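(* Under the standing assumptions (A1)–(A7) and (B1)–(B4) of the context, let $\{\mathcal P_i\}_{i=1}^\infty$ be a sequence of nested partitions $\mathcal P_i=\{0=t_{0,i}<\dots<t_{N_i,i}=t_{\mathrm f}\}$, $\mathcal P_i\subset\mathcal P_{i+1}$, with $\delta_{ki}:=t_{k+1,i}-t_{k,i}$ and $\lim_{i\to\infty}\max_k\delta_{ki}=0$. Define the Euler-discretized joint state-path and parameter log-posterior $\tilde\ell_i:\mathcal W_n^2\times\mathbb R^q\times\mathbb R^m\to\overline{\mathbb R}$ by $\tilde\ell_i(x,\zeta,\vartheta):=-\infty$ if $x\notin\mathrm{PL}(\mathcal P_i,\mathbb R^n)$ and, for $x\in\mathrm{PL}(\mathcal P_i,\mathbb R^n)$, $$\tilde\ell_i(x,\zeta,\vartheta):=\ln\psi(y\mid x,\tilde z_i,\vartheta)+\ln\pi(x(0),\zeta,\vartheta)-\frac12\sum_{k=0}^{N_i-1}\delta_{ki}\Big|\boldsymbol G^{-1}\Big[\tfrac{x(t_{k+1,i})-x(t_{k,i})}{\delta_{ki}}-f\big(t_{k,i},x(t_{k,i}),\tilde z_i(t_{k,i}),\vartheta\big)\Big]\Big|^2,$$ where $\tilde z_i\in\mathrm{PL}(\mathcal P_i,\mathbb R^q)$ is given by $\tilde z_i(0)=\zeta$ and $\tilde z_i(t)=\tilde z_i(t_{k,i})+(t-t_{k,i})\,h\big(t_{k,i},x(t_{k,i}),\tilde z_i(t_{k,i}),\vartheta\big)$ for $t\in(t_{k,i},t_{k+1,i}]$. Define the energy log-posterior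 $\ell_{\mathrm e}:\mathcal W_n^2\times\mathbb R^q\times\mathbb R^m\to\overline{\mathbb R}$ by $$\ell_{\mathrm e}(x,z_0,\theta):=\ln\psi(y\mid x,z,\theta)+\ln\pi(x(0),z_0,\theta)-\frac12\int_{\mathcal T}\Big|\boldsymbol G^{-1}\big[\dot x(t)-f(t,x(t),z(t),\theta)\big]\Big|^2dt,$$ where $z\in\mathcal W_q^2$ solves $\dot z(t)=h(t,x(t),z(t),\theta)$, $z(0)=z_0$. Then $\tilde\ell_i$ hypo-converges to $\ell_{\mathrm e}$ as $i\to\infty$.
   Context: Fix $t_{\mathrm f}>0$, $\mathcal T:=[0,t_{\mathrm f}]$, a probability space $(\Omega,\mathcal E,P)$ with a filtration $\{\mathcal E_t\}_{t\ge0}$, and an $n$-dimensional Wiener process $W$ with respect to it. $|\cdot|$ is the Euclidean norm and $\operatorname{supp}(P_\Theta)$ the topological support of the law of $\Theta$. The $\mathbb R^n$- and $\mathbb R^q$-valued processes $X,Z$ over $\mathcal T$ and the $\mathbb R^m$-valued random variable $\Theta$ satisfy $dX_t=f(t,X_t,Z_t,\Theta)\,dt+\boldsymbol G\,dW_t$, $dZ_t=h(t,X_t,Z_t,\Theta)\,dt$, with $f:\mathcal T\times\mathbb R^n\times\mathbb R^q\times\mathbb R^m\to\mathbb R^n$, $h:\mathcal T\times\mathbb R^n\times\mathbb R^q\times\mathbb R^m\to\mathbb R^q$, $\boldsymbol G\in\mathbb R^{n\times n}$. (A1) $X_0,Z_0,\Theta$ are $\mathcal E_0$-measurable. (A2)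 $X_0,Z_0,\Theta$ admit a continuous joint density $\pi:\mathbb R^n\times\mathbb R^q\times\mathbb R^m\to\mathbb R_{\ge0}$. (A3) $f$ and $h$ are uniformly continuous in all arguments on $\mathcal T\times\mathbb R^n\times\mathbb R^q\times\operatorname{supp}(P_\Theta)$. (A4) For each $\theta\in\operatorname{supp}(P_\Theta)$ there are $L_{\mathrm f}^\theta,L_{\mathrm h}^\theta>0$ such that for all $t\in\mathcal T$, $x,x'\in\mathbb R^n$, $z,z'\in\mathbb R^q$: $|f(t,x,z,\theta)-f(t,x',z',\theta)|\le L_{\mathrm f}^\theta(|x-x'|+|z-z'|)$ and $|h(t,x,z,\theta)-h(t,x',z',\theta)|\le L_{\mathrm h}^\theta(|x-x'|+|z-z'|)$. (A5) For all $t\in\mathcal T$ and $\theta\in\operatorname{supp}(P_\Theta)$, $f$ is twice differentiable in $x$ and differentiable in $t$ and $z$, with these first and second derivatives continuous in all arguments. (A6) $\boldsymbol G$ has full rank. (A7) $\mathrm E\big[\exp\big(\int_0^{t_{\mathrm f}}|\boldsymbol G^{-1}f(t,X_t,Z_t,\Theta)|^2dt\big)\big]<\infty$. (B1) A random variable $Y$ with values in a metric space $\mathcal Y$ is observed, with observed value $y$. (B2) There are a measure $\nu$ on $\mathcal Y$ and $\psi\ge0$ with $P(Y\in\mathbb B\mid X=x,Z=z,\Theta=\theta)=\int_{\mathbb B}\psi(y'\mid x,z,\theta)\,d\nu(y')$ for all Borel $\mathbb B$, continuous paths $x,z$, and $\theta\in\mathbb R^m$. (B3) $(x,z,\theta)\mapsto\psi(y\mid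 x,z,\theta)$ is continuous (supremum norm on paths). (B4) $\mathrm E[\psi(y\mid X,Z,\Theta)]>0$. $\mathcal W_n^2$ is the Hilbert space of absolutely continuous functions $\mathcal T\to\mathbb R^n$ with square-integrable weak derivative, with norm $\|a\|_{\mathcal W_n^2}=(|a(0)|^2+\int_0^{t_{\mathrm f}}|\dot a(t)|^2dt)^{1/2}$; $\mathrm{PL}(\mathcal P,\mathbb R^n)$ is the space of continuous piecewise linear functions $\mathcal T\to\mathbb R^n$ with breaks over $\mathcal P$. $\ln0:=-\infty$, and $\ell_{\mathrm e}(x,z_0,\theta):=-\infty$ whenever $\pi(x(0),z_0,\theta)=0$ (in particular when $\theta\notin\operatorname{supp}(P_\Theta)$). The space $\mathcal W_n^2\times\mathbb R^q\times\mathbb R^m$ carries the product topology. Hypo-convergence: functions $g_i:\mathcal X\to\overline{\mathbb R}$ on a first-countable space hypo-converge to $g$ iff (i) for every convergent sequence $u_i\to u$, $\limsup_ig_i(u_i)\le g(u)$; and (ii) for every $u\in\mathcal X$ there is a sequence $u_i\to u$ with $\liminf_ig_i(u_i)\ge g(u)$. *)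

theory Defs
  imports "HOL-Probability.Probability"
begin

subsection \<open>Path spaces over \<^term>\<open>{0..tf}\<close>\<close>

text \<open>Paths are functions \<^typ>\<open>real \<Rightarrow> 'a\<close> that are extensional on \<^term>\<open>{0..tf}\<close>, so that two
  paths are equal as soon as they agree on the time interval.\<close>

definition cont_paths :: "real \<Rightarrow> (real \<Rightarrow> 'a::euclidean_space) set" where
  "cont_paths tf = {x \<in> extensional {0..tf}. continuous_on {0..tf} x}"

definition sup_dist :: "real \<Rightarrow> (real \<Rightarrow> 'a::euclidean_space) \<Rightarrow> (real \<Rightarrow> 'a) \<Rightarrow> real" where
  "sup_dist tf x x' =
     (if x \<in> cont_paths tf \<and> x' \<in> cont_paths tf then SUP t\<in>{0..tf}. norm (x t - x' t) else 0)"

text \<open>The default value outside \<^term>\<open>cont_paths tf\<close> is there because \<^locale>\<open>Metric_space\<close> wants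
  nonnegativity and symmetry for all arguments.\<close>

lemma Metric_space_cont_paths:
  assumes "0 \<le> tf"
  shows "Metric_space (cont_paths tf) (sup_dist tf :: (real \<Rightarrow> 'a::euclidean_space) \<Rightarrow> _)"
proof -
  have bdd: "bdd_above ((\<lambda>t. norm (x t - x' t)) ` {0..tf})"
    if "x \<in> cont_paths tf" "x' \<in> cont_paths tf" for x x' :: "real \<Rightarrow> 'a"
    using that unfolding cont_paths_def
    by (intro bounded_imp_bdd_above compact_imp_bounded compact_continuous_image)
       (auto intro!: continuous_intros)
  have le: "norm (x t - x' t) \<le> sup_dist tf x x'"
    if "x \<in> cont_paths tf" "x' \<in> cont_paths tf" "t \<in> {0..tf}" for x x' :: "real \<Rightarrow> 'a" and t
    using that bdd[OF that(1,2)] by (auto simp: sup_dist_def intro!: cSUP_upper)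
  show ?thesis
  proof
    fix x x' x'' :: "real \<Rightarrow> 'a"
    show "0 \<le> sup_dist tf x x'"
    proof (cases "x \<in> cont_paths tf \<and> x' \<in> cont_paths tf")
      case True
      then show ?thesis
        using le[of x x' 0] assms order_trans[OF norm_ge_zero] by fastforce
    qed (auto simp: sup_dist_def)
    show "sup_dist tf x x' = sup_dist tf x' x"
      by (simp add: sup_dist_def norm_minus_commute)
    assume x: "x \<in> cont_paths tf" and x': "x' \<in> cont_paths tf"
    show "sup_dist tf x x' = 0 \<longleftrightarrow> x = x'"
    proof
      assume "sup_dist tf x x' = 0"
      then have "x t = x' t" if "t \<in> {0..tf}" for t
        using le[OF x x' that] by simp
      then show "x = x'"
        using x x' by (auto simp: cont_paths_def intro: extensionalityI)
    next
      assume "x = x'"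
      then show "sup_dist tf x x' = 0"
        using assms by (simp add: sup_dist_def)
    qed
    assume x'': "x'' \<in> cont_paths tf"
    have "norm (x t - x'' t) \<le> sup_dist tf x x' + sup_dist tf x' x''" if "t \<in> {0..tf}" for t
      using le[OF x x' that] le[OF x' x'' that] norm_triangle_ineq[of "x t - x' t" "x' t - x'' t"]
      by simp
    then show "sup_dist tf x x'' \<le> sup_dist tf x x' + sup_dist tf x' x''"
      using assms x x'' by (auto simp: sup_dist_def[of tf x x''] intro!: cSUP_least)
  qed
qed

definition cont_paths_topology :: "real \<Rightarrow> (real \<Rightarrow> 'a::euclidean_space) topology" where
  "cont_paths_topology tf = Metric_space.mtopology (cont_paths tf) (sup_dist tf)"

definition absolutely_continuous_path :: "real \<Rightarrow> (real \<Rightarrow> 'a::euclidean_space) \<Rightarrow> bool" where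
  "absolutely_continuous_path tf a \<longleftrightarrow>
     (\<forall>\<epsilon>>0. \<exists>\<delta>>0. \<forall>(n::nat) (l::nat \<Rightarrow> real) (r::nat \<Rightarrow> real).
        (\<forall>k<n. 0 \<le> l k \<and> l k \<le> r k \<and> r k \<le> tf) \<and>
        disjoint_family_on (\<lambda>k. {l k<..<r k}) {..<n} \<and>
        (\<Sum>k<n. r k - l k) < \<delta>
        \<longrightarrow> (\<Sum>k<n. norm (a (r k) - a (l k))) < \<epsilon>)"

text \<open>Test functions are the continuously differentiable functions with compact support in the
  open interval.\<close>

definition has_weak_derivative ::
    "real \<Rightarrow> (real \<Rightarrow> 'a::euclidean_space) \<Rightarrow> (real \<Rightarrow> 'a) \<Rightarrow> bool" where
  "has_weak_derivative tf a g \<longleftrightarrow>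
     set_integrable lborel {0..tf} g \<and>
     (\<forall>\<phi> \<phi>' :: real \<Rightarrow> real.
        (\<forall>t. (\<phi> has_real_derivative \<phi>' t) (at t)) \<and> continuous_on UNIV \<phi>' \<and>
        (\<exists>K. compact K \<and> K \<subseteq> {0<..<tf} \<and> (\<forall>t. t \<notin> K \<longrightarrow> \<phi> t = 0))
        \<longrightarrow> (LINT t:{0..tf}|lborel. \<phi>' t *\<^sub>R a t) = - (LINT t:{0..tf}|lborel. \<phi> t *\<^sub>R g t))"

text \<open>Weak derivatives are unique only up to null sets; the choice is immaterial below because
  \<^term>\<open>weak_derivative tf a\<close> is only ever used under an integral sign.\<close>

definition weak_derivative :: "real \<Rightarrow> (real \<Rightarrow> 'a::euclidean_space) \<Rightarrow> (real \<Rightarrow> 'a)" where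
  "weak_derivative tf a = (SOME g. has_weak_derivative tf a g)"

definition W2 :: "real \<Rightarrow> (real \<Rightarrow> 'a::euclidean_space) set" where
  "W2 tf = {a \<in> extensional {0..tf}. absolutely_continuous_path tf a \<and>
      (\<exists>g. has_weak_derivative tf a g \<and> set_integrable lborel {0..tf} (\<lambda>t. (norm (g t))\<^sup>2))}"

definition W2_norm :: "real \<Rightarrow> (real \<Rightarrow> 'a::euclidean_space) \<Rightarrow> real" where
  "W2_norm tf a =
     sqrt ((norm (a 0))\<^sup>2 + (LINT t:{0..tf}|lborel. (norm (weak_derivative tf a t))\<^sup>2))"

definition W2_topology :: "real \<Rightarrow> (real \<Rightarrow> 'a::euclidean_space) topology" where
  "W2_topology tf = Metric_space.mtopology (W2 tf) (\<lambda>a b. W2_norm tf (\<lambda>t. a t - b t))"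

subsection \<open>Hypo-convergence\<close>

definition hypo_converges ::
    "'a topology \<Rightarrow> (nat \<Rightarrow> 'a \<Rightarrow> ereal) \<Rightarrow> ('a \<Rightarrow> ereal) \<Rightarrow> bool" where
  "hypo_converges T g g' \<longleftrightarrow>
     (\<forall>u l. (\<forall>i. u i \<in> topspace T) \<and> limitin T u l sequentially
        \<longrightarrow> limsup (\<lambda>i. g i (u i)) \<le> g' l) \<and>
     (\<forall>l\<in>topspace T. \<exists>u. (\<forall>i. u i \<in> topspace T) \<and> limitin T u l sequentially \<and>
        g' l \<le> liminf (\<lambda>i. g i (u i)))"

subsection \<open>Probabilistic notions\<close>

definition law_support :: "'w measure \<Rightarrow> ('w \<Rightarrow> 'b::topological_space) \<Rightarrow> 'b set" where
  "law_support M V = {v. \<forall>U. open U \<and> v \<in> U \<longrightarrow> 0 < emeasure (distr M borel V) U}"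

text \<open>Filtrations and Wiener processes are indexed by the nonnegative reals; their values at
  negative times are irrelevant.\<close>

definition is_filtration :: "'w measure \<Rightarrow> (real \<Rightarrow> 'w measure) \<Rightarrow> bool" where
  "is_filtration M F \<longleftrightarrow>
     (\<forall>t\<ge>0. subalgebra M (F t)) \<and> (\<forall>s t. 0 \<le> s \<and> s \<le> t \<longrightarrow> sets (F s) \<subseteq> sets (F t))"

definition wiener_process ::
    "'w measure \<Rightarrow> (real \<Rightarrow> 'w measure) \<Rightarrow> (real \<Rightarrow> 'w \<Rightarrow> real^'n) \<Rightarrow> bool" where
  "wiener_process M F W \<longleftrightarrow>
     (\<forall>t\<ge>0. W t \<in> borel_measurable (F t)) \<and>
     (AE \<omega> in M. W 0 \<omega> = 0) \<and>
     (AE \<omega> in M. continuous_on {0..} (\<lambda>t. W t \<omega>)) \<and>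
     (\<forall>s t. 0 \<le> s \<and> s < t \<longrightarrow>
        prob_space.indep_set M (sets (F s))
          {(\<lambda>\<omega>. W t \<omega> - W s \<omega>) -` A \<inter> space M | A. A \<in> sets borel} \<and>
        distributed M lborel (\<lambda>\<omega>. W t \<omega> - W s \<omega>)
          (\<lambda>v. ennreal (\<Prod>j\<in>UNIV. normal_density 0 (sqrt (t - s)) (v $ j))))"

text \<open>Since \<^term>\<open>G\<close> is constant, the stochastic integral of \<^term>\<open>G\<close> is
  \<^term>\<open>G *v W t\<close>.\<close>

definition solves_sde ::
    "real \<Rightarrow> 'w measure \<Rightarrow> (real \<Rightarrow> 'w measure) \<Rightarrow> (real \<Rightarrow> 'w \<Rightarrow> real^'n) \<Rightarrow>
     (real \<Rightarrow> real^'n \<Rightarrow> real^'q \<Rightarrow> real^'m \<Rightarrow> real^'n) \<Rightarrow>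
     (real \<Rightarrow> real^'n \<Rightarrow> real^'q \<Rightarrow> real^'m \<Rightarrow> real^'q) \<Rightarrow> real^'n^'n \<Rightarrow>
     (real \<Rightarrow> 'w \<Rightarrow> real^'n) \<Rightarrow> (real \<Rightarrow> 'w \<Rightarrow> real^'q) \<Rightarrow> ('w \<Rightarrow> real^'m) \<Rightarrow> bool" where
  "solves_sde tf M F W f h G X Z \<Theta> \<longleftrightarrow>
     (\<forall>t\<in>{0..tf}. X t \<in> borel_measurable (F t) \<and> Z t \<in> borel_measurable (F t)) \<and>
     (AE \<omega> in M. continuous_on {0..tf} (\<lambda>t. X t \<omega>) \<and> continuous_on {0..tf} (\<lambda>t. Z t \<omega>)) \<and>
     (AE \<omega> in M. \<forall>t\<in>{0..tf}.
        set_integrable lborel {0..t} (\<lambda>s. f s (X s \<omega>) (Z s \<omega>) (\<Theta> \<omega>)) \<and>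
        set_integrable lborel {0..t} (\<lambda>s. h s (X s \<omega>) (Z s \<omega>) (\<Theta> \<omega>)) \<and>
        X t \<omega> = X 0 \<omega> + (LINT s:{0..t}|lborel. f s (X s \<omega>) (Z s \<omega>) (\<Theta> \<omega>)) + G *v W t \<omega> \<and>
        Z t \<omega> = Z 0 \<omega> + (LINT s:{0..t}|lborel. h s (X s \<omega>) (Z s \<omega>) (\<Theta> \<omega>)))"

definition sample_path :: "real \<Rightarrow> (real \<Rightarrow> 'w \<Rightarrow> 'a) \<Rightarrow> 'w \<Rightarrow> real \<Rightarrow> 'a" where
  "sample_path tf X \<omega> = restrict (\<lambda>t. X t \<omega>) {0..tf}"

definition paths_subalgebra ::
    "real \<Rightarrow> 'w measure \<Rightarrow> (real \<Rightarrow> 'w \<Rightarrow> real^'n) \<Rightarrow> (real \<Rightarrow> 'w \<Rightarrow> real^'q) \<Rightarrow>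
     ('w \<Rightarrow> real^'m) \<Rightarrow> 'w measure" where
  "paths_subalgebra tf M X Z \<Theta> =
     vimage_algebra (space M) (\<lambda>\<omega>. (sample_path tf X \<omega>, sample_path tf Z \<omega>, \<Theta> \<omega>))
       (PiM {0..tf} (\<lambda>_. borel) \<Otimes>\<^sub>M (PiM {0..tf} (\<lambda>_. borel) \<Otimes>\<^sub>M borel))"

text \<open>\<^term>\<open>\<psi>\<close> is a density with respect to \<^term>\<open>\<nu>\<close> of the regular conditional distribution of
  \<^term>\<open>Y\<close> given \<^term>\<open>(X, Z, \<Theta>)\<close>: for every fixed argument it is a probability density, and
  substituting the random paths and parameter yields a version of the conditional probability given
  the sigma-algebra generated by \<^term>\<open>(X, Z, \<Theta>)\<close>.\<close>

definition conditional_density ::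
    "real \<Rightarrow> 'w measure \<Rightarrow> (real \<Rightarrow> 'w \<Rightarrow> real^'n) \<Rightarrow> (real \<Rightarrow> 'w \<Rightarrow> real^'q) \<Rightarrow> ('w \<Rightarrow> real^'m) \<Rightarrow>
     ('w \<Rightarrow> 'y::metric_space) \<Rightarrow> 'y measure \<Rightarrow>
     ('y \<Rightarrow> (real \<Rightarrow> real^'n) \<Rightarrow> (real \<Rightarrow> real^'q) \<Rightarrow> real^'m \<Rightarrow> real) \<Rightarrow> bool" where
  "conditional_density tf M X Z \<Theta> Y \<nu> \<psi> \<longleftrightarrow>
     (\<forall>x\<in>cont_paths tf. \<forall>z\<in>cont_paths tf. \<forall>\<theta>.
        (\<forall>y. 0 \<le> \<psi> y x z \<theta>) \<and> (\<lambda>y. \<psi> y x z \<theta>) \<in> borel_measurable \<nu> \<and>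
        (\<integral>\<^sup>+y. ennreal (\<psi> y x z \<theta>) \<partial>\<nu>) = 1) \<and>
     (\<forall>B\<in>sets borel. AE \<omega> in M.
        real_cond_exp M (paths_subalgebra tf M X Z \<Theta>) (indicator (Y -` B \<inter> space M)) \<omega> =
        (LINT y:B|\<nu>. \<psi> y (sample_path tf X \<omega>) (sample_path tf Z \<omega>) (\<Theta> \<omega>)))"

subsection \<open>Regularity of the drift\<close>

text \<open>The derivatives in \<^term>\<open>t\<close> are one-sided at the endpoints of the time interval.\<close>

definition drift_C12 ::
    "real \<Rightarrow> (real^'m) set \<Rightarrow> (real \<Rightarrow> real^'n \<Rightarrow> real^'q \<Rightarrow> real^'m \<Rightarrow> real^'n) \<Rightarrow> bool" where
  "drift_C12 tf S f \<longleftrightarrow>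
     (\<exists>(fx :: real \<Rightarrow> real^'n \<Rightarrow> real^'q \<Rightarrow> real^'m \<Rightarrow> (real^'n) \<Rightarrow>\<^sub>L (real^'n))
        (fxx :: real \<Rightarrow> real^'n \<Rightarrow> real^'q \<Rightarrow> real^'m \<Rightarrow> (real^'n) \<Rightarrow>\<^sub>L ((real^'n) \<Rightarrow>\<^sub>L (real^'n)))
        (ft :: real \<Rightarrow> real^'n \<Rightarrow> real^'q \<Rightarrow> real^'m \<Rightarrow> real^'n)
        (fz :: real \<Rightarrow> real^'n \<Rightarrow> real^'q \<Rightarrow> real^'m \<Rightarrow> (real^'q) \<Rightarrow>\<^sub>L (real^'n)).
        (\<forall>t\<in>{0..tf}. \<forall>x z. \<forall>\<theta>\<in>S.
           ((\<lambda>x'. f t x' z \<theta>) has_derivative blinfun_apply (fx t x z \<theta>)) (at x) \<and>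
           ((\<lambda>x'. fx t x' z \<theta>) has_derivative blinfun_apply (fxx t x z \<theta>)) (at x) \<and>
           ((\<lambda>t'. f t' x z \<theta>) has_vector_derivative ft t x z \<theta>) (at t within {0..tf}) \<and>
           ((\<lambda>z'. f t x z' \<theta>) has_derivative blinfun_apply (fz t x z \<theta>)) (at z)) \<and>
        continuous_on ({0..tf} \<times> UNIV \<times> UNIV \<times> S) (\<lambda>(t, x, z, \<theta>). fx t x z \<theta>) \<and>
        continuous_on ({0..tf} \<times> UNIV \<times> UNIV \<times> S) (\<lambda>(t, x, z, \<theta>). fxx t x z \<theta>) \<and>
        continuous_on ({0..tf} \<times> UNIV \<times> UNIV \<times> S) (\<lambda>(t, x, z, \<theta>). ft t x z \<theta>) \<and>
        continuous_on ({0..tf} \<times> UNIV \<times> UNIV \<times> S) (\<lambda>(t, x, z, \<theta>). fz t x z \<theta>))"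

definition lipschitz_state ::
    "real \<Rightarrow> (real \<Rightarrow> real^'n \<Rightarrow> real^'q \<Rightarrow> real^'m \<Rightarrow> 'b::real_normed_vector) \<Rightarrow> real^'m \<Rightarrow> bool" where
  "lipschitz_state tf f \<theta> \<longleftrightarrow>
     (\<exists>L>0. \<forall>t\<in>{0..tf}. \<forall>x x' z z'.
        norm (f t x z \<theta> - f t x' z' \<theta>) \<le> L * (norm (x - x') + norm (z - z')))"

subsection \<open>Partitions, piecewise linear paths and the Euler scheme\<close>

text \<open>A partition is given by its number \<^term>\<open>N\<close> of intervals and its breaks
  \<^term>\<open>\<tau> ` {..N}\<close>; values of \<^term>\<open>\<tau>\<close> beyond \<^term>\<open>N\<close> are irrelevant.\<close>

definition is_partition :: "real \<Rightarrow> nat \<Rightarrow> (nat \<Rightarrow> real) \<Rightarrow> bool" where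
  "is_partition tf N \<tau> \<longleftrightarrow> \<tau> 0 = 0 \<and> \<tau> N = tf \<and> (\<forall>k<N. \<tau> k < \<tau> (Suc k))"

definition PL :: "real \<Rightarrow> nat \<Rightarrow> (nat \<Rightarrow> real) \<Rightarrow> (real \<Rightarrow> 'a::euclidean_space) set" where
  "PL tf N \<tau> = {x \<in> cont_paths tf.
     \<forall>k<N. \<exists>a b. \<forall>t\<in>{\<tau> k..\<tau> (Suc k)}. x t = a + t *\<^sub>R b}"

primrec euler_node ::
    "(real \<Rightarrow> real^'n \<Rightarrow> real^'q \<Rightarrow> real^'m \<Rightarrow> real^'q) \<Rightarrow> (nat \<Rightarrow> real) \<Rightarrow>
     (real \<Rightarrow> real^'n) \<Rightarrow> real^'q \<Rightarrow> real^'m \<Rightarrow> nat \<Rightarrow> real^'q" where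
  "euler_node h \<tau> x \<zeta> \<theta> 0 = \<zeta>"
| "euler_node h \<tau> x \<zeta> \<theta> (Suc k) = euler_node h \<tau> x \<zeta> \<theta> k +
     (\<tau> (Suc k) - \<tau> k) *\<^sub>R h (\<tau> k) (x (\<tau> k)) (euler_node h \<tau> x \<zeta> \<theta> k) \<theta>"

definition euler_path ::
    "real \<Rightarrow> nat \<Rightarrow> (nat \<Rightarrow> real) \<Rightarrow> (real \<Rightarrow> real^'n \<Rightarrow> real^'q \<Rightarrow> real^'m \<Rightarrow> real^'q) \<Rightarrow>
     (real \<Rightarrow> real^'n) \<Rightarrow> real^'q \<Rightarrow> real^'m \<Rightarrow> real \<Rightarrow> real^'q" where
  "euler_path tf N \<tau> h x \<zeta> \<theta> = restrict (\<lambda>t.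
     if t = 0 then \<zeta>
     else let k = (THE k. k < N \<and> t \<in> {\<tau> k<..\<tau> (Suc k)}) in
       euler_node h \<tau> x \<zeta> \<theta> k +
       (t - \<tau> k) *\<^sub>R h (\<tau> k) (x (\<tau> k)) (euler_node h \<tau> x \<zeta> \<theta> k) \<theta>) {0..tf}"

lemma euler_path_0: "0 \<le> tf \<Longrightarrow> euler_path tf N \<tau> h x \<zeta> \<theta> 0 = \<zeta>"
  by (simp add: euler_path_def)

lemma euler_path_step:
  fixes h :: "real \<Rightarrow> real^'n \<Rightarrow> real^'q \<Rightarrow> real^'m \<Rightarrow> real^'q"
  assumes \<tau>: "is_partition tf N \<tau>" and k: "k < N" and t: "t \<in> {\<tau> k<..\<tau> (Suc k)}"
    and z_def: "z = euler_path tf N \<tau> h x \<zeta> \<theta>"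
  shows "z t = z (\<tau> k) + (t - \<tau> k) *\<^sub>R h (\<tau> k) (x (\<tau> k)) (z (\<tau> k)) \<theta>"
proof -
  have mono: "\<tau> i \<le> \<tau> j" if "i \<le> j" "j \<le> N" for i j
    using that
  proof (induction j)
    case (Suc j)
    then have "\<tau> j < \<tau> (Suc j)"
      using \<tau> by (simp add: is_partition_def)
    with Suc show ?case
      by (cases "i = Suc j") auto
  qed auto
  have the: "(THE k. k < N \<and> s \<in> {\<tau> k<..\<tau> (Suc k)}) = j"
    if "j < N" "s \<in> {\<tau> j<..\<tau> (Suc j)}" for j s
  proof (rule the_equality)
    fix i assume i: "i < N \<and> s \<in> {\<tau> i<..\<tau> (Suc i)}"
    have "\<not> i < j" "\<not> j < i"
      using mono[of "Suc i" j] mono[of "Suc j" i] i that by auto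
    then show "i = j" by simp
  qed (use that in auto)
  have z: "z s = euler_node h \<tau> x \<zeta> \<theta> j +
      (s - \<tau> j) *\<^sub>R h (\<tau> j) (x (\<tau> j)) (euler_node h \<tau> x \<zeta> \<theta> j) \<theta>"
    if "j < N" "s \<in> {\<tau> j<..\<tau> (Suc j)}" for j s
  proof -
    have "s \<in> {0..tf}" "s \<noteq> 0"
      using mono[of 0 j] mono[of "Suc j" N] that \<tau> by (auto simp: is_partition_def)
    then show ?thesis
      using the[OF that] by (simp add: z_def euler_path_def Let_def)
  qed
  have "z (\<tau> k) = euler_node h \<tau> x \<zeta> \<theta> k"
  proof (cases k)
    case 0
    then show ?thesis
      using \<tau> mono[of 0 N] by (simp add: z_def euler_path_def is_partition_def)
  next
    case (Suc j)
    then show ?thesis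
      using z[of j "\<tau> k"] \<tau> k by (simp add: is_partition_def)
  qed
  then show ?thesis
    using z[OF k t] by simp
qed

subsection \<open>The log-posteriors\<close>

definition eln :: "real \<Rightarrow> ereal" where
  "eln r = (if r = 0 then -\<infinity> else ereal (ln r))"

definition euler_log_posterior ::
    "real \<Rightarrow> nat \<Rightarrow> (nat \<Rightarrow> real) \<Rightarrow>
     (real \<Rightarrow> real^'n \<Rightarrow> real^'q \<Rightarrow> real^'m \<Rightarrow> real^'n) \<Rightarrow>
     (real \<Rightarrow> real^'n \<Rightarrow> real^'q \<Rightarrow> real^'m \<Rightarrow> real^'q) \<Rightarrow> real^'n^'n \<Rightarrow>
     (real^'n \<Rightarrow> real^'q \<Rightarrow> real^'m \<Rightarrow> real) \<Rightarrow>
     ((real \<Rightarrow> real^'n) \<Rightarrow> (real \<Rightarrow> real^'q) \<Rightarrow> real^'m \<Rightarrow> real) \<Rightarrow>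
     (real \<Rightarrow> real^'n) \<times> (real^'q) \<times> (real^'m) \<Rightarrow> ereal" where
  "euler_log_posterior tf N \<tau> f h G \<pi> \<psi>\<^sub>y = (\<lambda>(x, \<zeta>, \<theta>).
     if x \<notin> PL tf N \<tau> then -\<infinity>
     else let z = euler_path tf N \<tau> h x \<zeta> \<theta> in
       eln (\<psi>\<^sub>y x z \<theta>) + eln (\<pi> (x 0) \<zeta> \<theta>) -
       ereal (1/2 * (\<Sum>k<N. (\<tau> (Suc k) - \<tau> k) *
         (norm (matrix_inv G *v
           ((x (\<tau> (Suc k)) - x (\<tau> k)) /\<^sub>R (\<tau> (Suc k) - \<tau> k) -
            f (\<tau> k) (x (\<tau> k)) (z (\<tau> k)) \<theta>)))\<^sup>2)))"

definition ode_path ::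
    "real \<Rightarrow> (real \<Rightarrow> real^'n \<Rightarrow> real^'q \<Rightarrow> real^'m \<Rightarrow> real^'q) \<Rightarrow>
     (real \<Rightarrow> real^'n) \<Rightarrow> real^'q \<Rightarrow> real^'m \<Rightarrow> real \<Rightarrow> real^'q" where
  "ode_path tf h x z0 \<theta> =
     (THE z. z \<in> W2 tf \<and> z 0 = z0 \<and> has_weak_derivative tf z (\<lambda>t. h t (x t) (z t) \<theta>))"

definition energy_log_posterior ::
    "real \<Rightarrow>
     (real \<Rightarrow> real^'n \<Rightarrow> real^'q \<Rightarrow> real^'m \<Rightarrow> real^'n) \<Rightarrow>
     (real \<Rightarrow> real^'n \<Rightarrow> real^'q \<Rightarrow> real^'m \<Rightarrow> real^'q) \<Rightarrow> real^'n^'n \<Rightarrow>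
     (real^'n \<Rightarrow> real^'q \<Rightarrow> real^'m \<Rightarrow> real) \<Rightarrow>
     ((real \<Rightarrow> real^'n) \<Rightarrow> (real \<Rightarrow> real^'q) \<Rightarrow> real^'m \<Rightarrow> real) \<Rightarrow>
     (real \<Rightarrow> real^'n) \<times> (real^'q) \<times> (real^'m) \<Rightarrow> ereal" where
  "energy_log_posterior tf f h G \<pi> \<psi>\<^sub>y = (\<lambda>(x, z0, \<theta>).
     if \<pi> (x 0) z0 \<theta> = 0 then -\<infinity>
     else let z = ode_path tf h x z0 \<theta> in
       eln (\<psi>\<^sub>y x z \<theta>) + eln (\<pi> (x 0) z0 \<theta>) -
       ereal (1/2 * (LINT t:{0..tf}|lborel.
         (norm (matrix_inv G *v (weak_derivative tf x t - f t (x t) (z t) \<theta>)))\<^sup>2)))"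

end

theory Submission
  imports Defs
begin

text \<open>
  Hypo-convergence holds because, for parameters in the support of the law of \<Theta>, the discretized
  log-posteriors are the restrictions to piecewise linear paths of functionals that converge along
  \<^emph>\<open>every\<close> convergent sequence, and because piecewise linear paths are dense.

  Let \<open>x\<^sub>i \<rightarrow> x\<close> in the Sobolev space, \<open>\<zeta>\<^sub>i \<rightarrow> z\<^sub>0\<close> and \<open>\<theta>\<^sub>i \<rightarrow> \<theta>\<close> with all parameters in the support.
  Sobolev convergence implies uniform convergence (\<open>norm_diff_le_W2_norm\<close>), and a discrete Gronwall
  argument shows that the Euler paths converge uniformly to the solution of the state equation
  (\<open>euler_path_uniform_limit\<close>). Hence the likelihood and the prior converge. For the energy, the
  key observation is that on a piecewise linear path the discrete sum is exactly the squared
  \<open>L\<^sup>2\<close> norm of \<open>G\<^sup>-\<^sup>1 (x\<^sub>i' - F\<^sub>i)\<close>, where \<open>F\<^sub>i\<close> is the drift sampled at the left ends of the cells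
  (\<open>PL_energy_eq_L2norm\<close>). This expression is meaningful for all Sobolev paths, and it converges
  since \<open>x\<^sub>i' \<rightarrow> x'\<close> in \<open>L\<^sup>2\<close> and \<open>F\<^sub>i\<close> converges uniformly (\<open>discrete_energy_tendsto\<close>).

  The upper bound follows, because off the piecewise linear paths the discretized log-posterior is
  \<open>-\<infinity>\<close>. Parameters outside the support have zero prior density, so there it is \<open>-\<infinity>\<close> too; such a
  parameter can be replaced by the limit \<open>\<theta>\<close>, which only increases the value. If \<open>\<theta>\<close> itself is outside
  the support, then so are all but finitely many \<open>\<theta>\<^sub>i\<close>, the support being closed.

  For the recovery sequence, \<open>x\<close> is replaced by its piecewise linear interpolants. Their derivatives
  are the cell averages of \<open>x'\<close>, and these converge to \<open>x'\<close> in \<open>L\<^sup>2\<close>: averaging is a contraction of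
  \<open>L\<^sup>2\<close>, and for continuous functions the convergence is uniform (\<open>cell_average_tendsto\<close>).

  All of this rests on the fundamental theorem of calculus for weak derivatives
  (\<open>weak_derivative_increment\<close>), which identifies a continuous path with the indefinite integral of its weak
  derivative. It makes weak derivatives unique almost everywhere and the Sobolev distance a metric.
\<close>

section \<open>Square-integrable functions\<close>

text \<open>Measurability is part of the notion, since it does not follow from integrability of the squared
norm.\<close>

definition square_integrable :: "'a measure \<Rightarrow> ('a \<Rightarrow> 'b::euclidean_space) \<Rightarrow> bool" where
  "square_integrable M g \<longleftrightarrow> g \<in> borel_measurable M \<and> integrable M (\<lambda>x. (norm (g x))\<^sup>2)"

definition L2norm :: "'a measure \<Rightarrow> ('a \<Rightarrow> 'b::euclidean_space) \<Rightarrow> real" where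
  "L2norm M g = sqrt (LINT x|M. (norm (g x))\<^sup>2)"

lemma square_integrable_measurable: "square_integrable M g \<Longrightarrow> g \<in> borel_measurable M"
  by (simp add: square_integrable_def)

lemma L2norm_nonneg [simp]: "0 \<le> L2norm M g"
  by (simp add: L2norm_def)

lemma L2norm_power2: "(L2norm M g)\<^sup>2 = (LINT x|M. (norm (g x))\<^sup>2)"
  by (simp add: L2norm_def)

text \<open>The difference of the two sides is at least \<open>(q |u| - p |v|)\<^sup>2 / (p q)\<close>.
Integrating this with \<open>p\<close> and \<open>q\<close> close to the norms of \<open>u\<close> and
\<open>v\<close> gives Minkowski's inequality.\<close>

lemma norm_add_power2_le_weighted:
  fixes u v :: "'b::euclidean_space"
  assumes "0 < p" "0 < q"
  shows "(norm (u + v))\<^sup>2 \<le> (p + q) / p * (norm u)\<^sup>2 + (p + q) / q * (norm v)\<^sup>2"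
proof -
  have "(norm (u + v))\<^sup>2 \<le> (norm u + norm v)\<^sup>2"
    by (simp add: norm_triangle_ineq power_mono)
  also have "\<dots> \<le> (norm u + norm v)\<^sup>2 + (q * norm u - p * norm v)\<^sup>2 / (p * q)"
    using assms by simp
  also have "\<dots> = (p + q) / p * (norm u)\<^sup>2 + (p + q) / q * (norm v)\<^sup>2"
    using assms by (simp add: field_simps power2_eq_square)
  finally show ?thesis .
qed

lemma square_integrable_add:
  assumes "square_integrable M u" "square_integrable M v"
  shows "square_integrable M (\<lambda>x. u x + v x)"
proof -
  have [measurable]: "u \<in> borel_measurable M" "v \<in> borel_measurable M"
    using assms by (auto simp: square_integrable_def)
  have "integrable M (\<lambda>x. 2 * (norm (u x))\<^sup>2 + 2 * (norm (v x))\<^sup>2)"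
    using assms by (auto simp: square_integrable_def)
  then have "integrable M (\<lambda>x. (norm (u x + v x))\<^sup>2)"
    by (rule Bochner_Integration.integrable_bound)
       (use norm_add_power2_le_weighted[of 1 1] in \<open>auto intro!: AE_I2\<close>)
  then show ?thesis
    by (simp add: square_integrable_def)
qed

lemma square_integrable_linear:
  assumes T: "bounded_linear T" and "square_integrable M u"
  shows "square_integrable M (\<lambda>x. T (u x))"
proof -
  have [measurable]: "u \<in> borel_measurable M" "T \<in> borel_measurable borel"
    using assms linear_continuous_on[OF T]
    by (auto simp: square_integrable_def intro: borel_measurable_continuous_onI)
  have "(norm (T (u x)))\<^sup>2 \<le> (onorm T)\<^sup>2 * (norm (u x))\<^sup>2" for x
    using power_mono[OF onorm[OF T] norm_ge_zero, of "u x" 2] by (simp add: power_mult_distrib)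
  moreover have "integrable M (\<lambda>x. (onorm T)\<^sup>2 * (norm (u x))\<^sup>2)"
    using assms by (auto simp: square_integrable_def)
  ultimately have "integrable M (\<lambda>x. (norm (T (u x)))\<^sup>2)"
    by (intro Bochner_Integration.integrable_bound[where g="\<lambda>x. (norm (T (u x)))\<^sup>2"
          and f="\<lambda>x. (onorm T)\<^sup>2 * (norm (u x))\<^sup>2"]) (auto intro!: AE_I2)
  then show ?thesis
    by (simp add: square_integrable_def)
qed

lemma square_integrable_uminus:
  "square_integrable M u \<Longrightarrow> square_integrable M (\<lambda>x. - u x)"
  by (simp add: square_integrable_def)

lemma square_integrable_diff:
  assumes "square_integrable M u" "square_integrable M v"
  shows "square_integrable M (\<lambda>x. u x - v x)"
  using square_integrable_add[OF assms(1) square_integrable_uminus[OF assms(2)]] by simp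

lemma square_integrable_AE_bounded:
  assumes "finite_measure M" "u \<in> borel_measurable M" "AE x in M. norm (u x) \<le> c"
  shows "square_integrable M u"
proof -
  interpret finite_measure M by fact
  have "AE x in M. norm ((norm (u x))\<^sup>2) \<le> c\<^sup>2"
    using assms(3) by eventually_elim (simp add: power_mono)
  then have "integrable M (\<lambda>x. (norm (u x))\<^sup>2)"
    using assms(2) by (intro integrable_const_bound[where B="c\<^sup>2"]) auto
  with assms(2) show ?thesis by (simp add: square_integrable_def)
qed

lemma integrable_of_square_integrable:
  assumes "finite_measure M" "square_integrable M u"
  shows "integrable M u"
proof -
  interpret finite_measure M by fact
  have "norm v \<le> 1 + (norm v)\<^sup>2" for v :: 'b
    using zero_le_power2[of "norm v - 1"] norm_ge_zero[of v]
    unfolding power2_diff one_power2 by linarith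
  moreover have "integrable M (\<lambda>x. 1 + (norm (u x))\<^sup>2)"
    using assms(2) by (auto simp: square_integrable_def)
  ultimately show ?thesis
    using assms(2)
    by (intro Bochner_Integration.integrable_bound[of M "\<lambda>x. 1 + (norm (u x))\<^sup>2" u])
       (auto simp: square_integrable_def intro!: AE_I2)
qed

lemma L2norm_cong_AE:
  assumes "u \<in> borel_measurable M" "v \<in> borel_measurable M" "AE x in M. u x = v x"
  shows "L2norm M u = L2norm M v"
  unfolding L2norm_def using assms by (intro arg_cong[where f=sqrt] integral_cong_AE) auto

lemma L2norm_triangle:
  assumes u: "square_integrable M u" and v: "square_integrable M v"
  shows "L2norm M (\<lambda>x. u x + v x) \<le> L2norm M u + L2norm M v"
proof -
  have weighted: "L2norm M (\<lambda>x. u x + v x) \<le> p + q"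
    if p: "L2norm M u < p" and q: "L2norm M v < q" for p q
  proof -
    have pos: "0 < p" "0 < q"
      using p q L2norm_nonneg[of M u] L2norm_nonneg[of M v] by linarith+
    have "(L2norm M (\<lambda>x. u x + v x))\<^sup>2
        \<le> (LINT x|M. (p + q) / p * (norm (u x))\<^sup>2 + (p + q) / q * (norm (v x))\<^sup>2)"
      unfolding L2norm_power2
      using u v square_integrable_add[OF u v] norm_add_power2_le_weighted[OF pos]
      by (intro integral_mono) (auto simp: square_integrable_def)
    also have "\<dots> = (p + q) / p * (L2norm M u)\<^sup>2 + (p + q) / q * (L2norm M v)\<^sup>2"
      unfolding L2norm_power2 using u v
      by (subst Bochner_Integration.integral_add) (auto simp: square_integrable_def)
    also have "\<dots> \<le> (p + q) / p * p\<^sup>2 + (p + q) / q * q\<^sup>2"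
      using p q pos by (intro add_mono mult_left_mono power_mono) auto
    also have "\<dots> = (p + q)\<^sup>2"
      using pos by (simp add: field_simps power2_eq_square)
    finally show ?thesis
      using pos by (auto intro: power2_le_imp_le)
  qed
  show ?thesis
  proof (rule field_le_epsilon)
    fix e :: real assume "0 < e"
    then show "L2norm M (\<lambda>x. u x + v x) \<le> L2norm M u + L2norm M v + e"
      using weighted[of "L2norm M u + e / 2" "L2norm M v + e / 2"] by simp
  qed
qed

lemma L2norm_uminus: "L2norm M (\<lambda>x. - u x) = L2norm M u"
  by (simp add: L2norm_def)

lemma L2norm_triangle_diff:
  assumes "square_integrable M u" "square_integrable M v"
  shows "\<bar>L2norm M u - L2norm M v\<bar> \<le> L2norm M (\<lambda>x. u x - v x)"
  using L2norm_triangle[OF square_integrable_diff[OF assms] assms(2)]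
    L2norm_triangle[OF square_integrable_uminus[OF square_integrable_diff[OF assms]] assms(1)]
  by (simp add: L2norm_uminus[of M "\<lambda>x. u x - v x", simplified])

lemma L2norm_linear_le:
  assumes T: "bounded_linear T" and u: "square_integrable M u"
  shows "L2norm M (\<lambda>x. T (u x)) \<le> onorm T * L2norm M u"
proof -
  have "(norm (T (u x)))\<^sup>2 \<le> (onorm T)\<^sup>2 * (norm (u x))\<^sup>2" for x
    using power_mono[OF onorm[OF T] norm_ge_zero, of "u x" 2] by (simp add: power_mult_distrib)
  then have "(L2norm M (\<lambda>x. T (u x)))\<^sup>2 \<le> (LINT x|M. (onorm T)\<^sup>2 * (norm (u x))\<^sup>2)"
    unfolding L2norm_power2
    using u square_integrable_linear[OF T u] by (intro integral_mono) (auto simp: square_integrable_def)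
  also have "\<dots> = (onorm T * L2norm M u)\<^sup>2"
    by (simp add: power_mult_distrib L2norm_power2)
  finally show ?thesis
    using onorm_pos_le[OF T] by (auto intro: power2_le_imp_le)
qed

lemma L2norm_le_AE_bound:
  assumes "finite_measure M" "u \<in> borel_measurable M" "AE x in M. norm (u x) \<le> c" "0 \<le> c"
  shows "L2norm M u \<le> c * sqrt (measure M (space M))"
proof -
  interpret finite_measure M by fact
  have "AE x in M. (norm (u x))\<^sup>2 \<le> c\<^sup>2"
    using assms(3) by eventually_elim (simp add: power_mono)
  then have "(LINT x|M. (norm (u x))\<^sup>2) \<le> (LINT x|M. c\<^sup>2)"
    using square_integrable_AE_bounded[OF assms(1-3)]
    by (intro integral_mono_AE) (auto simp: square_integrable_def)
  then have "L2norm M u \<le> sqrt (measure M (space M) * c\<^sup>2)"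
    by (simp add: L2norm_def)
  also have "\<dots> = c * sqrt (measure M (space M))"
    using assms(4) by (simp add: real_sqrt_mult)
  finally show ?thesis .
qed

text \<open>Cauchy--Schwarz against the constant function: expand \<open>\<integral>|c u - m|\<^sup>2 \<ge>
0\<close>, where \<open>c\<close> is the total mass and \<open>m\<close> the integral of
\<open>u\<close>.\<close>

lemma norm_integral_power2_le:
  assumes "finite_measure M" and u: "square_integrable M u"
  shows "(norm (integral\<^sup>L M u))\<^sup>2 \<le> measure M (space M) * (LINT x|M. (norm (u x))\<^sup>2)"
proof -
  interpret finite_measure M by fact
  define c where "c = measure M (space M)"
  define m where "m = integral\<^sup>L M u"
  have int: "integrable M u"
    by (rule integrable_of_square_integrable[OF assms])
  have sq: "integrable M (\<lambda>x. (norm (u x))\<^sup>2)"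
    using u by (simp add: square_integrable_def)
  have expand: "(norm (c *\<^sub>R u x - m))\<^sup>2 = c\<^sup>2 * (norm (u x))\<^sup>2 - 2 * c * (u x \<bullet> m) + (norm m)\<^sup>2" for x
    unfolding power2_norm_eq_inner
    by (simp add: inner_diff_left inner_diff_right inner_commute power2_eq_square algebra_simps)
  have "0 \<le> (LINT x|M. (norm (c *\<^sub>R u x - m))\<^sup>2)"
    by simp
  also have "\<dots> = c\<^sup>2 * (LINT x|M. (norm (u x))\<^sup>2) - 2 * c * (m \<bullet> m) + c * (norm m)\<^sup>2"
    unfolding expand using int sq by (simp add: c_def m_def)
  also have "\<dots> = c * (c * (LINT x|M. (norm (u x))\<^sup>2) - (norm m)\<^sup>2)"
    unfolding power2_norm_eq_inner by (simp add: power2_eq_square algebra_simps)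
  finally have *: "0 \<le> c * (c * (LINT x|M. (norm (u x))\<^sup>2) - (norm m)\<^sup>2)" .
  show ?thesis
  proof (cases "c = 0")
    case True
    then have "space M \<in> null_sets M"
      by (auto simp: c_def measure_eq_0_null_sets emeasure_eq_measure)
    then have "AE x in M. u x = 0"
      by (auto intro: AE_I'[where N="space M"])
    then have "m = 0"
      unfolding m_def using int by (subst integral_cong_AE[where g="\<lambda>_. 0"]) auto
    with True show ?thesis by (simp add: m_def c_def)
  next
    case False
    then have "0 < c" by (simp add: c_def zero_less_measure_iff measure_nonneg less_le)
    with * show ?thesis by (simp add: zero_le_mult_iff c_def m_def)
  qed
qed

lemma norm_integral_le_L2norm:
  assumes "finite_measure M" "square_integrable M u"
  shows "norm (integral\<^sup>L M u) \<le> sqrt (measure M (space M)) * L2norm M u"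
  using real_sqrt_le_mono[OF norm_integral_power2_le[OF assms]]
  by (simp add: L2norm_def real_sqrt_mult)

section \<open>Lebesgue measure on a compact interval\<close>

text \<open>Integrals over an interval become integrals with respect to a finite measure, to which the theory
of square-integrable functions applies.\<close>

definition Icc_measure :: "real \<Rightarrow> real \<Rightarrow> real measure" where
  "Icc_measure a b = restrict_space lborel {a..b}"

lemma space_Icc_measure [simp]: "space (Icc_measure a b) = {a..b}"
  by (simp add: Icc_measure_def space_restrict_space)

lemma finite_Icc_measure [simp]: "finite_measure (Icc_measure a b)"
proof (rule finite_measureI)
  show "emeasure (Icc_measure a b) (space (Icc_measure a b)) \<noteq> \<infinity>"
    by (cases "a \<le> b") (simp_all add: Icc_measure_def emeasure_restrict_space)
qed

lemma measure_Icc_measure [simp]: "a \<le> b \<Longrightarrow> measure (Icc_measure a b) {a..b} = b - a"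
  by (simp add: Icc_measure_def measure_restrict_space)

lemma set_integrable_Icc:
  fixes g :: "real \<Rightarrow> 'a::euclidean_space"
  shows "set_integrable lborel {a..b} g \<longleftrightarrow> integrable (Icc_measure a b) g"
  by (simp add: Icc_measure_def set_integrable_def integrable_restrict_space)

lemma set_integral_Icc:
  fixes g :: "real \<Rightarrow> 'a::euclidean_space"
  shows "(LINT t:{a..b}|lborel. g t) = (LINT t|Icc_measure a b. g t)"
  by (simp add: Icc_measure_def set_lebesgue_integral_def integral_restrict_space)

lemma AE_Icc: "(AE t in Icc_measure a b. P t) \<longleftrightarrow> (AE t in lborel. t \<in> {a..b} \<longrightarrow> P t)"
  unfolding Icc_measure_def by (rule AE_restrict_space_iff) simp

lemma AE_Icc_I: "(\<And>t. a \<le> t \<Longrightarrow> t \<le> b \<Longrightarrow> P t) \<Longrightarrow> AE t in Icc_measure a b. P t"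
  by (auto simp: AE_Icc)

lemma AE_Icc_except_finite:
  assumes "finite D" "\<And>t. a \<le> t \<Longrightarrow> t \<le> b \<Longrightarrow> t \<notin> D \<Longrightarrow> P t"
  shows "AE t in Icc_measure a b. P t"
proof -
  have "AE t in lborel. t \<notin> D"
    using assms(1) by (intro AE_not_in finite_imp_null_set_lborel)
  then show ?thesis
    unfolding AE_Icc by eventually_elim (use assms(2) in auto)
qed

lemma measurable_Icc_borel:
  "g \<in> borel_measurable borel \<Longrightarrow> g \<in> borel_measurable (Icc_measure a b)"
  by (simp add: Icc_measure_def measurable_restrict_space1)

lemma measurable_Icc_continuous:
  fixes g :: "real \<Rightarrow> 'a::euclidean_space"
  assumes "continuous_on {a..b} g"
  shows "g \<in> borel_measurable (Icc_measure a b)"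
proof -
  have "sets (Icc_measure a b) = sets (restrict_space borel {a..b})"
    unfolding Icc_measure_def by (rule sets_restrict_space_cong) simp
  then show ?thesis
    using borel_measurable_continuous_on_restrict[OF assms]
    by (subst measurable_cong_sets[OF _ refl])
qed

lemma continuous_bounded_Icc:
  fixes g :: "real \<Rightarrow> 'a::euclidean_space"
  assumes "continuous_on {a..b} g"
  obtains c where "0 \<le> c" "\<And>t. t \<in> {a..b} \<Longrightarrow> norm (g t) \<le> c"
proof -
  have "bounded (g ` {a..b})"
    using assms compact_continuous_image compact_imp_bounded by blast
  then obtain c where "0 < c" "\<forall>v\<in>g ` {a..b}. norm v \<le> c"
    unfolding bounded_pos by blast
  then show ?thesis
    using that[of c] by auto
qed

lemma square_integrable_Icc_continuous:
  fixes g :: "real \<Rightarrow> 'a::euclidean_space"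
  assumes "continuous_on {a..b} g"
  shows "square_integrable (Icc_measure a b) g"
proof -
  obtain c where "0 \<le> c" "\<And>t. t \<in> {a..b} \<Longrightarrow> norm (g t) \<le> c"
    using continuous_bounded_Icc[OF assms] by blast
  then show ?thesis
    by (intro square_integrable_AE_bounded[where c=c] measurable_Icc_continuous AE_Icc_I assms) auto
qed

lemma integrable_Icc_continuous:
  fixes g :: "real \<Rightarrow> 'a::euclidean_space"
  assumes "continuous_on {a..b} g"
  shows "integrable (Icc_measure a b) g"
  by (intro integrable_of_square_integrable square_integrable_Icc_continuous assms) simp

lemma integrable_Icc_subset:
  fixes g :: "real \<Rightarrow> 'a::euclidean_space"
  assumes "integrable (Icc_measure a b) g" "a \<le> c" "d \<le> b"
  shows "integrable (Icc_measure c d) g"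
  using assms set_integrable_subset[of lborel "{a..b}" g "{c..d}"]
  by (simp add: set_integrable_Icc[symmetric])

lemma square_integrable_Icc_subset:
  fixes g :: "real \<Rightarrow> 'a::euclidean_space"
  assumes "square_integrable (Icc_measure a b) g" "a \<le> c" "d \<le> b"
  shows "square_integrable (Icc_measure c d) g"
proof -
  have "integrable (Icc_measure c d) (\<lambda>t. (norm (g t))\<^sup>2)"
    using assms integrable_Icc_subset[of a b "\<lambda>t. (norm (g t))\<^sup>2" c d]
    by (simp add: square_integrable_def)
  moreover have "integrable (Icc_measure c d) g"
    using assms by (auto intro: integrable_Icc_subset[OF integrable_of_square_integrable])
  ultimately show ?thesis
    by (auto simp: square_integrable_def)
qed

lemma integral_indicator_Icc:
  fixes g :: "real \<Rightarrow> 'a::euclidean_space"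
  assumes "a \<le> c" "d \<le> b"
  shows "(LINT t|Icc_measure a b. indicator {c<..d} t *\<^sub>R g t) = (LINT t|Icc_measure c d. g t)"
proof -
  have "(LINT t|Icc_measure a b. indicator {c<..d} t *\<^sub>R g t)
      = (LINT t:{a..b}|lborel. indicator {c<..d} t *\<^sub>R g t)"
    by (rule set_integral_Icc[symmetric])
  also have "\<dots> = (LINT t:{c<..d}|lborel. g t)"
    unfolding set_lebesgue_integral_def using assms
    by (intro Bochner_Integration.integral_cong) (auto split: split_indicator)
  also have "\<dots> = (LINT t:{c..d}|lborel. g t)"
    by (rule set_integral_discrete_difference[where X="{c}"]) auto
  finally show ?thesis
    by (simp add: set_integral_Icc)
qed

lemma integral_Icc_HK:
  fixes g :: "real \<Rightarrow> 'a::euclidean_space"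
  assumes "integrable (Icc_measure a b) g"
  shows "g integrable_on {a..b}" "(LINT t|Icc_measure a b. g t) = integral {a..b} g"
  using set_borel_integral_eq_integral[of "{a..b}" g] assms
  by (auto simp: set_integrable_Icc set_integral_Icc)

lemma integral_Icc_combine:
  fixes g :: "real \<Rightarrow> 'a::euclidean_space"
  assumes "integrable (Icc_measure a b) g" "a \<le> c" "c \<le> b"
  shows "(LINT t|Icc_measure a b. g t) = (LINT t|Icc_measure a c. g t) + (LINT t|Icc_measure c b. g t)"
  using assms integrable_Icc_subset[OF assms(1), of a c] integrable_Icc_subset[OF assms(1), of c b]
  by (simp add: integral_Icc_HK Henstock_Kurzweil_Integration.integral_combine)

lemma continuous_on_indefinite_integral_Icc:
  fixes g :: "real \<Rightarrow> 'a::euclidean_space"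
  assumes "integrable (Icc_measure a b) g"
  shows "continuous_on {a..b} (\<lambda>t. LINT s|Icc_measure a t. g s)"
proof (rule continuous_on_eq)
  show "continuous_on {a..b} (\<lambda>t. integral {a..t} g)"
    by (intro indefinite_integral_continuous_1 integral_Icc_HK assms)
  show "integral {a..t} g = (LINT s|Icc_measure a t. g s)" if "t \<in> {a..b}" for t
    using that integrable_Icc_subset[OF assms, of a t] by (simp add: integral_Icc_HK)
qed

text \<open>The half-lines form an intersection-stable generator of the Borel sets, so \<open>g\<close>
integrates to zero over every Borel set.\<close>

lemma AE_zero_of_indefinite_integral_zero:
  fixes g :: "real \<Rightarrow> 'a::euclidean_space"
  assumes g: "integrable (Icc_measure a b) g" and "a \<le> b"
    and zero: "\<And>t. a \<le> t \<Longrightarrow> t \<le> b \<Longrightarrow> (LINT s|Icc_measure a t. g s) = 0"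
  shows "AE t in Icc_measure a b. g t = 0"
proof -
  define k where "k = (\<lambda>t. indicator {a..b} t *\<^sub>R g t)"
  have k: "integrable lborel k"
    using g by (simp add: k_def set_integrable_Icc[symmetric] set_integrable_def)
  have "(LINT t:A|lborel. k t) = 0" if "A \<in> sets borel" for A
  proof -
    have "Int_stable (range (\<lambda>x::real. {..x}))"
      by (auto simp: Int_stable_def)
    moreover have "range (\<lambda>x::real. {..x}) \<subseteq> Pow UNIV"
      by simp
    moreover have "A \<in> sigma_sets UNIV (range (\<lambda>x::real. {..x}))"
      using that by (simp add: borel_eq_atMost)
    ultimately show ?thesis
    proof (induction rule: sigma_sets_induct_disjoint)
      case (basic A)
      then obtain c where A: "A = {..c}" by auto
      have "(LINT t:A|lborel. k t) = (LINT t:{a..min b c}|lborel. g t)"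
        unfolding set_lebesgue_integral_def k_def A
        by (intro Bochner_Integration.integral_cong) (auto split: split_indicator)
      also have "\<dots> = 0"
      proof (cases "a \<le> c")
        case True
        then show ?thesis
          using zero[of "min b c"] \<open>a \<le> b\<close> by (simp add: set_integral_Icc)
      next
        case False
        then have "{a..min b c} = {}" by auto
        then show ?thesis by (simp add: set_lebesgue_integral_def)
      qed
      finally show ?case .
    next
      case empty
      show ?case by (simp add: set_lebesgue_integral_def)
    next
      case (compl A)
      have A: "A \<in> sets borel"
        using compl by (simp add: borel_eq_atMost)
      have "(LINT t:UNIV|lborel. k t) = (LINT t:(UNIV - A)|lborel. k t) + (LINT t:A|lborel. k t)"
        using A k by (subst set_integral_Un[symmetric])
          (auto simp: Un_Diff set_integrable_def intro!: integrable_mult_indicator)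
      moreover have "(LINT t:UNIV|lborel. k t) = (LINT t|Icc_measure a b. g t)"
        by (simp add: k_def set_integral_Icc[symmetric] set_lebesgue_integral_def)
      ultimately show ?case
        using compl zero[of b] \<open>a \<le> b\<close> by simp
    next
      case (union A)
      have A: "A i \<in> sets borel" for i
        using union(2) by (auto simp: borel_eq_atMost)
      have "(LINT t:(\<Union>i. A i)|lborel. k t) = (\<Sum>i. (LINT t:A i|lborel. k t))"
        using A k union(1)
        by (intro lebesgue_integral_countable_add)
           (auto simp: set_integrable_def disjoint_family_on_def intro!: integrable_mult_indicator)
      then show ?case using union by simp
    qed
  qed
  then have "AE t in lborel. k t = 0"
    using k sigma_finite_measure.density_zero[OF sigma_finite_lborel, of k] by simp
  then show ?thesis
    unfolding AE_Icc by eventually_elim (auto simp: k_def)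
qed

section \<open>Weak derivatives of continuous paths\<close>

text \<open>The tent of height 2 over the unit interval, which has integral one.\<close>

definition hat :: "real \<Rightarrow> real" where
  "hat u = 4 * (max 0 u - 2 * max 0 (u - 1/2) + max 0 (u - 1))"

text \<open>A quadratic spline whose derivative is \<^const>\<open>hat\<close>: a continuously differentiable
transition from 0 to 1. Differences of two steeply rescaled translates are test functions that approximate the
indicator of an interval.\<close>

definition smooth_step :: "real \<Rightarrow> real" where
  "smooth_step u = 2 * ((max 0 u)\<^sup>2 - 2 * (max 0 (u - 1/2))\<^sup>2 + (max 0 (u - 1))\<^sup>2)"

lemma has_real_derivative_max_power2:
  "((\<lambda>u::real. (max 0 u)\<^sup>2) has_real_derivative 2 * max 0 u) (at u)"
proof -
  consider "u < 0" | "u = 0" | "0 < u" by linarith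
  then show ?thesis
  proof cases
    case 1
    have "((\<lambda>u::real. 0) has_real_derivative 0) (at u)" by simp
    then have "((\<lambda>u::real. (max 0 u)\<^sup>2) has_real_derivative 0) (at u)"
      by (rule DERIV_cong_ev[THEN iffD1, rotated -1, OF _ refl _ refl])
         (use eventually_nhds_in_open[of "{..<0}" u] 1 in \<open>auto elim: eventually_mono\<close>)
    with 1 show ?thesis by simp
  next
    case 2
    have "((\<lambda>t. (max 0 (0 + t))\<^sup>2 / t) \<longlongrightarrow> 0) (at (0::real))"
    proof (rule tendsto_rabs_zero_cancel, rule tendsto_sandwich)
      show "\<forall>\<^sub>F t in at (0::real). 0 \<le> \<bar>(max 0 (0 + t))\<^sup>2 / t\<bar>" by simp
      show "\<forall>\<^sub>F t in at (0::real). \<bar>(max 0 (0 + t))\<^sup>2 / t\<bar> \<le> \<bar>t\<bar>"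
        by (auto simp: max_def power2_eq_square)
      show "((\<lambda>t. \<bar>t\<bar>) \<longlongrightarrow> 0) (at (0::real))"
        by (intro tendsto_rabs_zero tendsto_ident_at)
    qed simp
    with 2 show ?thesis by (simp add: DERIV_def)
  next
    case 3
    have "((\<lambda>u::real. u\<^sup>2) has_real_derivative 2 * u) (at u)"
      by (auto intro!: derivative_eq_intros)
    then have "((\<lambda>u::real. (max 0 u)\<^sup>2) has_real_derivative 2 * u) (at u)"
      by (rule DERIV_cong_ev[THEN iffD1, rotated -1, OF _ refl _ refl])
         (use eventually_nhds_in_open[of "{0<..}" u] 3 in \<open>auto elim: eventually_mono\<close>)
    with 3 show ?thesis by simp
  qed
qed

lemma smooth_step_has_derivative: "(smooth_step has_real_derivative hat u) (at u)"
proof -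
  have shift: "((\<lambda>u::real. (max 0 (u - c))\<^sup>2) has_real_derivative 2 * max 0 (u - c)) (at u)" for c
  proof -
    have "((\<lambda>u. u - c) has_real_derivative 1) (at u)"
      by (auto intro!: derivative_eq_intros)
    from DERIV_chain2[OF has_real_derivative_max_power2 this] show ?thesis
      by simp
  qed
  show ?thesis
    unfolding smooth_step_def hat_def
    by (rule DERIV_cong[OF DERIV_cmult[OF DERIV_add[OF DERIV_diff[OF has_real_derivative_max_power2
              DERIV_cmult[OF shift]] shift]]]) simp
qed

lemma hat_nonneg: "0 \<le> hat u"
  by (simp add: hat_def max_def)

lemma hat_eq_0: "u \<le> 0 \<or> 1 \<le> u \<Longrightarrow> hat u = 0"
  by (auto simp: hat_def max_def)

lemma continuous_on_hat [continuous_intros]: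
  "continuous_on S g \<Longrightarrow> continuous_on S (\<lambda>x. hat (g x))"
  unfolding hat_def by (intro continuous_intros)

lemma smooth_step_eq_0: "u \<le> 0 \<Longrightarrow> smooth_step u = 0"
  by (simp add: smooth_step_def max_def)

lemma smooth_step_eq_1: "1 \<le> u \<Longrightarrow> smooth_step u = 1"
  by (simp add: smooth_step_def max_def power2_eq_square algebra_simps)

lemma mono_smooth_step: "u \<le> v \<Longrightarrow> smooth_step u \<le> smooth_step v"
  by (erule DERIV_nonneg_imp_nondecreasing[of u v smooth_step])
     (blast intro: smooth_step_has_derivative hat_nonneg)

lemma smooth_step_bounds: "0 \<le> smooth_step u" "smooth_step u \<le> 1"
  using mono_smooth_step[of "min u 0" u] mono_smooth_step[of u "max u 1"]
  by (simp_all add: smooth_step_eq_0 smooth_step_eq_1)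

lemma smooth_step_scaled_has_derivative:
  "((\<lambda>r. smooth_step (c * (r - s))) has_real_derivative c * hat (c * (r - s))) (at r)"
proof -
  have "((\<lambda>r. c * (r - s)) has_real_derivative c) (at r)"
    by (auto intro!: derivative_eq_intros)
  from DERIV_chain2[OF smooth_step_has_derivative this] show ?thesis
    by (simp add: mult.commute)
qed

text \<open>The rescaled tent has mass one and is concentrated on \<open>(s, s + 1/n)\<close>.\<close>

lemma hat_approximates_identity:
  fixes a :: "real \<Rightarrow> 'a::euclidean_space"
  assumes a: "continuous_on {0..tf} a" and s: "0 \<le> s" "s < tf"
  shows "(\<lambda>n. LINT r|Icc_measure 0 tf. (real n * hat (real n * (r - s))) *\<^sub>R a r) \<longlonglongrightarrow> a s"
proof (rule LIMSEQ_I)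
  fix e :: real assume "0 < e"
  then obtain d where d: "0 < d" "\<And>r. r \<in> {0..tf} \<Longrightarrow> \<bar>r - s\<bar> < d \<Longrightarrow> norm (a r - a s) < e / 2"
    using a s unfolding continuous_on_iff dist_norm
    by (metis atLeastAtMost_iff half_gt_zero less_eq_real_def real_norm_def)
  obtain n0 where n0: "max (1 / d) (1 / (tf - s)) < real n0"
    using reals_Archimedean2 by blast
  show "\<exists>n0. \<forall>n\<ge>n0. norm ((LINT r|Icc_measure 0 tf. (real n * hat (real n * (r - s))) *\<^sub>R a r) - a s) < e"
  proof (intro exI allI impI)
    fix n assume "n0 \<le> n"
    then have n: "1 / d < real n" "1 / (tf - s) < real n" "0 < real n"
      using n0 d(1) less_trans[of 0 "1 / d" "real n"] by auto
    have nd: "1 < real n * d" "1 < real n * (tf - s)"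
      using n d(1) s by (simp_all add: field_simps)
    define k where "k = (\<lambda>r. real n * hat (real n * (r - s)))"
    have k_cont: "continuous_on S k" for S
      unfolding k_def by (intro continuous_intros)
    have k_nonneg: "0 \<le> k r" for r
      by (simp add: k_def hat_nonneg)
    have "(k has_integral smooth_step (real n * (tf - s)) - smooth_step (real n * (0 - s))) {0..tf}"
      using s smooth_step_scaled_has_derivative[of "real n" s] unfolding k_def
      by (intro fundamental_theorem_of_calculus)
         (auto simp: has_real_derivative_iff_has_vector_derivative[symmetric]
           intro: has_field_derivative_at_within)
    then have k1: "(LINT r|Icc_measure 0 tf. k r) = 1"
      using s nd integral_Icc_HK(2)[OF integrable_Icc_continuous[OF k_cont], of 0 tf]
      by (simp add: integral_unique smooth_step_eq_0 smooth_step_eq_1)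
    have int: "integrable (Icc_measure 0 tf) (\<lambda>r. k r *\<^sub>R a r)" "integrable (Icc_measure 0 tf) (\<lambda>r. k r *\<^sub>R a s)"
      "integrable (Icc_measure 0 tf) k"
      by (intro integrable_Icc_continuous continuous_intros k_cont a)+
    have "(LINT r|Icc_measure 0 tf. k r *\<^sub>R a r) - a s
        = (LINT r|Icc_measure 0 tf. k r *\<^sub>R (a r - a s))"
      using int k1 by (simp add: scaleR_diff_right)
    also have "norm \<dots> \<le> (LINT r|Icc_measure 0 tf. k r * (e / 2))"
    proof (rule Bochner_Integration.integral_norm_bound_integral)
      show "integrable (Icc_measure 0 tf) (\<lambda>r. k r *\<^sub>R (a r - a s))"
        by (intro integrable_Icc_continuous continuous_intros k_cont a)
      show "integrable (Icc_measure 0 tf) (\<lambda>r. k r * (e / 2))"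
        using int by simp
      fix r assume r: "r \<in> space (Icc_measure 0 tf)"
      show "norm (k r *\<^sub>R (a r - a s)) \<le> k r * (e / 2)"
      proof (cases "k r = 0")
        case False
        then have "\<not> (real n * (r - s) \<le> 0 \<or> 1 \<le> real n * (r - s))"
          using hat_eq_0[of "real n * (r - s)"] unfolding k_def by (metis mult_zero_right)
        then have "0 < real n * (r - s)" "real n * (r - s) < 1"
          by (simp_all only: de_Morgan_disj not_le)
        then have "0 < r - s" "real n * (r - s) < real n * d"
          using n(3) nd(1) zero_less_mult_pos[of "real n" "r - s"] by linarith+
        then have "\<bar>r - s\<bar> < d"
          using n(3) mult_less_cancel_left_pos[of "real n" "r - s" d] by linarith
        then show ?thesis
          using mult_left_mono[OF less_imp_le[OF d(2)] k_nonneg[of r], of r] r k_nonneg[of r] by simp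
      qed simp
    qed
    also have "\<dots> < e"
      using k1 \<open>0 < e\<close> by simp
    finally show "norm ((LINT r|Icc_measure 0 tf. (real n * hat (real n * (r - s))) *\<^sub>R a r) - a s) < e"
      by (simp add: k_def)
  qed
qed

lemma has_weak_derivative_Icc:
  "has_weak_derivative tf a g \<longleftrightarrow>
     integrable (Icc_measure 0 tf) g \<and>
     (\<forall>\<phi> \<phi>' :: real \<Rightarrow> real.
        (\<forall>t. (\<phi> has_real_derivative \<phi>' t) (at t)) \<and> continuous_on UNIV \<phi>' \<and>
        (\<exists>K. compact K \<and> K \<subseteq> {0<..<tf} \<and> (\<forall>t. t \<notin> K \<longrightarrow> \<phi> t = 0))
        \<longrightarrow> (LINT t|Icc_measure 0 tf. \<phi>' t *\<^sub>R a t) = - (LINT t|Icc_measure 0 tf. \<phi> t *\<^sub>R g t))"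
  by (simp add: has_weak_derivative_def set_integrable_Icc set_integral_Icc)

text \<open>Test with the difference of two smooth steps at \<open>s\<close> and \<open>t\<close>. Its
derivative acts on \<open>a\<close> like the difference of two point evaluations, and the function itself
converges boundedly to the indicator of \<open>(s, t]\<close>.\<close>

lemma weak_derivative_increment_interior:
  fixes a :: "real \<Rightarrow> 'a::euclidean_space"
  assumes a: "continuous_on {0..tf} a" and g: "has_weak_derivative tf a g"
    and st: "0 < s" "s < t" "t < tf"
  shows "a t - a s = (LINT r|Icc_measure s t. g r)"
proof -
  define \<phi> where "\<phi> = (\<lambda>n r. smooth_step (real n * (r - s)) - smooth_step (real n * (r - t)))"
  define \<phi>' where "\<phi>' = (\<lambda>n r. real n * hat (real n * (r - s)) - real n * hat (real n * (r - t)))"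
  have int_g: "integrable (Icc_measure 0 tf) g"
    using g by (simp add: has_weak_derivative_Icc)
  have test: "(LINT r|Icc_measure 0 tf. \<phi>' n r *\<^sub>R a r) = - (LINT r|Icc_measure 0 tf. \<phi> n r *\<^sub>R g r)"
    if n: "2 / (tf - t) < real n" for n
  proof -
    have "0 < real n"
      using n st less_trans[of 0 "2 / (tf - t)" "real n"] by simp
    have gap: "2 < real n * (tf - t)"
      using n st by (simp add: field_simps)
    \<comment> \<open>Both steps are complete to the right of t + 1/n, which is less than the midpoint (t + tf) / 2.\<close>
    have "\<phi> n r = 0" if "r \<notin> {s..(t + tf) / 2}" for r
    proof (cases "r < s")
      case True
      then show ?thesis
        using st \<open>0 < real n\<close> by (simp add: \<phi>_def smooth_step_eq_0 mult_le_0_iff)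
    next
      case False
      then have "real n * ((tf - t) / 2) \<le> real n * (r - t)"
        using that \<open>0 < real n\<close> by (intro mult_left_mono) auto
      then have "1 \<le> real n * (r - t)"
        using gap by simp
      moreover have "real n * (r - t) \<le> real n * (r - s)"
        using st by (intro mult_left_mono) auto
      ultimately show ?thesis
        by (simp add: \<phi>_def smooth_step_eq_1)
    qed
    moreover have "(\<phi> n has_real_derivative \<phi>' n r) (at r)" for r
      unfolding \<phi>_def \<phi>'_def by (intro DERIV_diff smooth_step_scaled_has_derivative)
    moreover have "continuous_on UNIV (\<phi>' n)"
      unfolding \<phi>'_def by (intro continuous_intros)
    moreover have "compact {s..(t + tf) / 2}" "{s..(t + tf) / 2} \<subseteq> {0<..<tf}"
      using st by auto
    ultimately show ?thesis
      using g unfolding has_weak_derivative_Icc by blast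
  qed
  have "(\<lambda>n. (LINT r|Icc_measure 0 tf. (real n * hat (real n * (r - s))) *\<^sub>R a r)
      - (LINT r|Icc_measure 0 tf. (real n * hat (real n * (r - t))) *\<^sub>R a r)) \<longlonglongrightarrow> a s - a t"
    using st by (intro tendsto_diff hat_approximates_identity a) auto
  moreover have "(LINT r|Icc_measure 0 tf. (real n * hat (real n * (r - s))) *\<^sub>R a r)
      - (LINT r|Icc_measure 0 tf. (real n * hat (real n * (r - t))) *\<^sub>R a r)
      = (LINT r|Icc_measure 0 tf. \<phi>' n r *\<^sub>R a r)" for n
    unfolding \<phi>'_def scaleR_diff_left
    by (intro Bochner_Integration.integral_diff[symmetric] integrable_Icc_continuous continuous_intros a)
  ultimately have lim_a: "(\<lambda>n. LINT r|Icc_measure 0 tf. \<phi>' n r *\<^sub>R a r) \<longlonglongrightarrow> a s - a t"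
    by simp
  have lim_g: "(\<lambda>n. LINT r|Icc_measure 0 tf. \<phi> n r *\<^sub>R g r)
      \<longlonglongrightarrow> (LINT r|Icc_measure 0 tf. indicator {s<..t} r *\<^sub>R g r)"
  proof (rule integral_dominated_convergence[where w="\<lambda>r. norm (g r)"])
    have meas: "g \<in> borel_measurable (Icc_measure 0 tf)"
      using int_g by simp
    show "integrable (Icc_measure 0 tf) (\<lambda>r. norm (g r))"
      using int_g by simp
    show "(\<lambda>r. indicator {s<..t} r *\<^sub>R g r) \<in> borel_measurable (Icc_measure 0 tf)"
      by (intro borel_measurable_scaleR meas measurable_Icc_borel) simp
    show "(\<lambda>r. \<phi> n r *\<^sub>R g r) \<in> borel_measurable (Icc_measure 0 tf)" for n
      unfolding \<phi>_def smooth_step_def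
      by (intro borel_measurable_scaleR meas measurable_Icc_borel) measurable
    show "AE r in Icc_measure 0 tf. norm (\<phi> n r *\<^sub>R g r) \<le> norm (g r)" for n
    proof (rule AE_I2)
      fix r
      have "\<bar>\<phi> n r\<bar> \<le> 1"
        using smooth_step_bounds[of "real n * (r - s)"] smooth_step_bounds[of "real n * (r - t)"]
        unfolding \<phi>_def by linarith
      then show "norm (\<phi> n r *\<^sub>R g r) \<le> norm (g r)"
        by (simp add: mult_left_le_one_le)
    qed
    show "AE r in Icc_measure 0 tf. (\<lambda>n. \<phi> n r *\<^sub>R g r) \<longlonglongrightarrow> indicator {s<..t} r *\<^sub>R g r"
    proof (rule AE_I2)
      fix r
      have step: "(\<lambda>n. smooth_step (real n * (r - c))) \<longlonglongrightarrow> (if r \<le> c then 0 else 1)" for c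
      proof (cases "r \<le> c")
        case True
        then show ?thesis by (simp add: smooth_step_eq_0 mult_le_0_iff)
      next
        case False
        then have "\<forall>\<^sub>F n in sequentially. 1 / (r - c) < real n"
          using filterlim_real_sequentially eventually_gt_at_top filterlim_iff by blast
        then have "\<forall>\<^sub>F n in sequentially. smooth_step (real n * (r - c)) = 1"
          by eventually_elim (use False in \<open>auto intro!: smooth_step_eq_1 simp: field_simps\<close>)
        with False show ?thesis by (simp add: tendsto_eventually)
      qed
      have "(\<lambda>n. \<phi> n r) \<longlonglongrightarrow> indicator {s<..t} r"
        using tendsto_diff[OF step[of s] step[of t]] st
        by (auto simp: \<phi>_def indicator_def split: if_splits)
      then show "(\<lambda>n. \<phi> n r *\<^sub>R g r) \<longlonglongrightarrow> indicator {s<..t} r *\<^sub>R g r"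
        by (intro tendsto_intros)
    qed
  qed
  have "\<forall>\<^sub>F n in sequentially. 2 / (tf - t) < real n"
    using filterlim_real_sequentially eventually_gt_at_top filterlim_iff by blast
  then have "\<forall>\<^sub>F n in sequentially.
      (LINT r|Icc_measure 0 tf. \<phi>' n r *\<^sub>R a r) = - (LINT r|Icc_measure 0 tf. \<phi> n r *\<^sub>R g r)"
    by eventually_elim (rule test)
  then have "(\<lambda>n. LINT r|Icc_measure 0 tf. \<phi>' n r *\<^sub>R a r)
      \<longlonglongrightarrow> - (LINT r|Icc_measure 0 tf. indicator {s<..t} r *\<^sub>R g r)"
    using tendsto_minus[OF lim_g] by (simp add: tendsto_cong)
  from LIMSEQ_unique[OF lim_a this]
  have "a t - a s = (LINT r|Icc_measure 0 tf. indicator {s<..t} r *\<^sub>R g r)"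
    by (simp add: algebra_simps)
  also have "\<dots> = (LINT r|Icc_measure s t. g r)"
    using st by (intro integral_indicator_Icc) auto
  finally show ?thesis .
qed

lemma absolutely_continuous_path_continuous:
  assumes "absolutely_continuous_path tf a"
  shows "continuous_on {0..tf} a"
  unfolding continuous_on_iff dist_norm
proof (intro ballI allI impI)
  fix s e :: real assume s: "s \<in> {0..tf}" and "0 < e"
  then obtain d where d: "0 < d" and *: "\<And>(n::nat) (l::nat \<Rightarrow> real) (r::nat \<Rightarrow> real).
        (\<forall>k<n. 0 \<le> l k \<and> l k \<le> r k \<and> r k \<le> tf) \<and>
        disjoint_family_on (\<lambda>k. {l k<..<r k}) {..<n} \<and>
        (\<Sum>k<n. r k - l k) < d
        \<Longrightarrow> (\<Sum>k<n. norm (a (r k) - a (l k))) < e"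
    using assms unfolding absolutely_continuous_path_def by blast
  have "norm (a r - a l) < e" if "0 \<le> l" "l \<le> r" "r \<le> tf" "r - l < d" for l r
    using *[of "Suc 0" "\<lambda>_. l" "\<lambda>_. r"] that by (simp add: disjoint_family_on_def)
  then show "\<exists>d>0. \<forall>t\<in>{0..tf}. norm (t - s) < d \<longrightarrow> norm (a t - a s) < e"
    using d s by (intro exI[of _ d]) (metis abs_le_iff abs_minus_commute atLeastAtMost_iff
        linorder_le_cases norm_minus_commute order_le_less_trans real_norm_def abs_ge_self)
qed

lemma lipschitz_absolutely_continuous_path:
  assumes L: "\<And>s t. 0 \<le> s \<Longrightarrow> s \<le> t \<Longrightarrow> t \<le> tf \<Longrightarrow> norm (a t - a s) \<le> L * (t - s)"
  shows "absolutely_continuous_path tf a"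
  unfolding absolutely_continuous_path_def
proof (intro allI impI)
  fix e :: real assume "0 < e"
  \<comment> \<open>The maximum makes the divisor of e positive without restricting L.\<close>
  define K where "K = max L 1"
  have K: "0 < K" "L \<le> K" by (auto simp: K_def)
  show "\<exists>\<delta>>0. \<forall>(n::nat) l r. (\<forall>k<n. 0 \<le> l k \<and> l k \<le> r k \<and> r k \<le> tf) \<and>
      disjoint_family_on (\<lambda>k. {l k<..<r k}) {..<n} \<and> (\<Sum>k<n. r k - l k) < \<delta> \<longrightarrow>
      (\<Sum>k<n. norm (a (r k) - a (l k))) < e"
  proof (intro exI[of _ "e / K"] conjI allI impI)
    show "0 < e / K" using K \<open>0 < e\<close> by simp
    fix n :: nat and l r :: "nat \<Rightarrow> real"
    assume *: "(\<forall>k<n. 0 \<le> l k \<and> l k \<le> r k \<and> r k \<le> tf) \<and>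
      disjoint_family_on (\<lambda>k. {l k<..<r k}) {..<n} \<and> (\<Sum>k<n. r k - l k) < e / K"
    have "(\<Sum>k<n. norm (a (r k) - a (l k))) \<le> (\<Sum>k<n. K * (r k - l k))"
      using * K(2) by (intro sum_mono order_trans[OF L mult_right_mono]) auto
    also have "\<dots> = K * (\<Sum>k<n. r k - l k)"
      by (simp add: sum_distrib_left)
    also have "\<dots> < e"
      using * K(1) by (simp add: field_simps)
    finally show "(\<Sum>k<n. norm (a (r k) - a (l k))) < e" .
  qed
qed

text \<open>Continuity of both sides extends the identity from the open interval to the end points.\<close>

lemma weak_derivative_increment:
  fixes a :: "real \<Rightarrow> 'a::euclidean_space"
  assumes a: "continuous_on {0..tf} a" and g: "has_weak_derivative tf a g"
    and st: "0 \<le> s" "s \<le> t" "t \<le> tf"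
  shows "a t - a s = (LINT r|Icc_measure s t. g r)"
proof -
  define A where "A = (\<lambda>t. LINT r|Icc_measure 0 t. g r)"
  have int_g: "integrable (Icc_measure 0 tf) g"
    using g by (simp add: has_weak_derivative_Icc)
  have A: "A t - A s = (LINT r|Icc_measure s t. g r)" if "0 \<le> s" "s \<le> t" "t \<le> tf" for s t
    using that integral_Icc_combine[OF integrable_Icc_subset[OF int_g, of 0 t], of s]
    by (simp add: A_def)
  have "a t - a s = A t - A s"
  proof (cases "tf = 0")
    case False
    then have "0 < tf" using st by simp
    define c where "c = a (tf / 2) - A (tf / 2)"
    have "a r - A r = c" if r: "r \<in> {0<..<tf}" for r
    proof (cases r "tf / 2" rule: linorder_cases)
      case equal
      show ?thesis unfolding equal c_def by (rule refl)
    next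
      case less
      then show ?thesis
        using weak_derivative_increment_interior[OF a g, of r "tf / 2"] A[of r "tf / 2"] r
        by (simp add: c_def algebra_simps)
    next
      case greater
      then show ?thesis
        using weak_derivative_increment_interior[OF a g, of "tf / 2" r] A[of "tf / 2" r] r
        by (simp add: c_def algebra_simps)
    qed
    moreover have "continuous_on (closure {0<..<tf}) (\<lambda>r. a r - A r)"
      using \<open>0 < tf\<close> a continuous_on_indefinite_integral_Icc[OF int_g]
      by (auto simp: A_def intro: continuous_intros)
    ultimately have "a r - A r = c" if "r \<in> {0..tf}" for r
      using continuous_constant_on_closure[of "{0<..<tf}" "\<lambda>r. a r - A r" c r] that \<open>0 < tf\<close> by simp
    from this[of s] this[of t] show ?thesis
      using st by (simp add: algebra_simps)
  next
    case True
    then have "s = t" using st by simp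
    then show ?thesis by simp
  qed
  with A st show ?thesis by simp
qed

lemma integrable_Icc_scaleR_continuous:
  fixes v :: "real \<Rightarrow> 'a::euclidean_space"
  assumes \<phi>: "continuous_on {a..b} \<phi>" and v: "integrable (Icc_measure a b) v"
  shows "integrable (Icc_measure a b) (\<lambda>t. \<phi> t *\<^sub>R v t)"
proof -
  obtain c where c: "\<And>t. t \<in> {a..b} \<Longrightarrow> norm (\<phi> t) \<le> c"
    using continuous_bounded_Icc[OF \<phi>] by blast
  show ?thesis
  proof (rule Bochner_Integration.integrable_bound[of _ "\<lambda>t. c * norm (v t)"])
    show "(\<lambda>t. \<phi> t *\<^sub>R v t) \<in> borel_measurable (Icc_measure a b)"
      using v measurable_Icc_continuous[OF \<phi>] by (intro borel_measurable_scaleR) auto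
    show "AE t in Icc_measure a b. norm (\<phi> t *\<^sub>R v t) \<le> norm (c * norm (v t))"
      by (rule AE_Icc_I) (use c in \<open>force simp: abs_mult intro!: mult_right_mono\<close>)
  qed (use v in simp)
qed

lemma has_weak_derivative_uminus:
  assumes "has_weak_derivative tf a g"
  shows "has_weak_derivative tf (\<lambda>t. - a t) (\<lambda>t. - g t)"
  unfolding has_weak_derivative_Icc
proof (intro conjI allI impI)
  show "integrable (Icc_measure 0 tf) (\<lambda>t. - g t)"
    using assms by (simp add: has_weak_derivative_Icc)
  fix \<phi> \<phi>' :: "real \<Rightarrow> real"
  assume "(\<forall>t. (\<phi> has_real_derivative \<phi>' t) (at t)) \<and> continuous_on UNIV \<phi>' \<and>
    (\<exists>K. compact K \<and> K \<subseteq> {0<..<tf} \<and> (\<forall>t. t \<notin> K \<longrightarrow> \<phi> t = 0))"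
  then have "(LINT t|Icc_measure 0 tf. \<phi>' t *\<^sub>R a t) = - (LINT t|Icc_measure 0 tf. \<phi> t *\<^sub>R g t)"
    using assms unfolding has_weak_derivative_Icc by blast
  then show "(LINT t|Icc_measure 0 tf. \<phi>' t *\<^sub>R - a t) = - (LINT t|Icc_measure 0 tf. \<phi> t *\<^sub>R - g t)"
    by simp
qed

lemma has_weak_derivative_add:
  assumes "continuous_on {0..tf} a" "continuous_on {0..tf} b"
    and g: "has_weak_derivative tf a g" and k: "has_weak_derivative tf b k"
  shows "has_weak_derivative tf (\<lambda>t. a t + b t) (\<lambda>t. g t + k t)"
  unfolding has_weak_derivative_Icc
proof (intro conjI allI impI)
  have int: "integrable (Icc_measure 0 tf) g" "integrable (Icc_measure 0 tf) k"
    using g k by (auto simp: has_weak_derivative_Icc)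
  then show "integrable (Icc_measure 0 tf) (\<lambda>t. g t + k t)"
    by simp
  fix \<phi> \<phi>' :: "real \<Rightarrow> real"
  assume test: "(\<forall>t. (\<phi> has_real_derivative \<phi>' t) (at t)) \<and> continuous_on UNIV \<phi>' \<and>
    (\<exists>K. compact K \<and> K \<subseteq> {0<..<tf} \<and> (\<forall>t. t \<notin> K \<longrightarrow> \<phi> t = 0))"
  then have \<phi>: "continuous_on S \<phi>" "continuous_on S \<phi>'" for S
    by (blast intro: continuous_at_imp_continuous_on DERIV_isCont, blast intro: continuous_on_subset)
  note bounded = integrable_Icc_scaleR_continuous[OF \<phi>(1)]
  have parts: "(LINT t|Icc_measure 0 tf. \<phi>' t *\<^sub>R a t) = - (LINT t|Icc_measure 0 tf. \<phi> t *\<^sub>R g t)"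
    "(LINT t|Icc_measure 0 tf. \<phi>' t *\<^sub>R b t) = - (LINT t|Icc_measure 0 tf. \<phi> t *\<^sub>R k t)"
    using g k test unfolding has_weak_derivative_Icc by blast+
  have "(LINT t|Icc_measure 0 tf. \<phi>' t *\<^sub>R (a t + b t))
      = (LINT t|Icc_measure 0 tf. \<phi>' t *\<^sub>R a t) + (LINT t|Icc_measure 0 tf. \<phi>' t *\<^sub>R b t)"
    unfolding scaleR_add_right
    by (intro Bochner_Integration.integral_add integrable_Icc_continuous continuous_intros \<phi> assms)
  also have "\<dots> = - (LINT t|Icc_measure 0 tf. \<phi> t *\<^sub>R (g t + k t))"
    unfolding scaleR_add_right parts using int bounded
    by (subst Bochner_Integration.integral_add) auto
  finally show "(LINT t|Icc_measure 0 tf. \<phi>' t *\<^sub>R (a t + b t))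
      = - (LINT t|Icc_measure 0 tf. \<phi> t *\<^sub>R (g t + k t))" .
qed

lemma has_weak_derivative_diff:
  assumes "continuous_on {0..tf} a" "continuous_on {0..tf} b"
    and "has_weak_derivative tf a g" "has_weak_derivative tf b k"
  shows "has_weak_derivative tf (\<lambda>t. a t - b t) (\<lambda>t. g t - k t)"
  using has_weak_derivative_add[OF assms(1) continuous_on_minus[OF assms(2)] assms(3)
      has_weak_derivative_uminus[OF assms(4)]] by simp

text \<open>The difference of two weak derivatives is a weak derivative of the zero path, so its indefinite
integral vanishes.\<close>

lemma has_weak_derivative_unique:
  fixes a :: "real \<Rightarrow> 'a::euclidean_space"
  assumes "0 \<le> tf" and g: "has_weak_derivative tf a g" and k: "has_weak_derivative tf a k"
  shows "AE t in Icc_measure 0 tf. g t = k t"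
proof -
  have int: "integrable (Icc_measure 0 tf) g" "integrable (Icc_measure 0 tf) k"
    using g k by (auto simp: has_weak_derivative_Icc)
  have "has_weak_derivative tf (\<lambda>_. 0 :: 'a) (\<lambda>t. g t - k t)"
    unfolding has_weak_derivative_Icc
  proof (intro conjI allI impI)
    show "integrable (Icc_measure 0 tf) (\<lambda>t. g t - k t)"
      using int by simp
    fix \<phi> \<phi>' :: "real \<Rightarrow> real"
    assume test: "(\<forall>t. (\<phi> has_real_derivative \<phi>' t) (at t)) \<and> continuous_on UNIV \<phi>' \<and>
      (\<exists>K. compact K \<and> K \<subseteq> {0<..<tf} \<and> (\<forall>t. t \<notin> K \<longrightarrow> \<phi> t = 0))"
    then have \<phi>: "continuous_on S \<phi>" for S
      by (blast intro: continuous_at_imp_continuous_on DERIV_isCont)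
    note bounded = integrable_Icc_scaleR_continuous[OF \<phi>]
    have "(LINT t|Icc_measure 0 tf. \<phi>' t *\<^sub>R a t) = - (LINT t|Icc_measure 0 tf. \<phi> t *\<^sub>R g t)"
      "(LINT t|Icc_measure 0 tf. \<phi>' t *\<^sub>R a t) = - (LINT t|Icc_measure 0 tf. \<phi> t *\<^sub>R k t)"
      using g k test unfolding has_weak_derivative_Icc by blast+
    then show "(LINT t|Icc_measure 0 tf. \<phi>' t *\<^sub>R (0 :: 'a)) = - (LINT t|Icc_measure 0 tf. \<phi> t *\<^sub>R (g t - k t))"
      unfolding scaleR_diff_right
      by (subst Bochner_Integration.integral_diff[OF bounded[OF int(1)] bounded[OF int(2)]]) simp
  qed
  from weak_derivative_increment[OF continuous_on_const this]
  have "AE t in Icc_measure 0 tf. g t - k t = 0"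
    using assms(1) int by (intro AE_zero_of_indefinite_integral_zero) auto
  then show ?thesis by simp
qed

text \<open>Integrate the derivative of the product of the path with a test function; finitely many
exceptional points are harmless, and the boundary terms vanish.\<close>

lemma has_weak_derivative_piecewise:
  fixes a :: "real \<Rightarrow> 'a::euclidean_space"
  assumes "0 \<le> tf" and a: "continuous_on {0..tf} a" and D: "finite D"
    and deriv: "\<And>t. 0 < t \<Longrightarrow> t < tf \<Longrightarrow> t \<notin> D \<Longrightarrow> (a has_vector_derivative g t) (at t)"
    and g: "integrable (Icc_measure 0 tf) g"
  shows "has_weak_derivative tf a g"
  unfolding has_weak_derivative_Icc
proof (intro conjI allI impI)
  show "integrable (Icc_measure 0 tf) g" by fact
  fix \<phi> \<phi>' :: "real \<Rightarrow> real"
  assume test: "(\<forall>t. (\<phi> has_real_derivative \<phi>' t) (at t)) \<and> continuous_on UNIV \<phi>' \<and>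
    (\<exists>K. compact K \<and> K \<subseteq> {0<..<tf} \<and> (\<forall>t. t \<notin> K \<longrightarrow> \<phi> t = 0))"
  then have \<phi>: "continuous_on S \<phi>" "continuous_on S \<phi>'" for S
    by (blast intro: continuous_at_imp_continuous_on DERIV_isCont, blast intro: continuous_on_subset)
  have ends: "\<phi> 0 = 0" "\<phi> tf = 0"
    using test by (auto simp: subset_iff)
  have int_g: "integrable (Icc_measure 0 tf) (\<lambda>t. \<phi> t *\<^sub>R g t)"
    by (intro integrable_Icc_scaleR_continuous \<phi> g)
  have int_a: "integrable (Icc_measure 0 tf) (\<lambda>t. \<phi>' t *\<^sub>R a t)"
    by (intro integrable_Icc_continuous continuous_intros \<phi> a)
  have "((\<lambda>t. \<phi> t *\<^sub>R g t + \<phi>' t *\<^sub>R a t) has_integral \<phi> tf *\<^sub>R a tf - \<phi> 0 *\<^sub>R a 0) {0..tf}"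
  proof (rule fundamental_theorem_of_calculus_interior_strong[OF D \<open>0 \<le> tf\<close>])
    show "continuous_on {0..tf} (\<lambda>t. \<phi> t *\<^sub>R a t)"
      by (intro continuous_intros \<phi> a)
    show "((\<lambda>t. \<phi> t *\<^sub>R a t) has_vector_derivative \<phi> t *\<^sub>R g t + \<phi>' t *\<^sub>R a t) (at t)"
      if "t \<in> {0<..<tf} - D" for t
      using that test by (intro has_vector_derivative_scaleR deriv) auto
  qed
  then have "(LINT t|Icc_measure 0 tf. \<phi> t *\<^sub>R g t + \<phi>' t *\<^sub>R a t) = 0"
    using int_g int_a by (subst integral_Icc_HK) (auto simp: ends integral_unique)
  then show "(LINT t|Icc_measure 0 tf. \<phi>' t *\<^sub>R a t) = - (LINT t|Icc_measure 0 tf. \<phi> t *\<^sub>R g t)"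
    using int_g int_a by (simp add: eq_neg_iff_add_eq_0 add.commute)
qed

lemma L2norm_Icc_mono:
  fixes g :: "real \<Rightarrow> 'a::euclidean_space"
  assumes g: "square_integrable (Icc_measure a b) g" and "a \<le> c" "c \<le> d" "d \<le> b"
  shows "L2norm (Icc_measure c d) g \<le> L2norm (Icc_measure a b) g"
proof -
  let ?g = "\<lambda>t. (norm (g t))\<^sup>2"
  have int: "integrable (Icc_measure a b) ?g"
    using g by (simp add: square_integrable_def)
  have nonneg: "0 \<le> (LINT t|Icc_measure u v. ?g t)" for u v
    by simp
  have "(LINT t|Icc_measure a b. ?g t)
      = (LINT t|Icc_measure a c. ?g t) + ((LINT t|Icc_measure c d. ?g t) + (LINT t|Icc_measure d b. ?g t))"
    using assms integral_Icc_combine[OF int, of c]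
      integral_Icc_combine[OF integrable_Icc_subset[OF int, of c b], of d] by simp
  then have "(LINT t|Icc_measure c d. ?g t) \<le> (LINT t|Icc_measure a b. ?g t)"
    using nonneg[of a c] nonneg[of d b] by linarith
  then show ?thesis
    by (simp add: L2norm_def)
qed

section \<open>The Sobolev space of paths\<close>

lemma W2_continuous: "a \<in> W2 tf \<Longrightarrow> continuous_on {0..tf} a"
  by (simp add: W2_def absolutely_continuous_path_continuous)

lemma W2_cont_paths: "a \<in> W2 tf \<Longrightarrow> a \<in> cont_paths tf"
  using W2_continuous by (auto simp: W2_def cont_paths_def)

lemma W2_weak_derivative:
  fixes a :: "real \<Rightarrow> 'a::euclidean_space"
  assumes "0 \<le> tf" and "a \<in> W2 tf"
  shows "has_weak_derivative tf a (weak_derivative tf a)"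
    and "square_integrable (Icc_measure 0 tf) (weak_derivative tf a)"
proof -
  obtain g where g: "has_weak_derivative tf a g" "integrable (Icc_measure 0 tf) (\<lambda>t. (norm (g t))\<^sup>2)"
    using assms(2) by (auto simp: W2_def set_integrable_Icc)
  show *: "has_weak_derivative tf a (weak_derivative tf a)"
    using g(1) unfolding weak_derivative_def by (rule someI[of "has_weak_derivative tf a" g])
  have "AE t in Icc_measure 0 tf. g t = weak_derivative tf a t"
    by (rule has_weak_derivative_unique[OF assms(1) g(1) *])
  then have "AE t in Icc_measure 0 tf. (norm (g t))\<^sup>2 = (norm (weak_derivative tf a t))\<^sup>2"
    by eventually_elim simp
  moreover have "g \<in> borel_measurable (Icc_measure 0 tf)"
    "weak_derivative tf a \<in> borel_measurable (Icc_measure 0 tf)"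
    using g(1) * by (auto simp: has_weak_derivative_Icc)
  ultimately show "square_integrable (Icc_measure 0 tf) (weak_derivative tf a)"
    unfolding square_integrable_def
    using g(2) by (auto intro: integrable_cong_AE_imp)
qed

text \<open>The Sobolev norm as a norm on a product, so that its triangle inequality reduces to Minkowski's
inequality.\<close>

lemma W2_norm_eq_L2norm:
  assumes "0 \<le> tf" "has_weak_derivative tf a g"
  shows "W2_norm tf a = norm (a 0, L2norm (Icc_measure 0 tf) g)"
proof -
  have *: "has_weak_derivative tf a (weak_derivative tf a)"
    unfolding weak_derivative_def using assms(2) by (rule someI[of "has_weak_derivative tf a" g])
  have "(LINT t|Icc_measure 0 tf. (norm (weak_derivative tf a t))\<^sup>2)
      = (L2norm (Icc_measure 0 tf) (weak_derivative tf a))\<^sup>2"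
    by (simp add: L2norm_power2)
  also have "L2norm (Icc_measure 0 tf) (weak_derivative tf a) = L2norm (Icc_measure 0 tf) g"
    using assms(2) * has_weak_derivative_unique[OF assms(1) * assms(2)]
    by (intro L2norm_cong_AE) (auto simp: has_weak_derivative_Icc)
  finally show ?thesis
    by (simp add: W2_norm_def set_integral_Icc norm_Pair)
qed

lemma W2_norm_diff:
  assumes "0 \<le> tf" "a \<in> W2 tf" "b \<in> W2 tf"
  shows "W2_norm tf (\<lambda>t. a t - b t) =
    norm (a 0 - b 0, L2norm (Icc_measure 0 tf) (\<lambda>t. weak_derivative tf a t - weak_derivative tf b t))"
  using assms by (intro W2_norm_eq_L2norm has_weak_derivative_diff W2_continuous W2_weak_derivative)

text \<open>\<^locale>\<open>Metric_space\<close> asks for symmetry for arbitrary functions. If the difference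
has no weak derivative, neither has its negative, and both choices are made from the same empty
predicate.\<close>

lemma W2_norm_commute:
  fixes a :: "real \<Rightarrow> 'a::euclidean_space"
  assumes "0 \<le> tf"
  shows "W2_norm tf (\<lambda>t. a t - b t) = W2_norm tf (\<lambda>t. b t - a t)"
proof (cases "\<exists>g. has_weak_derivative tf (\<lambda>t. a t - b t) g")
  case True
  then obtain g where g: "has_weak_derivative tf (\<lambda>t. a t - b t) g" by blast
  then have "has_weak_derivative tf (\<lambda>t. b t - a t) (\<lambda>t. - g t)"
    using has_weak_derivative_uminus[OF g] by simp
  with g assms show ?thesis
    by (simp add: W2_norm_eq_L2norm L2norm_uminus norm_Pair norm_minus_commute)
next
  case False
  moreover have "\<not> has_weak_derivative tf (\<lambda>t. b t - a t) g" for g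
    using has_weak_derivative_uminus[of tf "\<lambda>t. b t - a t" g] False by auto
  ultimately have "weak_derivative tf (\<lambda>t. a t - b t) = weak_derivative tf (\<lambda>t. b t - a t)"
    by (simp add: weak_derivative_def)
  then show ?thesis
    by (simp add: W2_norm_def norm_minus_commute)
qed

text \<open>The Sobolev embedding: an increment is the integral of the weak derivative, which Cauchy--Schwarz
bounds by its \<open>L\<^sup>2\<close> norm.\<close>

lemma norm_diff_le_W2_norm:
  fixes a b :: "real \<Rightarrow> 'a::euclidean_space"
  assumes "0 \<le> tf" and a: "a \<in> W2 tf" and b: "b \<in> W2 tf" and t: "t \<in> {0..tf}"
  shows "norm (a t - b t) \<le> (1 + sqrt tf) * W2_norm tf (\<lambda>t. a t - b t)"
proof -
  define g where "g = (\<lambda>t. weak_derivative tf a t - weak_derivative tf b t)"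
  define w where "w = W2_norm tf (\<lambda>t. a t - b t)"
  have g: "square_integrable (Icc_measure 0 tf) g"
    unfolding g_def using assms by (intro square_integrable_diff W2_weak_derivative)
  have w: "norm (a 0 - b 0) \<le> w" "L2norm (Icc_measure 0 tf) g \<le> w"
    using norm_fst_le[of "a 0 - b 0" "L2norm (Icc_measure 0 tf) g"]
      norm_snd_le[of "L2norm (Icc_measure 0 tf) g" "a 0 - b 0"]
    unfolding w_def W2_norm_diff[OF assms(1) a b] g_def by auto
  have increment: "(a t - b t) - (a 0 - b 0) = (LINT r|Icc_measure 0 t. g r)"
    unfolding g_def using assms
    by (intro weak_derivative_increment[of tf "\<lambda>t. a t - b t"] has_weak_derivative_diff continuous_intros
        W2_continuous W2_weak_derivative) auto
  have bound: "norm (LINT r|Icc_measure 0 t. g r) \<le> sqrt tf * L2norm (Icc_measure 0 tf) g"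
  proof -
    have "norm (LINT r|Icc_measure 0 t. g r) \<le> sqrt t * L2norm (Icc_measure 0 t) g"
      using norm_integral_le_L2norm[OF finite_Icc_measure square_integrable_Icc_subset[OF g, of 0 t]] t
      by simp
    also have "\<dots> \<le> sqrt tf * L2norm (Icc_measure 0 tf) g"
      using t L2norm_Icc_mono[OF g, of 0 t] by (intro mult_mono) auto
    finally show ?thesis .
  qed
  have "a t - b t = (a 0 - b 0) + (LINT r|Icc_measure 0 t. g r)"
    unfolding increment[symmetric] by simp
  then have "norm (a t - b t) \<le> norm (a 0 - b 0) + sqrt tf * L2norm (Icc_measure 0 tf) g"
    using norm_triangle_ineq[of "a 0 - b 0" "LINT r|Icc_measure 0 t. g r"] bound by simp
  also have "\<dots> \<le> w + sqrt tf * w"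
    using w assms(1) by (intro add_mono mult_left_mono) auto
  finally show ?thesis
    by (simp add: w_def algebra_simps)
qed

lemma Metric_space_W2:
  assumes tf: "0 \<le> tf"
  shows "Metric_space (W2 tf :: (real \<Rightarrow> 'a::euclidean_space) set) (\<lambda>a b. W2_norm tf (\<lambda>t. a t - b t))"
proof
  fix a b c :: "real \<Rightarrow> 'a"
  show "0 \<le> W2_norm tf (\<lambda>t. a t - b t)"
    by (simp add: W2_norm_def set_integral_Icc)
  show "W2_norm tf (\<lambda>t. a t - b t) = W2_norm tf (\<lambda>t. b t - a t)"
    by (rule W2_norm_commute[OF tf])
  assume a: "a \<in> W2 tf" and b: "b \<in> W2 tf"
  show "W2_norm tf (\<lambda>t. a t - b t) = 0 \<longleftrightarrow> a = b"
  proof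
    assume "W2_norm tf (\<lambda>t. a t - b t) = 0"
    then have "a t = b t" if "t \<in> {0..tf}" for t
      using norm_diff_le_W2_norm[OF tf a b that] by simp
    then show "a = b"
      using a b by (auto simp: W2_def intro: extensionalityI)
  next
    assume "a = b"
    then show "W2_norm tf (\<lambda>t. a t - b t) = 0"
      unfolding W2_norm_diff[OF tf a b] by (simp add: norm_Pair L2norm_def)
  qed
  assume c: "c \<in> W2 tf"
  let ?d = "\<lambda>a. weak_derivative tf (a :: real \<Rightarrow> 'a)"
  let ?n = "\<lambda>a b. L2norm (Icc_measure 0 tf) (\<lambda>t. ?d a t - ?d b t)"
  have sq: "square_integrable (Icc_measure 0 tf) (\<lambda>t. ?d a t - ?d b t)"
    "square_integrable (Icc_measure 0 tf) (\<lambda>t. ?d b t - ?d c t)"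
    using a b c tf by (auto intro!: square_integrable_diff W2_weak_derivative)
  have "norm (a 0 - c 0, ?n a c) \<le> norm (norm (a 0 - b 0) + norm (b 0 - c 0), ?n a b + ?n b c)"
    unfolding norm_Pair
  proof (intro real_sqrt_le_mono add_mono power_mono)
    show "norm (a 0 - c 0) \<le> norm (norm (a 0 - b 0) + norm (b 0 - c 0))"
      using norm_triangle_ineq[of "a 0 - b 0" "b 0 - c 0"] by simp
    show "norm (?n a c) \<le> norm (?n a b + ?n b c)"
      using L2norm_triangle[OF sq] by simp
  qed auto
  also have "\<dots> \<le> norm (norm (a 0 - b 0), ?n a b) + norm (norm (b 0 - c 0), ?n b c)"
    using norm_triangle_ineq[of "(norm (a 0 - b 0), ?n a b)" "(norm (b 0 - c 0), ?n b c)"] by simp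
  finally show "W2_norm tf (\<lambda>t. a t - c t) \<le> W2_norm tf (\<lambda>t. a t - b t) + W2_norm tf (\<lambda>t. b t - c t)"
    using a b c by (simp add: W2_norm_diff[OF tf] norm_Pair)
qed

lemma topspace_W2_topology [simp]: "0 \<le> tf \<Longrightarrow> topspace (W2_topology tf) = W2 tf"
  unfolding W2_topology_def by (rule Metric_space.topspace_mtopology[OF Metric_space_W2])

lemma limitin_W2_topology:
  fixes x :: "nat \<Rightarrow> real \<Rightarrow> 'a::euclidean_space"
  assumes tf: "0 \<le> tf" and x: "\<And>i. x i \<in> W2 tf" "a \<in> W2 tf"
  shows "limitin (W2_topology tf) x a sequentially \<longleftrightarrow>
    (\<lambda>i. x i 0) \<longlonglongrightarrow> a 0 \<and>
    (\<lambda>i. L2norm (Icc_measure 0 tf) (\<lambda>t. weak_derivative tf (x i) t - weak_derivative tf a t)) \<longlonglongrightarrow> 0"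
proof -
  let ?n = "\<lambda>i. L2norm (Icc_measure 0 tf) (\<lambda>t. weak_derivative tf (x i) t - weak_derivative tf a t)"
  have "limitin (W2_topology tf) x a sequentially \<longleftrightarrow> (\<lambda>i. W2_norm tf (\<lambda>t. x i t - a t)) \<longlonglongrightarrow> 0"
    unfolding W2_topology_def using x
    by (subst Metric_space.limitin_metric_dist_null[OF Metric_space_W2[OF tf]]) simp
  also have "\<dots> \<longleftrightarrow> (\<lambda>i. (x i 0 - a 0, ?n i)) \<longlonglongrightarrow> 0"
    using x by (simp add: W2_norm_diff[OF tf] tendsto_norm_zero_iff)
  also have "\<dots> \<longleftrightarrow> (\<lambda>i. x i 0 - a 0) \<longlonglongrightarrow> 0 \<and> ?n \<longlonglongrightarrow> 0"
    by (auto simp: zero_prod_def dest: tendsto_fst tendsto_snd intro: tendsto_Pair)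
  also have "(\<lambda>i. x i 0 - a 0) \<longlonglongrightarrow> 0 \<longleftrightarrow> (\<lambda>i. x i 0) \<longlonglongrightarrow> a 0"
    by (simp add: LIM_zero_iff)
  finally show ?thesis .
qed

text \<open>A bounded weak derivative makes the path Lipschitz. Both solutions of the state equation and
piecewise linear paths are of this kind.\<close>

lemma W2_of_bounded_weak_derivative:
  fixes a :: "real \<Rightarrow> 'a::euclidean_space"
  assumes "a \<in> extensional {0..tf}" and a: "continuous_on {0..tf} a"
    and g: "has_weak_derivative tf a g" and B: "\<And>t. t \<in> {0..tf} \<Longrightarrow> norm (g t) \<le> B"
  shows "a \<in> W2 tf"
proof -
  have int: "integrable (Icc_measure 0 tf) g"
    using g by (simp add: has_weak_derivative_Icc)
  have "norm (a t - a s) \<le> B * (t - s)" if st: "0 \<le> s" "s \<le> t" "t \<le> tf" for s t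
  proof -
    have "norm (a t - a s) = norm (LINT r|Icc_measure s t. g r)"
      using weak_derivative_increment[OF a g st] by simp
    also have "\<dots> \<le> (LINT r|Icc_measure s t. B)"
      using st B integrable_Icc_subset[OF int, of s t] finite_measure.integrable_const[OF finite_Icc_measure]
      by (intro Bochner_Integration.integral_norm_bound_integral) auto
    also have "\<dots> = B * (t - s)"
      using st by simp
    finally show ?thesis .
  qed
  then have "absolutely_continuous_path tf a"
    by (rule lipschitz_absolutely_continuous_path)
  moreover have "square_integrable (Icc_measure 0 tf) g"
    using int B by (intro square_integrable_AE_bounded[where c=B] AE_Icc_I) auto
  ultimately show ?thesis
    using assms(1) g by (auto simp: W2_def set_integrable_Icc square_integrable_def)
qed

section \<open>The deterministic state equation\<close>

lemma integral_Icc_point: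
  fixes g :: "real \<Rightarrow> 'a::euclidean_space"
  shows "(LINT t|Icc_measure a a. g t) = 0"
  by (intro integral_eq_zero_AE AE_Icc_except_finite[of "{a}"]) auto

lemma integral_equation_imp_W2:
  fixes a :: "real \<Rightarrow> 'a::euclidean_space"
  assumes "0 \<le> tf" "a \<in> extensional {0..tf}" and g: "continuous_on {0..tf} g"
    and a: "\<And>t. t \<in> {0..tf} \<Longrightarrow> a t = a 0 + (LINT s|Icc_measure 0 t. g s)"
  shows "a \<in> W2 tf" "has_weak_derivative tf a g"
proof -
  have int: "integrable (Icc_measure 0 tf) g"
    by (rule integrable_Icc_continuous[OF g])
  have a_HK: "a t = a 0 + integral {0..t} g" if "t \<in> {0..tf}" for t
    using that a[OF that] integral_Icc_HK(2)[OF integrable_Icc_subset[OF int, of 0 t]] by simp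
  have cont: "continuous_on {0..tf} a"
  proof (rule continuous_on_eq)
    show "continuous_on {0..tf} (\<lambda>t. a 0 + (LINT s|Icc_measure 0 t. g s))"
      by (intro continuous_on_add continuous_on_const continuous_on_indefinite_integral_Icc int)
    show "a 0 + (LINT s|Icc_measure 0 t. g s) = a t" if "t \<in> {0..tf}" for t
      by (rule a[OF that, symmetric])
  qed
  have "(a has_vector_derivative g t) (at t)" if t: "0 < t" "t < tf" for t
  proof -
    have "((\<lambda>t. a 0 + integral {0..t} g) has_vector_derivative g t) (at t within {0..tf})"
      using has_vector_derivative_add[OF has_vector_derivative_const integral_has_vector_derivative[OF g, of t]] t
      by simp
    then have "(a has_vector_derivative g t) (at t within {0..tf})"
      by (rule has_vector_derivative_transform[rotated 2]) (use t in simp, rule a_HK)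
    moreover have "at t within {0..tf} = at t"
      using t by (intro at_within_interior) auto
    ultimately show ?thesis by simp
  qed
  then show g': "has_weak_derivative tf a g"
    using assms(1) cont int by (intro has_weak_derivative_piecewise[of _ _ "{}"]) auto
  obtain B where "\<And>t. t \<in> {0..tf} \<Longrightarrow> norm (g t) \<le> B"
    using continuous_bounded_Icc[OF g] by blast
  then show "a \<in> W2 tf"
    using assms(2) cont g' by (intro W2_of_bounded_weak_derivative[where g=g and B=B])
qed

text \<open>Picard's argument in the supremum norm weighted by \<open>exp (- 2 L t)\<close>: for this weight
the integral operator contracts by the factor 1/2 on the whole time interval. Every solution in the Sobolev
space yields a fixed point, so the uniqueness of the fixed point also gives that of the solution.\<close>

lemma ode_solution_ex1:
  fixes k :: "real \<Rightarrow> 'a::euclidean_space \<Rightarrow> 'a"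
  assumes tf: "0 \<le> tf" and "0 < L"
    and k: "continuous_on ({0..tf} \<times> UNIV) (\<lambda>(t, z). k t z)"
    and lip: "\<And>t z z'. t \<in> {0..tf} \<Longrightarrow> norm (k t z - k t z') \<le> L * norm (z - z')"
  shows "\<exists>!z. z \<in> W2 tf \<and> z 0 = z0 \<and> has_weak_derivative tf z (\<lambda>t. k t (z t))"
proof -
  \<comment> \<open>Clamping the time turns continuous functions on the interval into bounded continuous functions on
    the line, which form a complete space.\<close>
  define c where "c = (\<lambda>t. max 0 (min t tf))"
  define K where "K = 2 * L"
  have c: "c t \<in> {0..tf}" for t using tf by (auto simp: c_def)
  have c_id: "c t = t" if "t \<in> {0..tf}" for t using that by (auto simp: c_def)
  have c_cont: "continuous_on UNIV c" unfolding c_def by (intro continuous_intros)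
  have K: "0 < K" using \<open>0 < L\<close> by (simp add: K_def)
  have k_cont: "continuous_on {0..tf} (\<lambda>t. k t (z t))" if "continuous_on {0..tf} z" for z
    using continuous_on_compose2[OF k continuous_on_Pair[OF continuous_on_id that]] by auto
  have k_int: "integrable (Icc_measure 0 t) (\<lambda>t. k t (z t))"
    if "continuous_on {0..tf} z" "t \<in> {0..tf}" for z t
    using integrable_Icc_subset[OF integrable_Icc_continuous[OF k_cont], of z 0 t] that by simp
  define S where "S = (\<lambda>z t. z0 + (LINT s|Icc_measure 0 t. k s (z s)))"
  have S_cont: "continuous_on {0..tf} (S z)" if "continuous_on {0..tf} z" for z
    unfolding S_def
    by (intro continuous_intros continuous_on_indefinite_integral_Icc integrable_Icc_continuous k_cont that)
  have bcont: "(\<lambda>t. exp (- K * c t) *\<^sub>R z (c t)) \<in> bcontfun" if "continuous_on {0..tf} z" for z :: "real \<Rightarrow> 'a"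
  proof -
    have z: "continuous_on {0..tf} (\<lambda>t. exp (- K * t) *\<^sub>R z t)"
      by (intro continuous_intros that)
    obtain b where "\<And>t. t \<in> {0..tf} \<Longrightarrow> norm (exp (- K * t) *\<^sub>R z t) \<le> b"
      using continuous_bounded_Icc[OF z] by blast
    moreover have "continuous_on UNIV (\<lambda>t. exp (- K * c t) *\<^sub>R z (c t))"
      using continuous_on_compose2[OF z c_cont] c by blast
    ultimately show ?thesis
      using c by (intro bcontfun_normI) auto
  qed
  \<comment> \<open>Fixed points are sought for the weighted function w; U removes the weight.\<close>
  define U where "U = (\<lambda>(w :: real \<Rightarrow>\<^sub>C 'a) t. exp (K * t) *\<^sub>R apply_bcontfun w t)"
  define T where "T = (\<lambda>w. Bcontfun (\<lambda>t. exp (- K * c t) *\<^sub>R S (U w) (c t)))"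
  have U_cont: "continuous_on {0..tf} (U w)" for w
    unfolding U_def by (intro continuous_intros) auto
  have T: "apply_bcontfun (T w) t = exp (- K * c t) *\<^sub>R S (U w) (c t)" for w t
    unfolding T_def Bcontfun_inverse[OF bcont[OF S_cont[OF U_cont]]] by (rule refl)
  have contraction: "dist (T v) (T w) \<le> 1/2 * dist v w" for v w
  proof (rule dist_bound)
    fix t
    define r where "r = c t"
    have r: "0 \<le> r" "r \<le> tf" using c[of t] by (auto simp: r_def)
    have diff_cont: "continuous_on {0..r} (\<lambda>s. k s (U v s) - k s (U w s))"
      using r continuous_on_subset[OF k_cont[OF U_cont], of "{0..r}"] by (intro continuous_on_diff) auto
    have weight_cont: "continuous_on {0..r} (\<lambda>s. L * dist v w * exp (K * s))"
      by (intro continuous_intros)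
    have "((\<lambda>s. L * dist v w * exp (K * s)) has_integral
        L * dist v w / K * exp (K * r) - L * dist v w / K * exp (K * 0)) {0..r}"
      using r K by (intro fundamental_theorem_of_calculus)
        (auto simp: has_real_derivative_iff_has_vector_derivative[symmetric] intro!: derivative_eq_intros)
    then have bound: "(LINT s|Icc_measure 0 r. L * dist v w * exp (K * s))
        = L * dist v w / K * exp (K * r) - L * dist v w / K"
      unfolding integral_Icc_HK(2)[OF integrable_Icc_continuous[OF weight_cont]]
      by (subst integral_unique) auto
    have "dist (apply_bcontfun (T v) t) (apply_bcontfun (T w) t)
        = exp (- K * r) * norm (LINT s|Icc_measure 0 r. k s (U v s) - k s (U w s))"
      using r k_int[OF U_cont, of r] 
      by (simp add: T dist_norm scaleR_diff_right[symmetric] S_def r_def[symmetric])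
    also have "norm (LINT s|Icc_measure 0 r. k s (U v s) - k s (U w s))
        \<le> (LINT s|Icc_measure 0 r. L * dist v w * exp (K * s))"
    proof (rule Bochner_Integration.integral_norm_bound_integral)
      show "integrable (Icc_measure 0 r) (\<lambda>s. k s (U v s) - k s (U w s))"
        by (rule integrable_Icc_continuous[OF diff_cont])
      show "integrable (Icc_measure 0 r) (\<lambda>s. L * dist v w * exp (K * s))"
        by (intro integrable_Icc_continuous continuous_intros)
      fix s assume "s \<in> space (Icc_measure 0 r)"
      then have "norm (k s (U v s) - k s (U w s)) \<le> L * norm (U v s - U w s)"
        using r by (intro lip) auto
      also have "norm (U v s - U w s) = exp (K * s) * dist (apply_bcontfun v s) (apply_bcontfun w s)"
        by (simp add: U_def scaleR_diff_right[symmetric] dist_norm)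
      also have "\<dots> \<le> exp (K * s) * dist v w"
        by (intro mult_left_mono dist_bounded) auto
      finally show "norm (k s (U v s) - k s (U w s)) \<le> L * dist v w * exp (K * s)"
        using \<open>0 < L\<close> by (simp add: mult_ac)
    qed
    also have "exp (- K * r) * (LINT s|Icc_measure 0 r. L * dist v w * exp (K * s))
        = 1/2 * dist v w * (1 - exp (- K * r))"
      unfolding bound using \<open>0 < L\<close> by (simp add: K_def field_simps exp_minus)
    also have "\<dots> \<le> 1/2 * dist v w"
      by (intro mult_left_le) auto
    finally show "dist (apply_bcontfun (T v) t) (apply_bcontfun (T w) t) \<le> 1/2 * dist v w"
      by simp
  qed
  then have ex1: "\<exists>!w. T w = w"
    by (intro banach_fix_type[of "1/2"]) auto
  show ?thesis
  proof (rule ex_ex1I)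
    obtain w where w: "T w = w" using ex1 by blast
    define z where "z = restrict (U w) {0..tf}"
    have z_cont: "continuous_on {0..tf} z"
      by (rule continuous_on_eq[OF U_cont[of w]]) (simp add: z_def)
    have z_S: "z t = z0 + (LINT s|Icc_measure 0 t. k s (z s))" if t: "t \<in> {0..tf}" for t
    proof -
      have "U w t = exp (K * t) *\<^sub>R (exp (- K * t) *\<^sub>R S (U w) t)"
        using T[of w t] c_id[OF t] by (simp add: U_def w)
      then have "z t = S (U w) t"
        using t by (simp add: z_def exp_minus_inverse flip: exp_add)
      also have "\<dots> = z0 + (LINT s|Icc_measure 0 t. k s (z s))"
        unfolding S_def using t by (auto intro!: Bochner_Integration.integral_cong simp: z_def)
      finally show ?thesis .
    qed
    have z_0: "z 0 = z0"
      using z_S[of 0] tf integral_Icc_point by simp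
    have "z t = z 0 + (LINT s|Icc_measure 0 t. k s (z s))" if "t \<in> {0..tf}" for t
      unfolding z_0 using that by (rule z_S)
    moreover have "z \<in> extensional {0..tf}"
      by (simp add: z_def)
    ultimately have "z \<in> W2 tf" "has_weak_derivative tf z (\<lambda>t. k t (z t))"
      using integral_equation_imp_W2[OF tf _ k_cont[OF z_cont], of z] by blast+
    with z_0 show "\<exists>z. z \<in> W2 tf \<and> z 0 = z0 \<and> has_weak_derivative tf z (\<lambda>t. k t (z t))"
      by blast
  next
    define V where "V = (\<lambda>z. Bcontfun (\<lambda>t. exp (- K * c t) *\<^sub>R z (c t)) :: real \<Rightarrow>\<^sub>C 'a)"
    have V: "T (V z) = V z" "t \<in> {0..tf} \<Longrightarrow> U (V z) t = z t"
      if z: "z \<in> W2 tf \<and> z 0 = z0 \<and> has_weak_derivative tf z (\<lambda>t. k t (z t))" for z t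
    proof -
      have z_cont: "continuous_on {0..tf} z"
        using z by (simp add: W2_continuous)
      have V_apply: "apply_bcontfun (V z) t = exp (- K * c t) *\<^sub>R z (c t)" for t
        unfolding V_def Bcontfun_inverse[OF bcont[OF z_cont]] by (rule refl)
      have UV: "U (V z) t = z t" if "t \<in> {0..tf}" for t
        using that by (simp add: U_def V_apply c_id exp_minus_inverse flip: exp_add)
      then show "t \<in> {0..tf} \<Longrightarrow> U (V z) t = z t" .
      have "S (U (V z)) t = z t" if t: "t \<in> {0..tf}" for t
      proof -
        have "S (U (V z)) t = z0 + (LINT s|Icc_measure 0 t. k s (z s))"
          unfolding S_def using t by (auto intro!: Bochner_Integration.integral_cong simp: UV)
        also have "\<dots> = z t"
          using weak_derivative_increment[OF z_cont, of "\<lambda>t. k t (z t)" 0 t] z t by (simp add: algebra_simps)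
        finally show ?thesis .
      qed
      then show "T (V z) = V z"
        using c by (intro bcontfun_eqI) (simp only: T V_apply)
    qed
    fix y z :: "real \<Rightarrow> 'a"
    assume y: "y \<in> W2 tf \<and> y 0 = z0 \<and> has_weak_derivative tf y (\<lambda>t. k t (y t))"
      and z: "z \<in> W2 tf \<and> z 0 = z0 \<and> has_weak_derivative tf z (\<lambda>t. k t (z t))"
    then have "V y = V z"
      using ex1 V(1) by blast
    then have "y t = z t" if "t \<in> {0..tf}" for t
      using V(2)[OF y that] V(2)[OF z that] by simp
    moreover have "y \<in> extensional {0..tf}" "z \<in> extensional {0..tf}"
      using y z by (simp_all add: W2_def)
    ultimately show "y = z"
      by (blast intro: extensionalityI)
  qed
qed

lemma ode_path_solves:
  fixes h :: "real \<Rightarrow> real^'n \<Rightarrow> real^'q \<Rightarrow> real^'m \<Rightarrow> real^'q" and z0 :: "real^'q"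
  assumes tf: "0 \<le> tf" and x: "continuous_on {0..tf} x" and "\<theta> \<in> S"
    and h: "continuous_on ({0..tf} \<times> UNIV \<times> UNIV \<times> S) (\<lambda>(t, x, z, \<theta>). h t x z \<theta>)"
    and lip: "lipschitz_state tf h \<theta>"
  defines "z \<equiv> ode_path tf h x z0 \<theta>"
  shows "z \<in> W2 tf" "z 0 = z0" "has_weak_derivative tf z (\<lambda>t. h t (x t) (z t) \<theta>)"
    "continuous_on {0..tf} (\<lambda>t. h t (x t) (z t) \<theta>)"
proof -
  obtain L where L: "0 < L" "\<And>t x x' z z'. t \<in> {0..tf} \<Longrightarrow>
      norm (h t x z \<theta> - h t x' z' \<theta>) \<le> L * (norm (x - x') + norm (z - z'))"
    using lip unfolding lipschitz_state_def by blast
  have cont: "continuous_on ({0..tf} \<times> UNIV) (\<lambda>(t, z). h t (x t) z \<theta>)"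
  proof -
    have "continuous_on ({0..tf} \<times> (UNIV :: (real^'q) set)) (\<lambda>p. (fst p, x (fst p), snd p, \<theta>))"
      by (intro continuous_intros continuous_on_compose2[OF x]) auto
    from continuous_on_compose2[OF h this] \<open>\<theta> \<in> S\<close> show ?thesis
      by (force simp: case_prod_unfold)
  qed
  have "\<exists>!z. z \<in> W2 tf \<and> z 0 = z0 \<and> has_weak_derivative tf z (\<lambda>t. h t (x t) (z t) \<theta>)"
  proof (rule ode_solution_ex1[OF tf L(1) cont])
    show "norm (h t (x t) z \<theta> - h t (x t) z' \<theta>) \<le> L * norm (z - z')" if "t \<in> {0..tf}" for t z z'
      using L(2)[OF that, of "x t" z "x t" z'] by simp
  qed
  from theI'[OF this] show z: "z \<in> W2 tf" "z 0 = z0"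
    "has_weak_derivative tf z (\<lambda>t. h t (x t) (z t) \<theta>)"
    unfolding z_def ode_path_def by auto
  show "continuous_on {0..tf} (\<lambda>t. h t (x t) (z t) \<theta>)"
    using continuous_on_compose2[OF cont continuous_on_Pair[OF continuous_on_id W2_continuous[OF z(1)]]]
    by auto
qed

section \<open>Convergence of the Euler scheme\<close>

lemma partition_mono:
  assumes "is_partition tf N \<tau>" "i \<le> j" "j \<le> N"
  shows "\<tau> i \<le> \<tau> j"
  using assms(2,3)
proof (induction j)
  case (Suc j)
  then have "\<tau> j < \<tau> (Suc j)"
    using assms(1) by (simp add: is_partition_def)
  with Suc show ?case
    by (cases "i = Suc j") auto
qed auto

lemma partition_bounds:
  assumes "is_partition tf N \<tau>" "k \<le> N"
  shows "0 \<le> \<tau> k" "\<tau> k \<le> tf"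
  using assms partition_mono[OF assms(1), of 0 k] partition_mono[OF assms(1), of k N]
  by (auto simp: is_partition_def)

lemma partition_cell:
  assumes \<tau>: "is_partition tf N \<tau>" and t: "0 < t" "t \<le> tf"
  obtains k where "k < N" "\<tau> k < t" "t \<le> \<tau> (Suc k)"
proof -
  define j where "j = (LEAST j. t \<le> \<tau> j)"
  have N: "t \<le> \<tau> N" using \<tau> t by (simp add: is_partition_def)
  have j: "t \<le> \<tau> j" "j \<le> N"
    unfolding j_def using N by (auto intro: LeastI Least_le)
  have "j \<noteq> 0"
    using j t \<tau> by (intro notI) (simp add: is_partition_def)
  then obtain k where k: "j = Suc k" by (cases j) auto
  have "\<not> t \<le> \<tau> k"
    using not_less_Least[of k "\<lambda>j. t \<le> \<tau> j"] k by (auto simp: j_def)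
  with j k show ?thesis by (intro that[of k]) auto
qed

lemma partition_cell_unique:
  assumes \<tau>: "is_partition tf N \<tau>"
    and "i < N" "\<tau> i < t" "t \<le> \<tau> (Suc i)" and "j < N" "\<tau> j < t" "t \<le> \<tau> (Suc j)"
  shows "i = j"
  using partition_mono[OF \<tau>, of "Suc i" j] partition_mono[OF \<tau>, of "Suc j" i] assms
  by (cases i j rule: linorder_cases) auto

text \<open>Each cell of length \<open>\<delta>\<close> multiplies the error by at most \<open>1 + L \<delta>
\<le> exp (L \<delta>)\<close>, and the local errors add up to at most \<open>t \<eta>\<close> before
amplification.\<close>

lemma discrete_gronwall:
  fixes E :: "real \<Rightarrow> real"
  assumes \<tau>: "is_partition tf N \<tau>" and "0 \<le> L" "0 \<le> \<eta>" and E: "\<And>t. 0 \<le> E t"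
    and step: "\<And>k t. k < N \<Longrightarrow> \<tau> k < t \<Longrightarrow> t \<le> \<tau> (Suc k) \<Longrightarrow>
      E t \<le> E (\<tau> k) + (t - \<tau> k) * (L * E (\<tau> k) + \<eta>)"
    and t: "t \<in> {0..tf}"
  shows "E t \<le> exp (L * t) * (E 0 + t * \<eta>)"
proof -
  have cell: "E t \<le> exp (L * t) * (E 0 + t * \<eta>)"
    if k: "k < N" "\<tau> k < t" "t \<le> \<tau> (Suc k)"
      and IH: "E (\<tau> k) \<le> exp (L * \<tau> k) * (E 0 + \<tau> k * \<eta>)" for k t
  proof -
    have "0 \<le> t" using partition_bounds(1)[OF \<tau>, of k] k by simp
    have "E t \<le> (1 + L * (t - \<tau> k)) * E (\<tau> k) + 1 * ((t - \<tau> k) * \<eta>)"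
      using step[OF k] by (simp add: algebra_simps)
    also have "\<dots> \<le> exp (L * (t - \<tau> k)) * (exp (L * \<tau> k) * (E 0 + \<tau> k * \<eta>)) + exp (L * t) * ((t - \<tau> k) * \<eta>)"
    proof (rule add_mono)
      show "(1 + L * (t - \<tau> k)) * E (\<tau> k) \<le> exp (L * (t - \<tau> k)) * (exp (L * \<tau> k) * (E 0 + \<tau> k * \<eta>))"
        by (rule mult_mono[OF exp_ge_add_one_self IH _ E]) simp
      show "1 * ((t - \<tau> k) * \<eta>) \<le> exp (L * t) * ((t - \<tau> k) * \<eta>)"
        by (rule mult_right_mono) (use k \<open>0 \<le> t\<close> assms(2,3) in simp_all)
    qed
    also have "exp (L * (t - \<tau> k)) * (exp (L * \<tau> k) * (E 0 + \<tau> k * \<eta>)) = exp (L * t) * (E 0 + \<tau> k * \<eta>)"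
    proof -
      have "exp (L * t) = exp (L * (t - \<tau> k)) * exp (L * \<tau> k)"
        unfolding exp_add[symmetric] distrib_left[symmetric] by simp
      then show ?thesis by simp
    qed
    finally show ?thesis
      by (simp add: algebra_simps)
  qed
  have node: "k \<le> N \<Longrightarrow> E (\<tau> k) \<le> exp (L * \<tau> k) * (E 0 + \<tau> k * \<eta>)" for k
  proof (induction k)
    case 0
    then show ?case using \<tau> by (simp add: is_partition_def)
  next
    case (Suc k)
    then show ?case using cell[of k "\<tau> (Suc k)"] \<tau> by (simp add: is_partition_def)
  qed
  show ?thesis
  proof (cases "t = 0")
    case False
    then obtain k where "k < N" "\<tau> k < t" "t \<le> \<tau> (Suc k)"
      using t partition_cell[OF \<tau>, of t] by auto
    then show ?thesis using cell[of k t] node[of k] by simp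
  qed simp
qed

lemma dist_Pair_le: "dist (a, b) (c, d) \<le> dist a c + dist b d"
  unfolding dist_Pair_Pair by (rule sqrt_sum_squares_le_sum) auto

text \<open>The Lipschitz constant depends on the parameter, so only the one of the limit parameter is used.
The changes of parameter, of path and of time are absorbed by the uniform continuity of \<open>h\<close>;
uniformity over the whole space matters because no bound on the Euler paths is known beforehand.\<close>

lemma euler_path_uniform_limit:
  fixes h :: "real \<Rightarrow> real^'n \<Rightarrow> real^'q \<Rightarrow> real^'m \<Rightarrow> real^'q"
  assumes tf: "0 < tf" and \<tau>: "\<And>i. is_partition tf (N i) (\<tau> i)"
    and mesh: "\<And>d. 0 < d \<Longrightarrow> \<forall>\<^sub>F i in sequentially. \<forall>k<N i. \<tau> i (Suc k) - \<tau> i k < d"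
    and h: "uniformly_continuous_on ({0..tf} \<times> UNIV \<times> UNIV \<times> S) (\<lambda>(t, x, z, \<theta>). h t x z \<theta>)"
    and lip: "lipschitz_state tf h \<theta>" and \<theta>: "\<theta> \<in> S" "\<And>i. \<theta>' i \<in> S" "\<theta>' \<longlonglongrightarrow> \<theta>"
    and \<zeta>: "\<zeta> \<longlonglongrightarrow> z0" and x: "continuous_on {0..tf} x" "uniform_limit {0..tf} x' x sequentially"
  shows "uniform_limit {0..tf} (\<lambda>i. euler_path tf (N i) (\<tau> i) h (x' i) (\<zeta> i) (\<theta>' i))
    (ode_path tf h x z0 \<theta>) sequentially"
proof -
  define z where "z = ode_path tf h x z0 \<theta>"
  define e where "e = (\<lambda>i. euler_path tf (N i) (\<tau> i) h (x' i) (\<zeta> i) (\<theta>' i))"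
  have h_cont: "continuous_on ({0..tf} \<times> UNIV \<times> UNIV \<times> S) (\<lambda>(t, x, z, \<theta>). h t x z \<theta>)"
    by (rule uniformly_continuous_imp_continuous[OF h])
  note z = ode_path_solves[OF less_imp_le[OF tf] x(1) \<theta>(1) h_cont lip, of z0, folded z_def]
  have z_cont: "continuous_on {0..tf} z"
    by (rule W2_continuous[OF z(1)])
  obtain L where L: "0 < L" "\<And>t x x' z z'. t \<in> {0..tf} \<Longrightarrow>
      norm (h t x z \<theta> - h t x' z' \<theta>) \<le> L * (norm (x - x') + norm (z - z'))"
    using lip unfolding lipschitz_state_def by blast
  have "uniformly_continuous_on {0..tf} (\<lambda>t. (x t, z t))"
    by (intro compact_uniformly_continuous continuous_intros x z_cont) auto
  note uc_path = this[unfolded uniformly_continuous_on_def]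
  have "\<forall>\<^sub>F i in sequentially. \<forall>t\<in>{0..tf}. dist (e i t) (z t) < \<epsilon>" if "0 < \<epsilon>" for \<epsilon>
  proof -
    \<comment> \<open>The discrete Gronwall lemma turns an initial and local error \<eta> into an error of at most C *
      \<eta>.\<close>
    define C where "C = exp (L * tf) * (1 + tf)"
    define \<eta> where "\<eta> = \<epsilon> / (2 * C)"
    have C: "0 < C" using tf by (simp add: C_def)
    then have \<eta>: "0 < \<eta>" using \<open>0 < \<epsilon>\<close> by (simp add: \<eta>_def)
    then obtain d where d: "0 < d" and uc: "\<And>t x z \<theta> t' x' z' \<theta>'.
        t \<in> {0..tf} \<Longrightarrow> t' \<in> {0..tf} \<Longrightarrow> \<theta> \<in> S \<Longrightarrow> \<theta>' \<in> S \<Longrightarrow>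
        dist (t', x', z', \<theta>') (t, x, z, \<theta>) < d \<Longrightarrow> norm (h t' x' z' \<theta>' - h t x z \<theta>) < \<eta> / 2"
      using h[unfolded uniformly_continuous_on_def, rule_format, of "\<eta> / 2"]
      by (force simp: dist_norm)
    \<comment> \<open>The arguments of h must move by less than d in total; the Lipschitz estimate in z spends the
      other half of \<eta>.\<close>
    define d' where "d' = min (d / 4) (\<eta> / (2 * L))"
    have d': "0 < d'" "d' \<le> d / 4" "L * d' \<le> \<eta> / 2"
      using d \<eta> L(1) by (auto simp: d'_def min_def field_simps)
    obtain \<omega> where \<omega>: "0 < \<omega>" and path: "\<And>s t. s \<in> {0..tf} \<Longrightarrow> t \<in> {0..tf} \<Longrightarrow> dist t s < \<omega> \<Longrightarrow>
        dist (x t, z t) (x s, z s) < d'"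
      using uc_path d'(1) by blast
    have "\<forall>\<^sub>F i in sequentially. \<forall>k<N i. \<tau> i (Suc k) - \<tau> i k < min \<omega> (d / 4)"
      using \<omega> d by (intro mesh) simp
    moreover have "\<forall>\<^sub>F i in sequentially. \<forall>t\<in>{0..tf}. dist (x' i t) (x t) < d / 4"
      using d by (intro uniform_limitD[OF x(2)]) simp
    moreover have "\<forall>\<^sub>F i in sequentially. dist (\<theta>' i) \<theta> < d / 4"
      using d by (intro tendstoD[OF \<theta>(3)]) simp
    moreover have "\<forall>\<^sub>F i in sequentially. dist (\<zeta> i) z0 < \<eta>"
      by (rule tendstoD[OF \<zeta> \<eta>])
    ultimately show ?thesis
    proof eventually_elim
      case (elim i)
      note part = \<tau>[of i]
      define E where "E = (\<lambda>t. norm (e i t - z t))"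
      have step: "E t \<le> E (\<tau> i k) + (t - \<tau> i k) * (L * E (\<tau> i k) + \<eta>)"
        if k: "k < N i" "\<tau> i k < t" "t \<le> \<tau> i (Suc k)" for k t
      proof -
        let ?s = "\<tau> i k"
        have s: "?s \<in> {0..tf}" "t \<in> {0..tf}"
          using partition_bounds[OF part, of k] partition_bounds[OF part, of "Suc k"] k by auto
        let ?h = "h ?s (x' i ?s) (e i ?s) (\<theta>' i)"
        have e_step: "e i t = e i ?s + (t - ?s) *\<^sub>R ?h"
          using euler_path_step[OF part k(1) _ e_def[THEN fun_cong]] k by auto
        have z_step: "z t - z ?s = (LINT r|Icc_measure ?s t. h r (x r) (z r) \<theta>)"
          using s k by (intro weak_derivative_increment[OF z_cont z(3)]) auto
        have int: "integrable (Icc_measure ?s t) (\<lambda>r. h r (x r) (z r) \<theta>)"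
          using s by (intro integrable_Icc_continuous continuous_on_subset[OF z(4)]) auto
        note const = integrable_Icc_continuous[OF continuous_on_const]
        have "(t - ?s) *\<^sub>R ?h - (z t - z ?s) = (LINT r|Icc_measure ?s t. ?h - h r (x r) (z r) \<theta>)"
          unfolding z_step using k by (subst Bochner_Integration.integral_diff[OF const int]) auto
        also have "norm \<dots> \<le> (LINT r|Icc_measure ?s t. L * E ?s + \<eta>)"
        proof (rule Bochner_Integration.integral_norm_bound_integral)
          show "integrable (Icc_measure ?s t) (\<lambda>r. ?h - h r (x r) (z r) \<theta>)"
            "integrable (Icc_measure ?s t) (\<lambda>r. L * E ?s + \<eta>)"
            by (intro Bochner_Integration.integrable_diff int const)+
          fix r assume "r \<in> space (Icc_measure ?s t)"
          then have r: "r \<in> {0..tf}" "\<bar>?s - r\<bar> < min \<omega> (d / 4)"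
            using s k elim(1) by (auto simp: abs_if)
          have close: "dist (x ?s, z ?s) (x r, z r) < d'"
            using path[OF r(1) s(1)] r(2) by (simp add: dist_norm)
          then have close_x: "dist (x ?s) (x r) < d / 4" and close_z: "dist (z ?s) (z r) < d'"
            using dist_fst_le[of "(x ?s, z ?s)" "(x r, z r)"] dist_snd_le[of "(x ?s, z ?s)" "(x r, z r)"] d'
            by auto
          have "dist (?s, x' i ?s, e i ?s, \<theta>' i) (r, x r, e i ?s, \<theta>)
              \<le> dist ?s r + (dist (x' i ?s) (x r) + (dist (e i ?s) (e i ?s) + dist (\<theta>' i) \<theta>))"
            by (intro order_trans[OF dist_Pair_le] add_left_mono dist_Pair_le)
          also have "\<dots> < d"
            using r(2) dist_triangle[of "x' i ?s" "x r" "x ?s"] close_x elim(2) s(1) elim(3)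
            by (force simp: dist_norm)
          finally have "norm (?h - h r (x r) (e i ?s) \<theta>) < \<eta> / 2"
            using uc r(1) s(1) \<theta> by blast
          moreover have "norm (h r (x r) (e i ?s) \<theta> - h r (x r) (z r) \<theta>) \<le> L * norm (e i ?s - z r)"
            using L(2)[OF r(1), of "x r" "e i ?s" "x r" "z r"] by simp
          moreover have "L * norm (e i ?s - z r) \<le> L * E ?s + \<eta> / 2"
          proof -
            have "norm (e i ?s - z r) \<le> E ?s + d'"
              using norm_triangle_ineq[of "e i ?s - z ?s" "z ?s - z r"] close_z
              by (simp add: E_def dist_norm)
            then have "L * norm (e i ?s - z r) \<le> L * (E ?s + d')"
              using L(1) by simp
            with d'(3) show ?thesis by (simp add: algebra_simps)
          qed
          moreover have "norm (?h - h r (x r) (z r) \<theta>) \<le> norm (?h - h r (x r) (e i ?s) \<theta>)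
              + norm (h r (x r) (e i ?s) \<theta> - h r (x r) (z r) \<theta>)"
            using norm_triangle_ineq[of "?h - h r (x r) (e i ?s) \<theta>"
                "h r (x r) (e i ?s) \<theta> - h r (x r) (z r) \<theta>"] by simp
          ultimately show "norm (?h - h r (x r) (z r) \<theta>) \<le> L * E ?s + \<eta>"
            by linarith
        qed
        also have "\<dots> = (t - ?s) * (L * E ?s + \<eta>)"
          using k by simp
        finally have bound: "norm ((t - ?s) *\<^sub>R ?h - (z t - z ?s)) \<le> (t - ?s) * (L * E ?s + \<eta>)" .
        have "e i t - z t = (e i ?s - z ?s) + ((t - ?s) *\<^sub>R ?h - (z t - z ?s))"
          unfolding e_step by simp
        then have "E t = norm ((e i ?s - z ?s) + ((t - ?s) *\<^sub>R ?h - (z t - z ?s)))"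
          unfolding E_def by (rule arg_cong)
        also have "\<dots> \<le> E ?s + (t - ?s) * (L * E ?s + \<eta>)"
          unfolding E_def by (rule order_trans[OF norm_triangle_ineq add_left_mono[OF bound[unfolded E_def]]])
        finally show ?thesis .
      qed
      have E0: "E 0 < \<eta>"
        using elim(4) tf by (simp add: E_def e_def euler_path_0 z(2) dist_norm)
      show "\<forall>t\<in>{0..tf}. dist (e i t) (z t) < \<epsilon>"
      proof
        fix t assume t: "t \<in> {0..tf}"
        have "E t \<le> exp (L * t) * (E 0 + t * \<eta>)"
          using L(1) \<eta> step t by (intro discrete_gronwall[OF part]) (auto simp: E_def)
        also have "\<dots> \<le> exp (L * tf) * (\<eta> + tf * \<eta>)"
          using L(1) \<eta> t E0 by (intro mult_mono add_mono) (auto simp: E_def)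
        also have "\<dots> = \<epsilon> / 2"
        proof -
          have "exp (L * tf) * (\<eta> + tf * \<eta>) = C * \<eta>"
            by (simp add: C_def algebra_simps)
          also have "\<dots> = \<epsilon> / 2"
            using C by (simp add: \<eta>_def)
          finally show ?thesis .
        qed
        also have "\<dots> < \<epsilon>" using \<open>0 < \<epsilon>\<close> by simp
        finally show "dist (e i t) (z t) < \<epsilon>"
          by (simp add: E_def dist_norm)
      qed
    qed
  qed
  then show ?thesis
    by (simp add: uniform_limit_iff z_def e_def)
qed

section \<open>Step functions and piecewise linear interpolation\<close>

definition step_fun :: "nat \<Rightarrow> (nat \<Rightarrow> real) \<Rightarrow> (nat \<Rightarrow> 'a::euclidean_space) \<Rightarrow> real \<Rightarrow> 'a" where
  "step_fun N \<tau> v t = (\<Sum>k<N. indicat_real {\<tau> k<..\<tau> (Suc k)} t *\<^sub>R v k)"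

lemma step_fun_cell:
  assumes \<tau>: "is_partition tf N \<tau>" and k: "k < N" "\<tau> k < t" "t \<le> \<tau> (Suc k)"
  shows "step_fun N \<tau> v t = v k"
proof -
  have "indicat_real {\<tau> j<..\<tau> (Suc j)} t *\<^sub>R v j = (if j = k then v k else 0)" if "j < N" for j
  proof (cases "t \<in> {\<tau> j<..\<tau> (Suc j)}")
    case True
    then have "j = k" using partition_cell_unique[OF \<tau> that _ _ k] by simp
    with True show ?thesis by simp
  next
    case False
    moreover from this k have "j \<noteq> k" by auto
    ultimately show ?thesis by simp
  qed
  then have "step_fun N \<tau> v t = (\<Sum>j<N. if j = k then v k else 0)"
    unfolding step_fun_def by (intro sum.cong) auto
  then show ?thesis using k(1) by simp
qed

lemma step_fun_measurable: "step_fun N \<tau> v \<in> borel_measurable (Icc_measure a b)"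
  unfolding step_fun_def by (intro measurable_Icc_borel) measurable

text \<open>At time 0, which lies in no half-open cell, the step function vanishes; hence the condition
\<open>0 \<le> B\<close>.\<close>

lemma norm_step_fun_le:
  assumes "\<And>k. k < N \<Longrightarrow> norm (v k) \<le> B" and \<tau>: "is_partition tf N \<tau>" and "0 \<le> B" "t \<in> {0..tf}"
  shows "norm (step_fun N \<tau> v t) \<le> B"
proof (cases "t = 0")
  case True
  then have "\<not> (\<tau> k < t \<and> t \<le> \<tau> (Suc k))" if "k < N" for k
    using partition_bounds(1)[OF \<tau>, of k] that by auto
  then have "step_fun N \<tau> v t = 0"
    by (auto simp: step_fun_def intro!: sum.neutral split: split_indicator)
  with \<open>0 \<le> B\<close> show ?thesis by simp
next
  case False
  then obtain k where "k < N" "\<tau> k < t" "t \<le> \<tau> (Suc k)"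
    using partition_cell[OF \<tau>, of t] assms(4) by auto
  then show ?thesis
    using step_fun_cell[OF \<tau>] assms(1) by metis
qed

lemma square_integrable_step_fun:
  assumes \<tau>: "is_partition tf N \<tau>"
  shows "square_integrable (Icc_measure 0 tf) (step_fun N \<tau> v)"
proof -
  define B where "B = (\<Sum>k<N. norm (v k))"
  have "norm (v k) \<le> B" if "k < N" for k
    unfolding B_def using that by (intro member_le_sum) auto
  then have "norm (step_fun N \<tau> v t) \<le> B" if "t \<in> {0..tf}" for t
    using that by (intro norm_step_fun_le[OF _ \<tau>]) (auto simp: B_def intro: sum_nonneg)
  then show ?thesis
    by (intro square_integrable_AE_bounded[where c=B] step_fun_measurable AE_Icc_I) auto
qed

lemma integral_split_partition:
  fixes g :: "real \<Rightarrow> 'a::euclidean_space"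
  assumes \<tau>: "is_partition tf N \<tau>" and g: "integrable (Icc_measure 0 tf) g"
  shows "(LINT t|Icc_measure 0 tf. g t) = (\<Sum>k<N. LINT t|Icc_measure (\<tau> k) (\<tau> (Suc k)). g t)"
proof -
  have "n \<le> N \<Longrightarrow> (LINT t|Icc_measure 0 (\<tau> n). g t)
      = (\<Sum>k<n. LINT t|Icc_measure (\<tau> k) (\<tau> (Suc k)). g t)" for n
  proof (induction n)
    case 0
    then show ?case using \<tau> by (simp add: is_partition_def integral_Icc_point)
  next
    case (Suc n)
    then have "(LINT t|Icc_measure 0 (\<tau> (Suc n)). g t)
        = (LINT t|Icc_measure 0 (\<tau> n). g t) + (LINT t|Icc_measure (\<tau> n) (\<tau> (Suc n)). g t)"
      using partition_bounds[OF \<tau>, of n] partition_bounds[OF \<tau>, of "Suc n"] \<tau>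
      by (intro integral_Icc_combine integrable_Icc_subset[OF g]) (auto simp: is_partition_def less_imp_le)
    with Suc show ?case by simp
  qed
  from this[of N] show ?thesis
    using \<tau> by (simp add: is_partition_def)
qed

lemma AE_Icc_step_fun:
  assumes \<tau>: "is_partition tf N \<tau>" and k: "k < N" and st: "\<tau> k \<le> s" "t \<le> \<tau> (Suc k)"
  shows "AE r in Icc_measure s t. step_fun N \<tau> v r = v k"
proof (rule AE_Icc_except_finite[of "{\<tau> k}"])
  fix r assume "s \<le> r" "r \<le> t" "r \<notin> {\<tau> k}"
  then show "step_fun N \<tau> v r = v k"
    using st by (intro step_fun_cell[OF \<tau> k]) auto
qed simp

lemma integral_step_fun_cell:
  assumes \<tau>: "is_partition tf N \<tau>" and k: "k < N" and st: "\<tau> k \<le> s" "s \<le> t" "t \<le> \<tau> (Suc k)"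
  shows "(LINT r|Icc_measure s t. step_fun N \<tau> v r) = (t - s) *\<^sub>R v k"
proof -
  have "(LINT r|Icc_measure s t. step_fun N \<tau> v r) = (LINT r|Icc_measure s t. v k)"
    using AE_Icc_step_fun[OF \<tau> k st(1,3)] by (intro integral_cong_AE step_fun_measurable) auto
  then show ?thesis
    using st by simp
qed

lemma L2norm_step_fun:
  fixes v :: "nat \<Rightarrow> 'a::euclidean_space"
  assumes \<tau>: "is_partition tf N \<tau>"
  shows "(L2norm (Icc_measure 0 tf) (step_fun N \<tau> v))\<^sup>2 = (\<Sum>k<N. (\<tau> (Suc k) - \<tau> k) * (norm (v k))\<^sup>2)"
proof -
  have "(LINT t|Icc_measure (\<tau> k) (\<tau> (Suc k)). (norm (step_fun N \<tau> v t))\<^sup>2)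
      = (\<tau> (Suc k) - \<tau> k) * (norm (v k))\<^sup>2" if k: "k < N" for k
  proof -
    have "AE t in Icc_measure (\<tau> k) (\<tau> (Suc k)). (norm (step_fun N \<tau> v t))\<^sup>2 = (norm (v k))\<^sup>2"
      using AE_Icc_step_fun[OF \<tau> k order_refl order_refl, of v] by eventually_elim simp
    then have "(LINT t|Icc_measure (\<tau> k) (\<tau> (Suc k)). (norm (step_fun N \<tau> v t))\<^sup>2)
        = (LINT t|Icc_measure (\<tau> k) (\<tau> (Suc k)). (norm (v k))\<^sup>2)"
      using step_fun_measurable[of N \<tau> v "\<tau> k" "\<tau> (Suc k)"] by (intro integral_cong_AE) auto
    then show ?thesis
      using \<tau> k by (simp add: is_partition_def less_imp_le)
  qed
  moreover have "(LINT t|Icc_measure 0 tf. (norm (step_fun N \<tau> v t))\<^sup>2)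
      = (\<Sum>k<N. LINT t|Icc_measure (\<tau> k) (\<tau> (Suc k)). (norm (step_fun N \<tau> v t))\<^sup>2)"
    using square_integrable_step_fun[OF \<tau>, of v]
    by (intro integral_split_partition[OF \<tau>]) (simp add: square_integrable_def)
  ultimately show ?thesis
    by (simp add: L2norm_power2)
qed

definition cell_average :: "(nat \<Rightarrow> real) \<Rightarrow> (real \<Rightarrow> 'a::euclidean_space) \<Rightarrow> nat \<Rightarrow> 'a" where
  "cell_average \<tau> g k = (LINT t|Icc_measure (\<tau> k) (\<tau> (Suc k)). g t) /\<^sub>R (\<tau> (Suc k) - \<tau> k)"

text \<open>Jensen's inequality on every cell: averaging over the cells is a contraction of
\<open>L\<^sup>2\<close>.\<close>

lemma L2norm_cell_average_le:
  fixes g :: "real \<Rightarrow> 'a::euclidean_space"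
  assumes \<tau>: "is_partition tf N \<tau>" and g: "square_integrable (Icc_measure 0 tf) g"
  shows "L2norm (Icc_measure 0 tf) (step_fun N \<tau> (cell_average \<tau> g)) \<le> L2norm (Icc_measure 0 tf) g"
proof -
  have "(\<tau> (Suc k) - \<tau> k) * (norm (cell_average \<tau> g k))\<^sup>2
      \<le> (LINT t|Icc_measure (\<tau> k) (\<tau> (Suc k)). (norm (g t))\<^sup>2)" if k: "k < N" for k
  proof -
    have pos: "0 < \<tau> (Suc k) - \<tau> k"
      using \<tau> k by (simp add: is_partition_def)
    have sq: "square_integrable (Icc_measure (\<tau> k) (\<tau> (Suc k))) g"
      using partition_bounds[OF \<tau>, of k] partition_bounds[OF \<tau>, of "Suc k"] k
      by (intro square_integrable_Icc_subset[OF g]) auto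
    have "(\<tau> (Suc k) - \<tau> k) * (norm (cell_average \<tau> g k))\<^sup>2
        = (norm (LINT t|Icc_measure (\<tau> k) (\<tau> (Suc k)). g t))\<^sup>2 / (\<tau> (Suc k) - \<tau> k)"
    proof -
      have "\<delta> * (norm (v /\<^sub>R \<delta>))\<^sup>2 = (norm v)\<^sup>2 / \<delta>" if "0 < \<delta>" for \<delta> and v :: 'a
        using that by (simp add: power2_eq_square field_simps)
      from this[OF pos] show ?thesis unfolding cell_average_def .
    qed
    also have "\<dots> \<le> (LINT t|Icc_measure (\<tau> k) (\<tau> (Suc k)). (norm (g t))\<^sup>2)"
      using norm_integral_power2_le[OF finite_Icc_measure sq] pos
      by (simp add: divide_le_eq mult.commute)
    finally show ?thesis .
  qed
  then have "(L2norm (Icc_measure 0 tf) (step_fun N \<tau> (cell_average \<tau> g)))\<^sup>2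
      \<le> (\<Sum>k<N. LINT t|Icc_measure (\<tau> k) (\<tau> (Suc k)). (norm (g t))\<^sup>2)"
    unfolding L2norm_step_fun[OF \<tau>] by (intro sum_mono) auto
  also have "\<dots> = (L2norm (Icc_measure 0 tf) g)\<^sup>2"
    unfolding L2norm_power2 using g
    by (intro integral_split_partition[OF \<tau>, symmetric]) (simp add: square_integrable_def)
  finally show ?thesis
    by (rule power2_le_imp_le) simp
qed

lemma cell_average_diff:
  assumes \<tau>: "is_partition tf N \<tau>" and g: "integrable (Icc_measure 0 tf) g"
    and u: "integrable (Icc_measure 0 tf) u" and k: "k < N"
  shows "cell_average \<tau> (\<lambda>t. g t - u t) k = cell_average \<tau> g k - cell_average \<tau> u k"
proof -
  have "integrable (Icc_measure (\<tau> k) (\<tau> (Suc k))) g" "integrable (Icc_measure (\<tau> k) (\<tau> (Suc k))) u"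
    using partition_bounds[OF \<tau>, of k] partition_bounds[OF \<tau>, of "Suc k"] k
    by (auto intro!: integrable_Icc_subset[OF g] integrable_Icc_subset[OF u])
  then show ?thesis
    by (simp add: cell_average_def scaleR_diff_right)
qed

text \<open>The radial retraction onto the ball of radius \<open>R\<close>.\<close>

definition truncate :: "real \<Rightarrow> 'a::euclidean_space \<Rightarrow> 'a" where
  "truncate R v = (R / max R (norm v)) *\<^sub>R v"

lemma truncate_facts:
  assumes "0 < R"
  shows norm_truncate_le: "norm (truncate R v) \<le> R"
    and norm_diff_truncate_le: "norm (v - truncate R v) \<le> norm v"
    and truncate_id: "norm v \<le> R \<Longrightarrow> truncate R v = v"
    and continuous_on_truncate: "continuous_on S (truncate R :: 'a::euclidean_space \<Rightarrow> 'a)"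
proof -
  show "norm (truncate R v) \<le> R"
    using assms by (simp add: truncate_def field_simps max_def)
  have "v - truncate R v = (1 - R / max R (norm v)) *\<^sub>R v"
    by (simp add: truncate_def scaleR_diff_left)
  moreover have "0 \<le> 1 - R / max R (norm v)" "1 - R / max R (norm v) \<le> 1"
    using assms by (auto simp: max_def divide_le_eq_1)
  ultimately show "norm (v - truncate R v) \<le> norm v"
    by (simp add: mult_left_le_one_le)
  show "norm v \<le> R \<Longrightarrow> truncate R v = v"
    using assms by (simp add: truncate_def)
  show "continuous_on S (truncate R :: 'a \<Rightarrow> 'a)"
    unfolding truncate_def using assms by (intro continuous_intros) (auto simp: max_def)
qed

lemma L2norm_tendsto_0:
  fixes u :: "nat \<Rightarrow> 'a \<Rightarrow> 'b::euclidean_space"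
  assumes u: "\<And>n. u n \<in> borel_measurable M" and w: "integrable M (\<lambda>x. (w x)\<^sup>2)"
    and bound: "\<And>n. AE x in M. norm (u n x) \<le> w x"
    and lim: "AE x in M. (\<lambda>n. u n x) \<longlonglongrightarrow> 0"
  shows "(\<lambda>n. L2norm M (u n)) \<longlonglongrightarrow> 0"
proof -
  have "(\<lambda>n. LINT x|M. (norm (u n x))\<^sup>2) \<longlonglongrightarrow> (LINT x|M. 0)"
  proof (rule integral_dominated_convergence[OF _ _ w])
    show "AE x in M. (\<lambda>n. (norm (u n x))\<^sup>2) \<longlonglongrightarrow> 0"
      using lim
    proof eventually_elim
      case (elim x)
      from tendsto_power[OF tendsto_norm[OF elim], of 2] show ?case by simp
    qed
    show "AE x in M. norm ((norm (u n x))\<^sup>2) \<le> (w x)\<^sup>2" for n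
      using bound[of n] by eventually_elim (simp add: power_mono)
  qed (use u in auto)
  from tendsto_real_sqrt[OF this] show ?thesis
    by (simp add: L2norm_def)
qed

text \<open>Truncate to a bounded function, which is the limit almost everywhere of continuous functions.
Truncating these by the same bound makes dominated convergence applicable.\<close>

lemma continuous_dense_L2:
  fixes g :: "real \<Rightarrow> 'a::euclidean_space"
  assumes g: "square_integrable (Icc_measure a b) g" and "0 < e"
  obtains c where "continuous_on UNIV c" "L2norm (Icc_measure a b) (\<lambda>t. g t - c t) < e"
proof -
  let ?M = "Icc_measure a b"
  have g_meas: "g \<in> borel_measurable ?M"
    using g by (simp add: square_integrable_def)
  have trunc_meas: "(\<lambda>t. truncate (real (Suc n)) (g t)) \<in> borel_measurable ?M" for n
    using borel_measurable_continuous_onI[OF continuous_on_truncate[of "real (Suc n)"]] g_meas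
    by (rule measurable_compose_rev) simp
  have "(\<lambda>n. L2norm ?M (\<lambda>t. g t - truncate (real (Suc n)) (g t))) \<longlonglongrightarrow> 0"
  proof (rule L2norm_tendsto_0[where w="\<lambda>t. norm (g t)"])
    show "integrable ?M (\<lambda>t. (norm (g t))\<^sup>2)"
      using g by (simp add: square_integrable_def)
    show "AE t in ?M. norm (g t - truncate (real (Suc n)) (g t)) \<le> norm (g t)" for n
      by (intro AE_I2 norm_diff_truncate_le) simp
    have "(\<lambda>n. v - truncate (real (Suc n)) v) \<longlonglongrightarrow> 0" for v :: 'a
    proof (rule tendsto_eventually)
      obtain m where "norm v \<le> real m" using real_arch_simple by blast
      then have "v - truncate (real (Suc n)) v = 0" if "m \<le> n" for n
        using that by (subst truncate_id) auto
      then show "\<forall>\<^sub>F n in sequentially. v - truncate (real (Suc n)) v = 0"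
        unfolding eventually_sequentially by blast
    qed
    then show "AE t in ?M. (\<lambda>n. g t - truncate (real (Suc n)) (g t)) \<longlonglongrightarrow> 0"
      by simp
  qed (use g_meas trunc_meas in auto)
  then have "\<forall>\<^sub>F n in sequentially. L2norm ?M (\<lambda>t. g t - truncate (real (Suc n)) (g t)) < e / 2"
    using \<open>0 < e\<close> by (intro order_tendstoD) auto
  then obtain n where "L2norm ?M (\<lambda>t. g t - truncate (real (Suc n)) (g t)) < e / 2"
    using eventually_happens'[OF sequentially_bot] by blast
  then obtain R where R: "0 < R" "L2norm ?M (\<lambda>t. g t - truncate R (g t)) < e / 2"
    by (rule that[rotated]) simp
  define g' where "g' = (\<lambda>t. indicator {a..b} t *\<^sub>R g t)"
  have "g' \<in> borel_measurable lborel"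
    using g_meas by (simp add: g'_def Icc_measure_def borel_measurable_restrict_space_iff)
  then have "g' measurable_on UNIV"
    by (intro lebesgue_measurable_imp_measurable_on) (auto intro: measurable_completion)
  then obtain N c where N: "negligible N" and c: "\<And>n. continuous_on UNIV (c n)"
    and lim: "\<And>t. t \<notin> N \<Longrightarrow> (\<lambda>n. c n t) \<longlonglongrightarrow> g' t"
    unfolding measurable_on_def by auto
  have c': "continuous_on UNIV (\<lambda>t. truncate R (c n t))" for n
    by (rule continuous_on_compose2[OF continuous_on_truncate[OF R(1), of UNIV] c]) simp
  have trunc_meas': "(\<lambda>t. truncate R (g t)) \<in> borel_measurable ?M"
    using borel_measurable_continuous_onI[OF continuous_on_truncate[OF R(1)]] g_meas
    by (rule measurable_compose_rev)
  have "(\<lambda>n. L2norm ?M (\<lambda>t. truncate R (g t) - truncate R (c n t))) \<longlonglongrightarrow> 0"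
  proof (rule L2norm_tendsto_0[where w="\<lambda>t. 2 * R"])
    show "(\<lambda>t. truncate R (g t) - truncate R (c n t)) \<in> borel_measurable ?M" for n
      using trunc_meas' measurable_Icc_continuous[OF continuous_on_subset[OF c'[of n]]] by simp
    show "integrable ?M (\<lambda>t. (2 * R)\<^sup>2)"
      by (rule integrable_Icc_continuous) simp
    show "AE t in ?M. norm (truncate R (g t) - truncate R (c n t)) \<le> 2 * R" for n
    proof (rule AE_I2)
      fix t
      show "norm (truncate R (g t) - truncate R (c n t)) \<le> 2 * R"
        using norm_triangle_ineq4[of "truncate R (g t)" "truncate R (c n t)"]
          norm_truncate_le[OF R(1), of "g t"] norm_truncate_le[OF R(1), of "c n t"] by linarith
    qed
    have "AE t in lborel. t \<notin> N"
      using AE_not_in[of N "completion lborel"] N by (simp add: negligible_iff_null_sets AE_completion_iff)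
    then show "AE t in ?M. (\<lambda>n. truncate R (g t) - truncate R (c n t)) \<longlonglongrightarrow> 0"
      unfolding AE_Icc
    proof eventually_elim
      case (elim t)
      show ?case
      proof
        assume "t \<in> {a..b}"
        then have "(\<lambda>n. c n t) \<longlonglongrightarrow> g t"
          using lim[OF elim] by (simp add: g'_def)
        then have "(\<lambda>n. truncate R (c n t)) \<longlonglongrightarrow> truncate R (g t)"
          using continuous_on_tendsto_compose[OF continuous_on_truncate[OF R(1), of UNIV]] by auto
        from tendsto_diff[OF tendsto_const this] show "(\<lambda>n. truncate R (g t) - truncate R (c n t)) \<longlonglongrightarrow> 0"
          by (metis diff_self)
      qed
    qed
  qed
  then have "\<forall>\<^sub>F n in sequentially. L2norm ?M (\<lambda>t. truncate R (g t) - truncate R (c n t)) < e / 2"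
    using \<open>0 < e\<close> by (intro order_tendstoD) auto
  then obtain n where n: "L2norm ?M (\<lambda>t. truncate R (g t) - truncate R (c n t)) < e / 2"
    using eventually_happens'[OF sequentially_bot] by blast
  have trunc_sq: "square_integrable ?M (\<lambda>t. truncate R (g t))"
    using trunc_meas' norm_truncate_le[OF R(1)]
    by (intro square_integrable_AE_bounded[where c=R] AE_I2) auto
  have "L2norm ?M (\<lambda>t. (g t - truncate R (g t)) + (truncate R (g t) - truncate R (c n t))) \<le>
      L2norm ?M (\<lambda>t. g t - truncate R (g t)) + L2norm ?M (\<lambda>t. truncate R (g t) - truncate R (c n t))"
    using trunc_sq g square_integrable_Icc_continuous[OF continuous_on_subset[OF c'[of n]]]
    by (intro L2norm_triangle square_integrable_diff) auto
  with R n have "L2norm ?M (\<lambda>t. g t - truncate R (c n t)) < e"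
    by simp
  with c'[of n] show ?thesis by (rule that)
qed

text \<open>By density and contractivity it suffices to treat a continuous function, for which the averages
converge uniformly.\<close>

lemma cell_average_tendsto:
  fixes g :: "real \<Rightarrow> 'a::euclidean_space"
  assumes \<tau>: "\<And>i. is_partition tf (N i) (\<tau> i)"
    and mesh: "\<And>d. 0 < d \<Longrightarrow> \<forall>\<^sub>F i in sequentially. \<forall>k<N i. \<tau> i (Suc k) - \<tau> i k < d"
    and g: "square_integrable (Icc_measure 0 tf) g" and tf: "0 \<le> tf"
  shows "(\<lambda>i. L2norm (Icc_measure 0 tf) (\<lambda>t. step_fun (N i) (\<tau> i) (cell_average (\<tau> i) g) t - g t)) \<longlonglongrightarrow> 0"
proof (rule LIMSEQ_I)
  fix e :: real assume "0 < e"
  let ?M = "Icc_measure 0 tf"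
  let ?A = "\<lambda>i u. step_fun (N i) (\<tau> i) (cell_average (\<tau> i) u)"
  obtain c where c: "continuous_on UNIV c" "L2norm ?M (\<lambda>t. g t - c t) < e / 4"
    using continuous_dense_L2[OF g, of "e / 4"] \<open>0 < e\<close> by auto
  have c_cont: "continuous_on S c" for S
    using c(1) continuous_on_subset by blast
  have c_sq: "square_integrable ?M c"
    by (rule square_integrable_Icc_continuous[OF c_cont])
  define C where "C = 1 + sqrt tf"
  define \<eta> where "\<eta> = e / (4 * C)"
  have "0 < C" using tf by (simp add: C_def add_pos_nonneg)
  then have \<eta>: "0 < \<eta>" "\<eta> * C = e / 4"
    using \<open>0 < e\<close> by (simp_all add: \<eta>_def)
  have "uniformly_continuous_on {0..tf} c"
    by (intro compact_uniformly_continuous c_cont) simp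
  then obtain d where d: "0 < d" and uc: "\<And>s t. s \<in> {0..tf} \<Longrightarrow> t \<in> {0..tf} \<Longrightarrow> dist t s < d \<Longrightarrow> dist (c t) (c s) < \<eta>"
    using \<eta>(1) unfolding uniformly_continuous_on_def by blast
  have "\<forall>\<^sub>F i in sequentially. norm (L2norm ?M (\<lambda>t. ?A i g t - g t) - 0) < e"
    using mesh[OF d]
  proof eventually_elim
    case (elim i)
    note part = \<tau>[of i]
    have close: "norm (?A i c t - c t) \<le> \<eta>" if t: "0 \<le> t" "t \<le> tf" "t \<notin> {0}" for t
    proof -
      obtain k where k: "k < N i" "\<tau> i k < t" "t \<le> \<tau> i (Suc k)"
        using partition_cell[OF part, of t] t by auto
      define \<delta> where "\<delta> = \<tau> i (Suc k) - \<tau> i k"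
      have \<delta>: "0 < \<delta>" "\<delta> < d" using k elim by (auto simp: \<delta>_def)
      have bounds: "0 \<le> \<tau> i k" "\<tau> i (Suc k) \<le> tf"
        using partition_bounds[OF part, of k] partition_bounds[OF part, of "Suc k"] k by auto
      let ?I = "Icc_measure (\<tau> i k) (\<tau> i (Suc k))"
      note int = integrable_Icc_continuous[OF c_cont] integrable_Icc_continuous[OF continuous_on_const]
      have "\<delta> *\<^sub>R (?A i c t - c t) = (LINT r|?I. c r) - (LINT r|?I. c t)"
        using \<delta>(1) by (simp add: step_fun_cell[OF part k] cell_average_def scaleR_diff_right \<delta>_def[symmetric])
          (simp add: \<delta>_def)
      also have "\<dots> = (LINT r|?I. c r - c t)"
        by (rule Bochner_Integration.integral_diff[OF int, symmetric])
      also have "norm \<dots> \<le> (LINT r|?I. \<eta>)"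
      proof (rule Bochner_Integration.integral_norm_bound_integral)
        fix r assume "r \<in> space ?I"
        then have "dist (c r) (c t) < \<eta>"
          using bounds k \<delta> t by (intro uc) (auto simp: \<delta>_def dist_norm abs_if)
        then show "norm (c r - c t) \<le> \<eta>" by (simp add: dist_norm)
      qed (auto intro!: int Bochner_Integration.integrable_diff)
      also have "\<dots> = \<delta> * \<eta>"
        using \<delta>(1) by (simp add: \<delta>_def)
      finally show ?thesis using \<delta>(1) by simp
    qed
    have A_sq: "square_integrable ?M (?A i u)" for u :: "real \<Rightarrow> 'a"
      by (rule square_integrable_step_fun[OF part])
    have "L2norm ?M (\<lambda>t. ?A i c t - c t) \<le> \<eta> * sqrt tf"
      using L2norm_le_AE_bound[of ?M "\<lambda>t. ?A i c t - c t" \<eta>] square_integrable_measurable[OF square_integrable_diff[OF A_sq[of c] c_sq]] \<eta>(1) tf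
        AE_Icc_except_finite[of "{0}" 0 tf "\<lambda>t. norm (?A i c t - c t) \<le> \<eta>"] close
      by simp
    also have "\<dots> \<le> \<eta> * C"
      using \<eta>(1) by (simp add: C_def)
    finally have 2: "L2norm ?M (\<lambda>t. ?A i c t - c t) \<le> e / 4"
      using \<eta>(2) by simp
    have int: "integrable ?M g" "integrable ?M c"
      using g c_sq by (auto intro: integrable_of_square_integrable)
    have linear: "?A i (\<lambda>t. g t - c t) = (\<lambda>t. ?A i g t - ?A i c t)"
      unfolding step_fun_def sum_subtractf[symmetric] scaleR_diff_right[symmetric]
      by (intro ext sum.cong) (auto simp: cell_average_diff[OF part int])
    have 1: "L2norm ?M (\<lambda>t. ?A i g t - ?A i c t) < e / 4"
      using L2norm_cell_average_le[OF part square_integrable_diff[OF g c_sq]] c(2)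
      unfolding linear by (rule order_le_less_trans)
    have 3: "L2norm ?M (\<lambda>t. c t - g t) < e / 4"
      using c(2) L2norm_uminus[of ?M "\<lambda>t. g t - c t"] by simp
    have "L2norm ?M (\<lambda>t. (?A i g t - ?A i c t) + ((?A i c t - c t) + (c t - g t)))
        \<le> L2norm ?M (\<lambda>t. ?A i g t - ?A i c t) + L2norm ?M (\<lambda>t. (?A i c t - c t) + (c t - g t))"
      by (intro L2norm_triangle square_integrable_diff square_integrable_add A_sq c_sq g)
    also have "L2norm ?M (\<lambda>t. (?A i c t - c t) + (c t - g t))
        \<le> L2norm ?M (\<lambda>t. ?A i c t - c t) + L2norm ?M (\<lambda>t. c t - g t)"
      by (intro L2norm_triangle square_integrable_diff A_sq c_sq g)
    finally have "L2norm ?M (\<lambda>t. ?A i g t - g t) < e"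
      using 1 2 3 \<open>0 < e\<close> by simp
    then show ?case by simp
  qed
  then show "\<exists>n0. \<forall>i\<ge>n0. norm (L2norm ?M (\<lambda>t. ?A i g t - g t) - 0) < e"
    by (simp add: eventually_sequentially)
qed

definition slope :: "(nat \<Rightarrow> real) \<Rightarrow> (real \<Rightarrow> 'a::real_vector) \<Rightarrow> nat \<Rightarrow> 'a" where
  "slope \<tau> x k = (x (\<tau> (Suc k)) - x (\<tau> k)) /\<^sub>R (\<tau> (Suc k) - \<tau> k)"

lemma PL_continuous: "x \<in> PL tf N \<tau> \<Longrightarrow> continuous_on {0..tf} x"
  by (simp add: PL_def cont_paths_def)

lemma PL_has_weak_derivative:
  fixes x :: "real \<Rightarrow> 'a::euclidean_space"
  assumes tf: "0 \<le> tf" and \<tau>: "is_partition tf N \<tau>" and x: "x \<in> PL tf N \<tau>"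
  shows "has_weak_derivative tf x (step_fun N \<tau> (slope \<tau> x))"
proof (rule has_weak_derivative_piecewise[OF tf PL_continuous[OF x]])
  show "finite (\<tau> ` {..N})" by simp
  show "integrable (Icc_measure 0 tf) (step_fun N \<tau> (slope \<tau> x))"
    by (intro integrable_of_square_integrable square_integrable_step_fun[OF \<tau>]) simp
  fix t assume t: "0 < t" "t < tf" "t \<notin> \<tau> ` {..N}"
  then obtain k where k: "k < N" "\<tau> k < t" "t \<le> \<tau> (Suc k)"
    using partition_cell[OF \<tau>, of t] by auto
  with t have k': "t < \<tau> (Suc k)" by (cases "t = \<tau> (Suc k)") auto
  obtain a b where ab: "\<And>s. s \<in> {\<tau> k..\<tau> (Suc k)} \<Longrightarrow> x s = a + s *\<^sub>R b"
    using x k(1) unfolding PL_def by blast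
  have "slope \<tau> x k = b"
    using k ab[of "\<tau> k"] ab[of "\<tau> (Suc k)"]
    by (simp add: slope_def scaleR_diff_left[symmetric])
  moreover have "(x has_vector_derivative b) (at t)"
  proof (rule has_vector_derivative_transform_within_open)
    show "((\<lambda>s. a + s *\<^sub>R b) has_vector_derivative b) (at t)"
      by (auto intro!: derivative_eq_intros)
    show "open {\<tau> k<..<\<tau> (Suc k)}" "t \<in> {\<tau> k<..<\<tau> (Suc k)}"
      using k k' by auto
    show "a + s *\<^sub>R b = x s" if "s \<in> {\<tau> k<..<\<tau> (Suc k)}" for s
      using that ab[of s] by simp
  qed
  ultimately show "(x has_vector_derivative step_fun N \<tau> (slope \<tau> x) t) (at t)"
    unfolding step_fun_cell[OF \<tau> k] by simp
qed

lemma PL_subset_W2: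
  fixes x :: "real \<Rightarrow> 'a::euclidean_space"
  assumes tf: "0 \<le> tf" and \<tau>: "is_partition tf N \<tau>" and x: "x \<in> PL tf N \<tau>"
  shows "x \<in> W2 tf"
proof (rule W2_of_bounded_weak_derivative[OF _ PL_continuous[OF x] PL_has_weak_derivative[OF assms]])
  show "x \<in> extensional {0..tf}"
    using x by (simp add: PL_def cont_paths_def)
  have "norm (slope \<tau> x k) \<le> (\<Sum>k<N. norm (slope \<tau> x k))" if "k < N" for k
    using that by (intro member_le_sum) auto
  then show "norm (step_fun N \<tau> (slope \<tau> x) t) \<le> (\<Sum>k<N. norm (slope \<tau> x k))" if "t \<in> {0..tf}" for t
    using that by (intro norm_step_fun_le[OF _ \<tau>]) (auto intro: sum_nonneg)
qed

text \<open>Integrating the step function of the slopes makes the interpolant continuous at the breaks by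
construction.\<close>

definition pl_interpolant :: "real \<Rightarrow> nat \<Rightarrow> (nat \<Rightarrow> real) \<Rightarrow> (real \<Rightarrow> 'a::euclidean_space) \<Rightarrow> real \<Rightarrow> 'a" where
  "pl_interpolant tf N \<tau> x =
     restrict (\<lambda>t. x 0 + (LINT s|Icc_measure 0 t. step_fun N \<tau> (slope \<tau> x) s)) {0..tf}"

lemma pl_interpolant_facts:
  fixes x :: "real \<Rightarrow> 'a::euclidean_space"
  assumes tf: "0 \<le> tf" and \<tau>: "is_partition tf N \<tau>"
  shows pl_interpolant_PL: "pl_interpolant tf N \<tau> x \<in> PL tf N \<tau>"
    and pl_interpolant_node: "k \<le> N \<Longrightarrow> pl_interpolant tf N \<tau> x (\<tau> k) = x (\<tau> k)"
    and pl_interpolant_cell: "k < N \<Longrightarrow> t \<in> {\<tau> k..\<tau> (Suc k)} \<Longrightarrow>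
      pl_interpolant tf N \<tau> x t = pl_interpolant tf N \<tau> x (\<tau> k) + (t - \<tau> k) *\<^sub>R slope \<tau> x k"
proof -
  let ?p = "pl_interpolant tf N \<tau> x" and ?s = "step_fun N \<tau> (slope \<tau> x)"
  have int: "integrable (Icc_measure 0 tf) ?s"
    by (intro integrable_of_square_integrable square_integrable_step_fun[OF \<tau>]) simp
  show cell: "?p t = ?p (\<tau> k) + (t - \<tau> k) *\<^sub>R slope \<tau> x k"
    if k: "k < N" and t: "t \<in> {\<tau> k..\<tau> (Suc k)}" for k t
  proof -
    have b: "0 \<le> \<tau> k" "\<tau> (Suc k) \<le> tf"
      using partition_bounds[OF \<tau>, of k] partition_bounds[OF \<tau>, of "Suc k"] k by auto
    have "(LINT s|Icc_measure 0 t. ?s s) = (LINT s|Icc_measure 0 (\<tau> k). ?s s) + (LINT s|Icc_measure (\<tau> k) t. ?s s)"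
      using b t by (intro integral_Icc_combine integrable_Icc_subset[OF int]) auto
    also have "(LINT s|Icc_measure (\<tau> k) t. ?s s) = (t - \<tau> k) *\<^sub>R slope \<tau> x k"
      using t by (intro integral_step_fun_cell[OF \<tau> k]) auto
    finally show ?thesis
      using b t by (simp add: pl_interpolant_def)
  qed
  show node: "?p (\<tau> k) = x (\<tau> k)" if "k \<le> N" for k
    using that
  proof (induction k)
    case 0
    then show ?case
      using \<tau> tf by (simp add: is_partition_def pl_interpolant_def integral_Icc_point)
  next
    case (Suc k)
    then have "\<tau> k < \<tau> (Suc k)" using \<tau> by (simp add: is_partition_def)
    with Suc show ?case
      using cell[of k "\<tau> (Suc k)"] by (simp add: slope_def)
  qed
  have "continuous_on {0..tf} ?p"
  proof (rule continuous_on_eq)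
    show "continuous_on {0..tf} (\<lambda>t. x 0 + (LINT s|Icc_measure 0 t. ?s s))"
      by (intro continuous_on_add continuous_on_const continuous_on_indefinite_integral_Icc int)
  qed (simp add: pl_interpolant_def)
  moreover have "\<exists>a b. \<forall>t\<in>{\<tau> k..\<tau> (Suc k)}. ?p t = a + t *\<^sub>R b" if "k < N" for k
  proof (intro exI ballI)
    fix t assume "t \<in> {\<tau> k..\<tau> (Suc k)}"
    from cell[OF that this]
    show "?p t = (?p (\<tau> k) - \<tau> k *\<^sub>R slope \<tau> x k) + t *\<^sub>R slope \<tau> x k"
      by (simp add: scaleR_diff_left)
  qed
  ultimately show "?p \<in> PL tf N \<tau>"
    by (auto simp: PL_def cont_paths_def pl_interpolant_def)
qed

text \<open>The Euler path agrees with its own piecewise linear interpolant, and is therefore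
continuous.\<close>

lemma euler_path_PL:
  fixes h :: "real \<Rightarrow> real^'n \<Rightarrow> real^'q \<Rightarrow> real^'m \<Rightarrow> real^'q"
  assumes tf: "0 \<le> tf" and \<tau>: "is_partition tf N \<tau>"
  shows "euler_path tf N \<tau> h x \<zeta> \<theta> \<in> PL tf N \<tau>"
proof -
  define e where "e = euler_path tf N \<tau> h x \<zeta> \<theta>"
  let ?p = "pl_interpolant tf N \<tau> e"
  define v where "v = (\<lambda>k. h (\<tau> k) (x (\<tau> k)) (e (\<tau> k)) \<theta>)"
  have cell: "e t = e (\<tau> k) + (t - \<tau> k) *\<^sub>R v k" if "k < N" "t \<in> {\<tau> k<..\<tau> (Suc k)}" for k t
    unfolding v_def by (rule euler_path_step[OF \<tau> that e_def])
  have slope: "slope \<tau> e k = v k" if "k < N" for k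
  proof -
    have "\<tau> k < \<tau> (Suc k)" using that \<tau> by (simp add: is_partition_def)
    then show ?thesis
      using cell[of k "\<tau> (Suc k)"] that by (simp add: slope_def)
  qed
  have "?p t = e t" if t: "t \<in> {0..tf}" for t
  proof (cases "t = 0")
    case True
    then show ?thesis
      using pl_interpolant_node[OF tf \<tau>, of 0 e] \<tau> by (simp add: is_partition_def)
  next
    case False
    then obtain k where k: "k < N" "\<tau> k < t" "t \<le> \<tau> (Suc k)"
      using partition_cell[OF \<tau>, of t] t by auto
    then show ?thesis
      using pl_interpolant_cell[OF tf \<tau> k(1), of t e] pl_interpolant_node[OF tf \<tau>, of k e] cell[of k t] slope[of k]
      by simp
  qed
  moreover have "?p \<in> extensional {0..tf}" "e \<in> extensional {0..tf}"
    by (simp_all add: pl_interpolant_def e_def euler_path_def)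
  ultimately have "?p = e"
    by (blast intro: extensionalityI)
  then show ?thesis
    using pl_interpolant_PL[OF tf \<tau>, of e] by (simp add: e_def)
qed

text \<open>This is where interpolation of a path turns into averaging of its derivative.\<close>

lemma slope_eq_cell_average:
  fixes x :: "real \<Rightarrow> 'a::euclidean_space"
  assumes tf: "0 \<le> tf" and \<tau>: "is_partition tf N \<tau>" and x: "x \<in> W2 tf" and k: "k < N"
  shows "slope \<tau> x k = cell_average \<tau> (weak_derivative tf x) k"
proof -
  have "x (\<tau> (Suc k)) - x (\<tau> k) = (LINT t|Icc_measure (\<tau> k) (\<tau> (Suc k)). weak_derivative tf x t)"
    using partition_bounds[OF \<tau>, of k] partition_bounds[OF \<tau>, of "Suc k"] partition_mono[OF \<tau>, of k "Suc k"] k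
    by (intro weak_derivative_increment[OF W2_continuous[OF x] W2_weak_derivative(1)[OF tf x]]) auto
  then show ?thesis
    by (simp add: slope_def cell_average_def)
qed

lemma pl_interpolant_tendsto:
  fixes x :: "real \<Rightarrow> 'a::euclidean_space"
  assumes tf: "0 \<le> tf" and \<tau>: "\<And>i. is_partition tf (N i) (\<tau> i)"
    and mesh: "\<And>d. 0 < d \<Longrightarrow> \<forall>\<^sub>F i in sequentially. \<forall>k<N i. \<tau> i (Suc k) - \<tau> i k < d"
    and x: "x \<in> W2 tf"
  shows "limitin (W2_topology tf) (\<lambda>i. pl_interpolant tf (N i) (\<tau> i) x) x sequentially"
proof -
  let ?p = "\<lambda>i. pl_interpolant tf (N i) (\<tau> i) x" and ?g = "weak_derivative tf x"
  have W2: "?p i \<in> W2 tf" for i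
    by (rule PL_subset_W2[OF tf \<tau> pl_interpolant_PL[OF tf \<tau>]])
  have "L2norm (Icc_measure 0 tf) (\<lambda>t. weak_derivative tf (?p i) t - ?g t)
      = L2norm (Icc_measure 0 tf) (\<lambda>t. step_fun (N i) (\<tau> i) (cell_average (\<tau> i) ?g) t - ?g t)" for i
  proof -
    have "slope (\<tau> i) (?p i) k = cell_average (\<tau> i) ?g k" if "k < N i" for k
      using that slope_eq_cell_average[OF tf \<tau> x that] pl_interpolant_node[OF tf \<tau>, of _ i x]
      by (simp add: slope_def)
    then have step: "step_fun (N i) (\<tau> i) (slope (\<tau> i) (?p i)) = step_fun (N i) (\<tau> i) (cell_average (\<tau> i) ?g)"
      by (simp add: step_fun_def fun_eq_iff)
    note wd = PL_has_weak_derivative[OF tf \<tau> pl_interpolant_PL[OF tf \<tau>], of i x, unfolded step]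
    have "AE t in Icc_measure 0 tf. weak_derivative tf (?p i) t - ?g t
        = step_fun (N i) (\<tau> i) (cell_average (\<tau> i) ?g) t - ?g t"
      using has_weak_derivative_unique[OF tf W2_weak_derivative(1)[OF tf W2] wd]
      by eventually_elim simp
    then show ?thesis
      using W2_weak_derivative(2)[OF tf W2, of i] W2_weak_derivative(2)[OF tf x] square_integrable_step_fun[OF \<tau>]
      by (intro L2norm_cong_AE borel_measurable_diff square_integrable_measurable)
  qed
  moreover have "?p i 0 = x 0" for i
    using pl_interpolant_node[OF tf \<tau>, of 0 i x] \<tau>[of i] by (simp add: is_partition_def)
  ultimately show ?thesis
    using limitin_W2_topology[OF tf W2 x] cell_average_tendsto[OF \<tau> mesh W2_weak_derivative(2)[OF tf x] tf]
    by simp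
qed

section \<open>The likelihood and the prior\<close>

text \<open>For an open neighbourhood \<open>U\<close> of \<open>g v\<close>, the set of points where
\<open>g\<close> has values in \<open>U\<close> and the density is positive is open and nonempty, so it has
positive Lebesgue measure and carries mass.\<close>

lemma positive_density_imp_law_support:
  fixes V :: "'w \<Rightarrow> 'a::euclidean_space" and g :: "'a \<Rightarrow> 'b::topological_space"
  assumes V: "distributed M lborel V (\<lambda>v. ennreal (p v))"
    and p: "continuous_on UNIV p" "0 < p v" and g: "continuous_on UNIV g"
  shows "g v \<in> law_support M (\<lambda>\<omega>. g (V \<omega>))"
proof -
  have "0 < emeasure (distr M borel (\<lambda>\<omega>. g (V \<omega>))) U" if U: "open U" "g v \<in> U" for U
  proof (rule ccontr)
    assume *: "\<not> 0 < emeasure (distr M borel (\<lambda>\<omega>. g (V \<omega>))) U"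
    define A where "A = g -` U \<inter> {w. 0 < p w}"
    have p_meas: "p \<in> borel_measurable borel" and g_meas: "g \<in> borel_measurable borel"
      using p g by (auto intro: borel_measurable_continuous_onI)
    have V_meas: "V \<in> measurable M borel"
      using distributed_measurable[OF V] by simp
    have pre: "open (g -` U)"
      using g U by (simp add: continuous_on_open_vimage)
    then have "open A"
      unfolding A_def using p by (intro open_Int open_Collect_less) auto
    moreover have "v \<in> A"
      using U p by (simp add: A_def)
    ultimately have "\<not> negligible A"
      using open_not_negligible by blast
    moreover have "A \<in> null_sets lborel"
    proof -
      have "emeasure (distr M borel (\<lambda>\<omega>. g (V \<omega>))) U = emeasure M (V -` (g -` U) \<inter> space M)"
        using U V_meas g_meas by (subst emeasure_distr) (auto simp: vimage_def intro: measurable_compose)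
      also have "\<dots> = (\<integral>\<^sup>+w. ennreal (p w) * indicator (g -` U) w \<partial>lborel)"
        using pre by (intro distributed_emeasure[OF V]) auto
      finally have "(\<integral>\<^sup>+w. ennreal (p w) * indicator (g -` U) w \<partial>lborel) = 0"
        using * by (simp add: zero_less_iff_neq_zero)
      moreover have "(\<lambda>w. ennreal (p w) * indicator (g -` U) w) \<in> borel_measurable lborel"
        using p_meas borel_open[OF pre] by simp
      ultimately have "AE w in lborel. ennreal (p w) * indicator (g -` U) w = 0"
        by (simp add: nn_integral_0_iff_AE)
      then have "AE w in lborel. w \<notin> A"
        by eventually_elim (auto simp: A_def split: split_indicator_asm)
      then show ?thesis
        using \<open>open A\<close> by (simp add: AE_iff_null_sets)
    qed
    ultimately show False
      by (simp add: negligible_iff_null_sets null_sets_completionI)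
  qed
  then show ?thesis by (simp add: law_support_def)
qed

lemma closed_law_support: "closed (law_support M V)"
proof -
  have "\<exists>T. open T \<and> v \<in> T \<and> T \<subseteq> - law_support M V" if v: "v \<notin> law_support M V" for v
  proof -
    obtain U where "open U" "v \<in> U" "\<not> 0 < emeasure (distr M borel V) U"
      using v by (auto simp: law_support_def)
    then show ?thesis
      by (intro exI[of _ U]) (auto simp: law_support_def)
  qed
  then have "open (- law_support M V)"
    by (subst open_subopen) auto
  then show ?thesis by (simp add: closed_def)
qed

lemma topspace_cont_paths_topology [simp]: "0 \<le> tf \<Longrightarrow> topspace (cont_paths_topology tf) = cont_paths tf"
  unfolding cont_paths_topology_def by (rule Metric_space.topspace_mtopology[OF Metric_space_cont_paths])

lemma limitin_cont_paths_topology: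
  fixes x :: "real \<Rightarrow> 'a::euclidean_space"
  assumes tf: "0 \<le> tf" and x: "\<And>i. x' i \<in> cont_paths tf" "x \<in> cont_paths tf"
    and lim: "uniform_limit {0..tf} x' x sequentially"
  shows "limitin (cont_paths_topology tf) x' x sequentially"
proof -
  have "(\<lambda>i. sup_dist tf (x' i) x) \<longlonglongrightarrow> 0"
  proof (rule LIMSEQ_I)
    fix e :: real assume "0 < e"
    then have "\<forall>\<^sub>F i in sequentially. \<forall>t\<in>{0..tf}. dist (x' i t) (x t) < e / 2"
      by (intro uniform_limitD[OF lim]) simp
    then have "\<forall>\<^sub>F i in sequentially. norm (sup_dist tf (x' i) x - 0) < e"
    proof eventually_elim
      case (elim i)
      have "sup_dist tf (x' i) x \<le> e / 2"
      proof -
        have "(SUP t\<in>{0..tf}. norm (x' i t - x t)) \<le> e / 2"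
          using tf elim by (intro cSUP_least) (auto simp: dist_norm less_imp_le)
        with x show ?thesis by (simp add: sup_dist_def)
      qed
      moreover have "0 \<le> sup_dist tf (x' i) x"
        by (rule Metric_space.nonneg[OF Metric_space_cont_paths[OF tf]])
      ultimately show ?case using \<open>0 < e\<close> by simp
    qed
    then show "\<exists>n0. \<forall>i\<ge>n0. norm (sup_dist tf (x' i) x - 0) < e"
      by (simp add: eventually_sequentially)
  qed
  then show ?thesis
    unfolding cont_paths_topology_def using x
    by (subst Metric_space.limitin_metric_dist_null[OF Metric_space_cont_paths[OF tf]]) simp
qed

lemma continuous_likelihood_tendsto:
  fixes x :: "real \<Rightarrow> 'a::euclidean_space" and z :: "real \<Rightarrow> 'b::euclidean_space"
    and \<theta> :: "'c::topological_space" and \<psi> :: "_ \<Rightarrow> _ \<Rightarrow> _ \<Rightarrow> real"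
  assumes tf: "0 \<le> tf"
    and \<psi>: "continuous_map
        (prod_topology (cont_paths_topology tf) (prod_topology (cont_paths_topology tf) euclidean))
        euclidean (\<lambda>(x, z, \<theta>). \<psi> x z \<theta>)"
    and x: "\<And>i. x' i \<in> cont_paths tf" "x \<in> cont_paths tf" "uniform_limit {0..tf} x' x sequentially"
    and z: "\<And>i. z' i \<in> cont_paths tf" "z \<in> cont_paths tf" "uniform_limit {0..tf} z' z sequentially"
    and \<theta>: "\<theta>' \<longlonglongrightarrow> \<theta>"
  shows "(\<lambda>i. \<psi> (x' i) (z' i) (\<theta>' i)) \<longlonglongrightarrow> \<psi> x z \<theta>"
proof -
  have "limitin (prod_topology (cont_paths_topology tf) (prod_topology (cont_paths_topology tf) euclidean))
      (\<lambda>i. (x' i, z' i, \<theta>' i)) (x, z, \<theta>) sequentially"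
    using limitin_cont_paths_topology[OF tf x] limitin_cont_paths_topology[OF tf z] \<theta>
    by (simp add: limitin_pairwise o_def)
  from continuous_map_limit[OF \<psi> this] show ?thesis
    by (simp add: o_def)
qed

lemma eln_tendsto:
  assumes "r \<longlonglongrightarrow> a" "\<And>i. 0 \<le> r i" "0 \<le> a"
  shows "(\<lambda>i. eln (r i)) \<longlonglongrightarrow> eln a"
proof (cases "a = 0")
  case True
  have "\<forall>\<^sub>F i in sequentially. eln (r i) < ereal b" for b
  proof -
    have "\<forall>\<^sub>F i in sequentially. r i < exp b"
      using assms(1) True by (intro order_tendstoD) auto
    then show ?thesis
    proof eventually_elim
      case (elim i)
      then have "0 < r i \<Longrightarrow> ln (r i) < b"
        by (metis exp_gt_zero ln_exp ln_less_cancel_iff)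
      then show ?case
        using assms(2)[of i] by (auto simp: eln_def)
    qed
  qed
  then show ?thesis
    using True by (simp add: eln_def tendsto_MInfty)
next
  case False
  then have "0 < a" using assms(3) by simp
  then have "\<forall>\<^sub>F i in sequentially. 0 < r i"
    using assms(1) by (intro order_tendstoD)
  then have "\<forall>\<^sub>F i in sequentially. ereal (ln (r i)) = eln (r i)"
    by eventually_elim (simp add: eln_def)
  moreover have "(\<lambda>i. ereal (ln (r i))) \<longlonglongrightarrow> ereal (ln a)"
    using assms(1) \<open>0 < a\<close> by (intro tendsto_ereal tendsto_ln) auto
  ultimately show ?thesis
    using False by (auto simp: eln_def intro: Lim_transform_eventually)
qed

lemma eln_not_PInf: "eln r \<noteq> \<infinity>"
  by (simp add: eln_def)

text \<open>Addition of extended reals is continuous here, since no summand is ever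
\<open>+\<infinity>\<close>.\<close>

lemma log_posterior_tendsto:
  assumes "p \<longlonglongrightarrow> a" "\<And>i. 0 \<le> p i" "0 \<le> a" and "q \<longlonglongrightarrow> b" "\<And>i. 0 \<le> q i" "0 \<le> b" and "J \<longlonglongrightarrow> c"
  shows "(\<lambda>i. eln (p i) + eln (q i) - ereal (J i)) \<longlonglongrightarrow> eln a + eln b - ereal c"
proof -
  have "(\<lambda>i. eln (p i) + eln (q i)) \<longlonglongrightarrow> eln a + eln b"
    using eln_tendsto[OF assms(1-3)] eln_tendsto[OF assms(4-6)] eln_not_PInf
    by (intro tendsto_add_ereal_general) auto
  moreover have "(\<lambda>i. ereal (- J i)) \<longlonglongrightarrow> ereal (- c)"
    using assms(7) by (intro tendsto_ereal tendsto_minus)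
  ultimately have "(\<lambda>i. eln (p i) + eln (q i) + ereal (- J i)) \<longlonglongrightarrow> eln a + eln b + ereal (- c)"
    by (rule tendsto_add_ereal_general1[rotated]) simp
  then show ?thesis
    by (simp add: minus_ereal_def)
qed

section \<open>Convergence of the energy\<close>

lemma step_fun_linear:
  assumes "linear T"
  shows "T (step_fun N \<tau> v t) = step_fun N \<tau> (\<lambda>k. T (v k)) t"
  unfolding step_fun_def using assms by (simp add: linear_sum linear_scale)

lemma step_fun_diff: "step_fun N \<tau> (\<lambda>k. v k - w k) t = step_fun N \<tau> v t - step_fun N \<tau> w t"
  by (simp add: step_fun_def scaleR_diff_right sum_subtractf)

text \<open>On a piecewise linear path both the derivative and the sampled drift are constant on the cells, so
the discrete energy is an integral. The right-hand side no longer refers to piecewise linearity.\<close>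

lemma PL_energy_eq_L2norm:
  fixes x :: "real \<Rightarrow> real^'n" and A :: "real^'n^'k"
  assumes tf: "0 \<le> tf" and \<tau>: "is_partition tf N \<tau>" and x: "x \<in> PL tf N \<tau>"
  shows "(\<Sum>k<N. (\<tau> (Suc k) - \<tau> k) *
      (norm (A *v ((x (\<tau> (Suc k)) - x (\<tau> k)) /\<^sub>R (\<tau> (Suc k) - \<tau> k) - F k)))\<^sup>2)
    = (L2norm (Icc_measure 0 tf) (\<lambda>t. A *v (weak_derivative tf x t - step_fun N \<tau> F t)))\<^sup>2"
proof -
  have A: "bounded_linear ((*v) A)"
    by (rule matrix_vector_mul_bounded_linear)
  have x': "x \<in> W2 tf"
    by (rule PL_subset_W2[OF assms])
  have "(\<Sum>k<N. (\<tau> (Suc k) - \<tau> k) * (norm (A *v (slope \<tau> x k - F k)))\<^sup>2)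
      = (L2norm (Icc_measure 0 tf) (step_fun N \<tau> (\<lambda>k. A *v (slope \<tau> x k - F k))))\<^sup>2"
    by (rule L2norm_step_fun[OF \<tau>, symmetric])
  also have "step_fun N \<tau> (\<lambda>k. A *v (slope \<tau> x k - F k))
      = (\<lambda>t. A *v (step_fun N \<tau> (slope \<tau> x) t - step_fun N \<tau> F t))"
    unfolding step_fun_diff[symmetric] step_fun_linear[OF bounded_linear.linear[OF A]] by (rule refl)
  also have "L2norm (Icc_measure 0 tf) \<dots>
      = L2norm (Icc_measure 0 tf) (\<lambda>t. A *v (weak_derivative tf x t - step_fun N \<tau> F t))"
  proof (rule L2norm_cong_AE)
    show "(\<lambda>t. A *v (step_fun N \<tau> (slope \<tau> x) t - step_fun N \<tau> F t)) \<in> borel_measurable (Icc_measure 0 tf)"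
      "(\<lambda>t. A *v (weak_derivative tf x t - step_fun N \<tau> F t)) \<in> borel_measurable (Icc_measure 0 tf)"
      by (intro square_integrable_measurable square_integrable_linear[OF A] square_integrable_diff
          square_integrable_step_fun[OF \<tau>] W2_weak_derivative(2)[OF tf x'])+
    show "AE t in Icc_measure 0 tf. A *v (step_fun N \<tau> (slope \<tau> x) t - step_fun N \<tau> F t)
        = A *v (weak_derivative tf x t - step_fun N \<tau> F t)"
      using has_weak_derivative_unique[OF tf PL_has_weak_derivative[OF assms] W2_weak_derivative(1)[OF tf x']]
      by eventually_elim simp
  qed
  finally show ?thesis by (simp add: slope_def)
qed

lemma W2_limit_imp_uniform_limit:
  fixes x :: "real \<Rightarrow> 'a::euclidean_space"
  assumes tf: "0 \<le> tf" and x: "\<And>i. x' i \<in> W2 tf" "x \<in> W2 tf"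
    and lim: "limitin (W2_topology tf) x' x sequentially"
  shows "uniform_limit {0..tf} x' x sequentially"
proof (rule uniform_limitI)
  fix e :: real assume "0 < e"
  have C: "0 < 1 + sqrt tf" using tf by (simp add: add_pos_nonneg)
  have "(\<lambda>i. W2_norm tf (\<lambda>t. x' i t - x t)) \<longlonglongrightarrow> 0"
    using lim x unfolding W2_topology_def
    by (subst (asm) Metric_space.limitin_metric_dist_null[OF Metric_space_W2[OF tf]]) simp
  then have "\<forall>\<^sub>F i in sequentially. W2_norm tf (\<lambda>t. x' i t - x t) < e / (1 + sqrt tf)"
    using C \<open>0 < e\<close> by (intro order_tendstoD) auto
  then show "\<forall>\<^sub>F i in sequentially. \<forall>t\<in>{0..tf}. dist (x' i t) (x t) < e"
  proof eventually_elim
    case (elim i)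
    then have "(1 + sqrt tf) * W2_norm tf (\<lambda>t. x' i t - x t) < e"
      using C by (simp add: less_divide_eq mult.commute)
    then show ?case
      unfolding dist_norm by (blast intro: le_less_trans[OF norm_diff_le_W2_norm[OF tf x]])
  qed
qed

text \<open>Sampling at the left end of a cell moves the arguments of \<open>f\<close> by an amount that is
small uniformly in time.\<close>

lemma sampled_drift_tendsto:
  fixes f :: "real \<Rightarrow> real^'n \<Rightarrow> real^'q \<Rightarrow> real^'m \<Rightarrow> real^'n"
  assumes tf: "0 \<le> tf" and \<tau>: "\<And>i. is_partition tf (N i) (\<tau> i)"
    and mesh: "\<And>d. 0 < d \<Longrightarrow> \<forall>\<^sub>F i in sequentially. \<forall>k<N i. \<tau> i (Suc k) - \<tau> i k < d"
    and f: "uniformly_continuous_on ({0..tf} \<times> UNIV \<times> UNIV \<times> S) (\<lambda>(t, x, z, \<theta>). f t x z \<theta>)"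
    and \<theta>: "\<theta> \<in> S" "\<And>i. \<theta>' i \<in> S" "\<theta>' \<longlonglongrightarrow> \<theta>"
    and x: "continuous_on {0..tf} x" "uniform_limit {0..tf} x' x sequentially"
    and z: "continuous_on {0..tf} z" "uniform_limit {0..tf} z' z sequentially"
  shows "(\<lambda>i. L2norm (Icc_measure 0 tf) (\<lambda>t.
      step_fun (N i) (\<tau> i) (\<lambda>k. f (\<tau> i k) (x' i (\<tau> i k)) (z' i (\<tau> i k)) (\<theta>' i)) t
      - f t (x t) (z t) \<theta>)) \<longlonglongrightarrow> 0" (is "(\<lambda>i. L2norm _ (?D i)) \<longlonglongrightarrow> 0")
    and "continuous_on {0..tf} (\<lambda>t. f t (x t) (z t) \<theta>)"
proof -
  have f_cont: "continuous_on ({0..tf} \<times> UNIV \<times> UNIV \<times> S) (\<lambda>(t, x, z, \<theta>). f t x z \<theta>)"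
    by (rule uniformly_continuous_imp_continuous[OF f])
  have "continuous_on {0..tf} (\<lambda>t. (t, x t, z t, \<theta>))"
    by (intro continuous_intros x z)
  from continuous_on_compose2[OF f_cont this] \<theta>(1)
  show F_cont: "continuous_on {0..tf} (\<lambda>t. f t (x t) (z t) \<theta>)"
    by force
  have "uniformly_continuous_on {0..tf} (\<lambda>t. (x t, z t))"
    by (intro compact_uniformly_continuous continuous_intros x z) auto
  note uc_path = this[unfolded uniformly_continuous_on_def]
  show "(\<lambda>i. L2norm (Icc_measure 0 tf) (?D i)) \<longlonglongrightarrow> 0"
  proof (rule LIMSEQ_I)
    fix e :: real assume "0 < e"
    define C where "C = 1 + sqrt tf"
    define \<eta> where "\<eta> = e / (2 * C)"
    have C: "0 < C" "sqrt tf \<le> C" using tf by (simp_all add: C_def add_pos_nonneg)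
    then have \<eta>: "0 < \<eta>" "\<eta> * C = e / 2" using \<open>0 < e\<close> by (simp_all add: \<eta>_def)
    \<comment> \<open>The budget d is shared equally by the four arguments of f; those of x and z are split again
      between the convergence of the paths and the change of time.\<close>
    obtain d where d: "0 < d" and uc: "\<And>t x z \<theta> t' x' z' \<theta>'.
        t \<in> {0..tf} \<Longrightarrow> t' \<in> {0..tf} \<Longrightarrow> \<theta> \<in> S \<Longrightarrow> \<theta>' \<in> S \<Longrightarrow>
        dist (t', x', z', \<theta>') (t, x, z, \<theta>) < d \<Longrightarrow> norm (f t' x' z' \<theta>' - f t x z \<theta>) < \<eta>"
      using f[unfolded uniformly_continuous_on_def, rule_format, OF \<eta>(1)] by (force simp: dist_norm)
    obtain \<omega> where \<omega>: "0 < \<omega>" and path: "\<And>s t. s \<in> {0..tf} \<Longrightarrow> t \<in> {0..tf} \<Longrightarrow> dist t s < \<omega> \<Longrightarrow>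
        dist (x t, z t) (x s, z s) < d / 8"
      using uc_path d by (metis zero_less_divide_iff zero_less_numeral)
    have "\<forall>\<^sub>F i in sequentially. \<forall>k<N i. \<tau> i (Suc k) - \<tau> i k < min \<omega> (d / 4)"
      using \<omega> d by (intro mesh) simp
    moreover have "\<forall>\<^sub>F i in sequentially. \<forall>t\<in>{0..tf}. dist (x' i t) (x t) < d / 8"
      using d by (intro uniform_limitD[OF x(2)]) simp
    moreover have "\<forall>\<^sub>F i in sequentially. \<forall>t\<in>{0..tf}. dist (z' i t) (z t) < d / 8"
      using d by (intro uniform_limitD[OF z(2)]) simp
    moreover have "\<forall>\<^sub>F i in sequentially. dist (\<theta>' i) \<theta> < d / 4"
      using d by (intro tendstoD[OF \<theta>(3)]) simp
    ultimately have "\<forall>\<^sub>F i in sequentially. norm (L2norm (Icc_measure 0 tf) (?D i) - 0) < e"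
    proof eventually_elim
      case (elim i)
      note part = \<tau>[of i]
      have "norm (?D i t) \<le> \<eta>" if t: "0 \<le> t" "t \<le> tf" "t \<notin> {0}" for t
      proof -
        obtain k where k: "k < N i" "\<tau> i k < t" "t \<le> \<tau> i (Suc k)"
          using partition_cell[OF part, of t] t by auto
        let ?s = "\<tau> i k"
        have s: "?s \<in> {0..tf}" "t \<in> {0..tf}"
          using partition_bounds[OF part, of k] t k by auto
        have st: "dist ?s t < min \<omega> (d / 4)"
          using k elim(1) by (force simp: dist_norm)
        then have "dist (x ?s, z ?s) (x t, z t) < d / 8"
          by (intro path s) simp
        then have "dist (x ?s) (x t) < d / 8" "dist (z ?s) (z t) < d / 8"
          using dist_fst_le[of "(x ?s, z ?s)" "(x t, z t)"] dist_snd_le[of "(x ?s, z ?s)" "(x t, z t)"] by auto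
        moreover have "dist (x' i ?s) (x ?s) < d / 8" "dist (z' i ?s) (z ?s) < d / 8"
          using elim(2,3) s(1) by auto
        ultimately have xz: "dist (x' i ?s) (x t) < d / 4" "dist (z' i ?s) (z t) < d / 4"
          using dist_triangle[of "x' i ?s" "x t" "x ?s"] dist_triangle[of "z' i ?s" "z t" "z ?s"] by linarith+
        have "dist (?s, x' i ?s, z' i ?s, \<theta>' i) (t, x t, z t, \<theta>)
            \<le> dist ?s t + (dist (x' i ?s) (x t) + (dist (z' i ?s) (z t) + dist (\<theta>' i) \<theta>))"
          by (intro order_trans[OF dist_Pair_le] add_left_mono dist_Pair_le)
        then have "dist (?s, x' i ?s, z' i ?s, \<theta>' i) (t, x t, z t, \<theta>) < d"
          using st xz elim(4) by simp
        then have "norm (f ?s (x' i ?s) (z' i ?s) (\<theta>' i) - f t (x t) (z t) \<theta>) < \<eta>"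
          by (intro uc s \<theta>)
        then show ?thesis
          by (simp add: step_fun_cell[OF part k])
      qed
      then have "AE t in Icc_measure 0 tf. norm (?D i t) \<le> \<eta>"
        by (intro AE_Icc_except_finite[of "{0}"]) auto
      then have "L2norm (Icc_measure 0 tf) (?D i) \<le> \<eta> * sqrt (measure (Icc_measure 0 tf) (space (Icc_measure 0 tf)))"
        using \<eta>(1)
        by (intro L2norm_le_AE_bound borel_measurable_diff step_fun_measurable measurable_Icc_continuous[OF F_cont]) auto
      also have "\<dots> \<le> \<eta> * C"
        using tf \<eta>(1) C by (simp add: mult_left_mono)
      finally show ?case
        using \<eta>(2) \<open>0 < e\<close> by simp
    qed
    then show "\<exists>n0. \<forall>i\<ge>n0. norm (L2norm (Icc_measure 0 tf) (?D i) - 0) < e"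
      by (simp add: eventually_sequentially)
  qed
qed

text \<open>The \<open>L\<^sup>2\<close> norm is continuous, so the convergence of the derivatives and of the
sampled drifts can be combined.\<close>

lemma discrete_energy_tendsto:
  fixes f :: "real \<Rightarrow> real^'n \<Rightarrow> real^'q \<Rightarrow> real^'m \<Rightarrow> real^'n" and A :: "real^'n^'k"
  assumes tf: "0 \<le> tf" and \<tau>: "\<And>i. is_partition tf (N i) (\<tau> i)"
    and mesh: "\<And>d. 0 < d \<Longrightarrow> \<forall>\<^sub>F i in sequentially. \<forall>k<N i. \<tau> i (Suc k) - \<tau> i k < d"
    and f: "uniformly_continuous_on ({0..tf} \<times> UNIV \<times> UNIV \<times> S) (\<lambda>(t, x, z, \<theta>). f t x z \<theta>)"
    and \<theta>: "\<theta> \<in> S" "\<And>i. \<theta>' i \<in> S" "\<theta>' \<longlonglongrightarrow> \<theta>"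
    and x: "\<And>i. x' i \<in> W2 tf" "x \<in> W2 tf" "limitin (W2_topology tf) x' x sequentially"
    and z: "continuous_on {0..tf} z" "uniform_limit {0..tf} z' z sequentially"
  shows "(\<lambda>i. L2norm (Icc_measure 0 tf) (\<lambda>t. A *v (weak_derivative tf (x' i) t -
      step_fun (N i) (\<tau> i) (\<lambda>k. f (\<tau> i k) (x' i (\<tau> i k)) (z' i (\<tau> i k)) (\<theta>' i)) t)))
    \<longlonglongrightarrow> L2norm (Icc_measure 0 tf) (\<lambda>t. A *v (weak_derivative tf x t - f t (x t) (z t) \<theta>))"
proof -
  let ?M = "Icc_measure 0 tf"
  define F where "F = (\<lambda>i. step_fun (N i) (\<tau> i) (\<lambda>k. f (\<tau> i k) (x' i (\<tau> i k)) (z' i (\<tau> i k)) (\<theta>' i)))"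
  define F0 where "F0 = (\<lambda>t. f t (x t) (z t) \<theta>)"
  define g where "g = (\<lambda>i. weak_derivative tf (x' i))"
  define g0 where "g0 = weak_derivative tf x"
  have A: "bounded_linear ((*v) A)"
    by (rule matrix_vector_mul_bounded_linear)
  note x_cont = W2_continuous[OF x(2)] W2_limit_imp_uniform_limit[OF tf x]
  have drift: "(\<lambda>i. L2norm ?M (\<lambda>t. F i t - F0 t)) \<longlonglongrightarrow> 0" "continuous_on {0..tf} F0"
    unfolding F_def F0_def
    by (rule sampled_drift_tendsto[OF tf \<tau> mesh f \<theta> x_cont z], assumption)+
  have sq: "square_integrable ?M (F i)" "square_integrable ?M F0" "square_integrable ?M (g i)"
    "square_integrable ?M g0" for i
    unfolding F_def g_def g0_def
    by (intro square_integrable_step_fun[OF \<tau>] square_integrable_Icc_continuous W2_weak_derivative(2)[OF tf]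
        x drift(2))+
  have bound: "\<bar>L2norm ?M (\<lambda>t. A *v (g i t - F i t)) - L2norm ?M (\<lambda>t. A *v (g0 t - F0 t))\<bar>
      \<le> onorm ((*v) A) * (L2norm ?M (\<lambda>t. g i t - g0 t) + L2norm ?M (\<lambda>t. F i t - F0 t))" for i
  proof -
    have "\<bar>L2norm ?M (\<lambda>t. A *v (g i t - F i t)) - L2norm ?M (\<lambda>t. A *v (g0 t - F0 t))\<bar>
        \<le> L2norm ?M (\<lambda>t. A *v (g i t - F i t) - A *v (g0 t - F0 t))"
      by (intro L2norm_triangle_diff square_integrable_linear[OF A] square_integrable_diff sq)
    also have "\<dots> = L2norm ?M (\<lambda>t. A *v ((g i t - g0 t) + - (F i t - F0 t)))"
    proof -
      have "(a - b) - (c - d) = (a - c) + - (b - d)" for a b c d :: "real^'n"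
        by simp
      then show ?thesis
        unfolding matrix_vector_mult_diff_distrib[symmetric] by metis
    qed
    also have "\<dots> \<le> onorm ((*v) A) * L2norm ?M (\<lambda>t. (g i t - g0 t) + - (F i t - F0 t))"
      by (intro L2norm_linear_le[OF A] square_integrable_add square_integrable_uminus square_integrable_diff sq)
    also have "L2norm ?M (\<lambda>t. (g i t - g0 t) + - (F i t - F0 t))
        \<le> L2norm ?M (\<lambda>t. g i t - g0 t) + L2norm ?M (\<lambda>t. - (F i t - F0 t))"
      by (intro L2norm_triangle square_integrable_uminus square_integrable_diff sq)
    finally show ?thesis
      using onorm_pos_le[OF A] unfolding L2norm_uminus[of ?M "\<lambda>t. F i t - F0 t"]
      by (simp add: mult_left_mono)
  qed
  have "(\<lambda>i. L2norm ?M (\<lambda>t. g i t - g0 t)) \<longlonglongrightarrow> 0"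
    using limitin_W2_topology[OF tf x(1,2)] x(3) by (simp add: g_def g0_def)
  from tendsto_mult_right_zero[OF tendsto_add_zero[OF this drift(1)]]
  have majorant: "(\<lambda>i. onorm ((*v) A) * (L2norm ?M (\<lambda>t. g i t - g0 t) + L2norm ?M (\<lambda>t. F i t - F0 t))) \<longlonglongrightarrow> 0"
    .
  have "(\<lambda>i. L2norm ?M (\<lambda>t. A *v (g i t - F i t)) - L2norm ?M (\<lambda>t. A *v (g0 t - F0 t))) \<longlonglongrightarrow> 0"
    by (rule Lim_null_comparison[OF _ majorant]) (simp add: bound)
  then show ?thesis
    by (simp add: LIM_zero_iff F_def F0_def g_def g0_def)
qed

section \<open>Hypo-convergence of the discretized log-posteriors\<close>

theorem theorem3p7:
  fixes tf :: real
    and M :: "'w measure" and \<E> :: "real \<Rightarrow> 'w measure"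
    and W X :: "real \<Rightarrow> 'w \<Rightarrow> real^'n" and Z :: "real \<Rightarrow> 'w \<Rightarrow> real^'q" and \<Theta> :: "'w \<Rightarrow> real^'m"
    and f :: "real \<Rightarrow> real^'n \<Rightarrow> real^'q \<Rightarrow> real^'m \<Rightarrow> real^'n"
    and h :: "real \<Rightarrow> real^'n \<Rightarrow> real^'q \<Rightarrow> real^'m \<Rightarrow> real^'q"
    and G :: "real^'n^'n"
    and \<pi> :: "real^'n \<Rightarrow> real^'q \<Rightarrow> real^'m \<Rightarrow> real"
    and Y :: "'w \<Rightarrow> 'y::metric_space" and y :: 'y and \<nu> :: "'y measure"
    and \<psi> :: "'y \<Rightarrow> (real \<Rightarrow> real^'n) \<Rightarrow> (real \<Rightarrow> real^'q) \<Rightarrow> real^'m \<Rightarrow> real"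
    and N :: "nat \<Rightarrow> nat" and \<tau> :: "nat \<Rightarrow> nat \<Rightarrow> real"
  assumes tf_pos: "0 < tf"
    and prob: "prob_space M" and filt: "is_filtration M \<E>" and wiener: "wiener_process M \<E> W"
    and sde: "solves_sde tf M \<E> W f h G X Z \<Theta>"
    and A1: "X 0 \<in> borel_measurable (\<E> 0)" "Z 0 \<in> borel_measurable (\<E> 0)"
      "\<Theta> \<in> borel_measurable (\<E> 0)"
    and A2: "\<And>a b c. 0 \<le> \<pi> a b c" "continuous_on UNIV (\<lambda>(a, b, c). \<pi> a b c)"
      "distributed M lborel (\<lambda>\<omega>. (X 0 \<omega>, Z 0 \<omega>, \<Theta> \<omega>)) (\<lambda>(a, b, c). ennreal (\<pi> a b c))"
    and A3: "uniformly_continuous_on ({0..tf} \<times> UNIV \<times> UNIV \<times> law_support M \<Theta>)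
        (\<lambda>(t, x, z, \<theta>). f t x z \<theta>)"
      "uniformly_continuous_on ({0..tf} \<times> UNIV \<times> UNIV \<times> law_support M \<Theta>)
        (\<lambda>(t, x, z, \<theta>). h t x z \<theta>)"
    and A4: "\<And>\<theta>. \<theta> \<in> law_support M \<Theta> \<Longrightarrow> lipschitz_state tf f \<theta>"
      "\<And>\<theta>. \<theta> \<in> law_support M \<Theta> \<Longrightarrow> lipschitz_state tf h \<theta>"
    and A5: "drift_C12 tf (law_support M \<Theta>) f"
    and A6: "rank G = CARD('n)"
    and A7: "(\<integral>\<^sup>+\<omega>. ennreal (exp (LINT t:{0..tf}|lborel.
        (norm (matrix_inv G *v f t (X t \<omega>) (Z t \<omega>) (\<Theta> \<omega>)))\<^sup>2)) \<partial>M) < \<infinity>"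
    and B1: "Y \<in> borel_measurable M"
    and B2: "sets \<nu> = sets borel" "conditional_density tf M X Z \<Theta> Y \<nu> \<psi>"
    and B3: "continuous_map
        (prod_topology (cont_paths_topology tf) (prod_topology (cont_paths_topology tf) euclidean))
        euclidean (\<lambda>(x, z, \<theta>). \<psi> y x z \<theta>)"
    and B4: "0 < (\<integral>\<^sup>+\<omega>. ennreal (\<psi> y (sample_path tf X \<omega>) (sample_path tf Z \<omega>) (\<Theta> \<omega>)) \<partial>M)"
    and partitions: "\<And>i. is_partition tf (N i) (\<tau> i)"
    and nested: "\<And>i. \<tau> i ` {..N i} \<subseteq> \<tau> (Suc i) ` {..N (Suc i)}"
    and mesh: "(\<lambda>i. Max ((\<lambda>k. \<tau> i (Suc k) - \<tau> i k) ` {..<N i})) \<longlonglongrightarrow> 0"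
  shows "hypo_converges
      (prod_topology (W2_topology tf) (prod_topology euclidean euclidean))
      (\<lambda>i. euler_log_posterior tf (N i) (\<tau> i) f h G \<pi> (\<psi> y))
      (energy_log_posterior tf f h G \<pi> (\<psi> y))"
proof -
  define S where "S = law_support M \<Theta>"
  define A where "A = matrix_inv G"
  let ?T = "prod_topology (W2_topology tf) (prod_topology euclidean euclidean) ::
    ((real \<Rightarrow> real^'n) \<times> (real^'q) \<times> (real^'m)) topology"
  let ?ell = "\<lambda>i. euler_log_posterior tf (N i) (\<tau> i) f h G \<pi> (\<psi> y)"
  let ?energy = "energy_log_posterior tf f h G \<pi> (\<psi> y)"
  have tf0: "0 \<le> tf" using tf_pos by simp
  have h_cont: "continuous_on ({0..tf} \<times> UNIV \<times> UNIV \<times> S) (\<lambda>(t, x, z, \<theta>). h t x z \<theta>)"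
    using uniformly_continuous_imp_continuous[OF A3(2)] by (simp add: S_def)

  \<comment> \<open>All assumptions on f and h are restricted to the support; a vanishing prior covers the rest.\<close>
  have support: "c \<in> S" if "\<pi> a b c \<noteq> 0" for a b c
  proof -
    have V: "distributed M lborel (\<lambda>\<omega>. (X 0 \<omega>, Z 0 \<omega>, \<Theta> \<omega>)) (\<lambda>v. ennreal ((\<lambda>(a, b, c). \<pi> a b c) v))"
      using A2(3) by (simp add: case_prod_unfold)
    have "0 < (\<lambda>(a, b, c). \<pi> a b c) (a, b, c)"
      using that A2(1)[of a b c] by simp
    from positive_density_imp_law_support[OF V A2(2) this, of "\<lambda>v. snd (snd v)"] show ?thesis
      by (simp add: S_def continuous_on_snd)
  qed
  have prior_tendsto: "(\<lambda>i. \<pi> (a' i) (b' i) (c' i)) \<longlonglongrightarrow> \<pi> a b c"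
    if "a' \<longlonglongrightarrow> a" "b' \<longlonglongrightarrow> b" "c' \<longlonglongrightarrow> c" for a' b' c' a b c
    using continuous_on_tendsto_compose[OF A2(2) tendsto_Pair[OF that(1) tendsto_Pair[OF that(2,3)]]] by simp
  have likelihood_nonneg: "0 \<le> \<psi> y x z \<theta>" if "x \<in> cont_paths tf" "z \<in> cont_paths tf" for x z \<theta>
    using B2(2) that unfolding conditional_density_def by blast
  have mesh': "\<forall>\<^sub>F i in sequentially. \<forall>k<N i. \<tau> i (Suc k) - \<tau> i k < d" if "0 < d" for d
  proof -
    have "\<forall>\<^sub>F i in sequentially. Max ((\<lambda>k. \<tau> i (Suc k) - \<tau> i k) ` {..<N i}) < d"
      using mesh that by (intro order_tendstoD)
    then show ?thesis
    proof eventually_elim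
      case (elim i)
      show ?case
      proof (intro allI impI)
        fix k assume "k < N i"
        then have "\<tau> i (Suc k) - \<tau> i k \<le> Max ((\<lambda>k. \<tau> i (Suc k) - \<tau> i k) ` {..<N i})"
          by (intro Max_ge) auto
        with elim show "\<tau> i (Suc k) - \<tau> i k < d" by simp
      qed
    qed
  qed

  define e where "e = (\<lambda>i. euler_path tf (N i) (\<tau> i) h :: (real \<Rightarrow> real^'n) \<Rightarrow> real^'q \<Rightarrow> real^'m \<Rightarrow> real \<Rightarrow> real^'q)"
  \<comment> \<open>J and ell extend the discrete energy and log-posterior from piecewise linear paths to the Sobolev
    space.\<close>
  define J where "J = (\<lambda>i x \<zeta> \<theta>. L2norm (Icc_measure 0 tf) (\<lambda>t. A *v (weak_derivative tf x t -
      step_fun (N i) (\<tau> i) (\<lambda>k. f (\<tau> i k) (x (\<tau> i k)) (e i x \<zeta> \<theta> (\<tau> i k)) \<theta>) t)))"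
  define ell where "ell = (\<lambda>i x \<zeta> \<theta>. eln (\<psi> y x (e i x \<zeta> \<theta>) \<theta>) + eln (\<pi> (x 0) \<zeta> \<theta>) - ereal (1/2 * (J i x \<zeta> \<theta>)\<^sup>2))"
  have ell_PL: "?ell i (x, \<zeta>, \<theta>) = ell i x \<zeta> \<theta>" if "x \<in> PL tf (N i) (\<tau> i)" for i x \<zeta> \<theta>
    using that PL_energy_eq_L2norm[OF tf0 partitions that, of A "\<lambda>k. f (\<tau> i k) (x (\<tau> i k)) (e i x \<zeta> \<theta> (\<tau> i k)) \<theta>"]
    by (simp add: euler_log_posterior_def ell_def J_def e_def A_def Let_def)
  have ell_not_PL: "?ell i (x, \<zeta>, \<theta>) = -\<infinity>" if "x \<notin> PL tf (N i) (\<tau> i)" for i x \<zeta> \<theta>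
    using that by (simp add: euler_log_posterior_def)
  have ell_outside: "?ell i (x, \<zeta>, \<theta>) = -\<infinity>" if "\<theta> \<notin> S" for i x \<zeta> \<theta>
  proof (cases "x \<in> PL tf (N i) (\<tau> i)")
    case True
    have "\<pi> (x 0) \<zeta> \<theta> = 0" using support that by blast
    then show ?thesis
      unfolding ell_PL[OF True] ell_def by (simp add: eln_def minus_ereal_def)
  qed (rule ell_not_PL)

  have ell_tendsto: "(\<lambda>i. ell i (x' i) (\<zeta>' i) (\<theta>' i)) \<longlonglongrightarrow> ?energy (x, \<zeta>, \<theta>)"
    if \<theta>: "\<theta> \<in> S" "\<And>i. \<theta>' i \<in> S" "\<theta>' \<longlonglongrightarrow> \<theta>" and \<zeta>: "\<zeta>' \<longlonglongrightarrow> \<zeta>"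
      and x: "\<And>i. x' i \<in> W2 tf" "x \<in> W2 tf" "limitin (W2_topology tf) x' x sequentially"
    for x' x \<zeta>' \<zeta> \<theta>' \<theta>
  proof -
    define z where "z = ode_path tf h x \<zeta> \<theta>"
    have lip: "lipschitz_state tf h \<theta>" using A4(2) \<theta>(1) by (simp add: S_def)
    note uniform_x = W2_limit_imp_uniform_limit[OF tf0 x]
    have z_W2: "z \<in> W2 tf"
      unfolding z_def by (rule ode_path_solves(1)[OF tf0 W2_continuous[OF x(2)] \<theta>(1) h_cont lip])
    have uniform_z: "uniform_limit {0..tf} (\<lambda>i. e i (x' i) (\<zeta>' i) (\<theta>' i)) z sequentially"
      unfolding e_def z_def
      by (rule euler_path_uniform_limit[OF tf_pos partitions mesh' A3(2)[folded S_def] lip \<theta> \<zeta>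
            W2_continuous[OF x(2)] uniform_x])
    have e_cont: "e i x \<zeta> \<theta> \<in> cont_paths tf" for i x \<zeta> \<theta>
      using euler_path_PL[OF tf0 partitions, of i h x \<zeta> \<theta>] by (simp add: e_def PL_def)
    have likelihood: "(\<lambda>i. \<psi> y (x' i) (e i (x' i) (\<zeta>' i) (\<theta>' i)) (\<theta>' i)) \<longlonglongrightarrow> \<psi> y x z \<theta>"
      by (rule continuous_likelihood_tendsto[OF tf0 B3 W2_cont_paths[OF x(1)] W2_cont_paths[OF x(2)] uniform_x
            e_cont W2_cont_paths[OF z_W2] uniform_z \<theta>(3)])
    have prior: "(\<lambda>i. \<pi> (x' i 0) (\<zeta>' i) (\<theta>' i)) \<longlonglongrightarrow> \<pi> (x 0) \<zeta> \<theta>"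
      using x limitin_W2_topology[OF tf0 x(1,2)] by (intro prior_tendsto \<zeta> \<theta>) simp
    have energy: "(\<lambda>i. 1/2 * (J i (x' i) (\<zeta>' i) (\<theta>' i))\<^sup>2) \<longlonglongrightarrow>
        1/2 * (L2norm (Icc_measure 0 tf) (\<lambda>t. A *v (weak_derivative tf x t - f t (x t) (z t) \<theta>)))\<^sup>2"
      unfolding J_def
      by (intro tendsto_intros
          discrete_energy_tendsto[OF tf0 partitions mesh' A3(1)[folded S_def] \<theta> x W2_continuous[OF z_W2] uniform_z])
    have limit: "?energy (x, \<zeta>, \<theta>) = eln (\<psi> y x z \<theta>) + eln (\<pi> (x 0) \<zeta> \<theta>) -
        ereal (1/2 * (L2norm (Icc_measure 0 tf) (\<lambda>t. A *v (weak_derivative tf x t - f t (x t) (z t) \<theta>)))\<^sup>2)"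
      by (simp add: energy_log_posterior_def L2norm_power2 set_integral_Icc z_def A_def Let_def eln_def minus_ereal_def)
    show ?thesis
      unfolding limit ell_def
      by (intro log_posterior_tendsto likelihood prior energy likelihood_nonneg A2(1) e_cont
          W2_cont_paths[OF x(1)] W2_cont_paths[OF x(2)] W2_cont_paths[OF z_W2])
  qed

  have limsup: "limsup (\<lambda>i. ?ell i (u i)) \<le> ?energy l"
    if u: "\<And>i. u i \<in> topspace ?T" and lim: "limitin ?T u l sequentially" for u l
  proof -
    obtain x \<zeta> \<theta> where l: "l = (x, \<zeta>, \<theta>)" by (cases l)
    define x' where "x' = fst \<circ> u"
    define \<zeta>' where "\<zeta>' = (\<lambda>i. fst (snd (u i)))"
    define \<theta>' where "\<theta>' = (\<lambda>i. snd (snd (u i)))"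
    have u_eq: "u i = (x' i, \<zeta>' i, \<theta>' i)" for i
      by (simp add: x'_def \<zeta>'_def \<theta>'_def)
    have lims: "limitin (W2_topology tf) x' x sequentially" "\<zeta>' \<longlonglongrightarrow> \<zeta>" "\<theta>' \<longlonglongrightarrow> \<theta>"
      using lim tendsto_fst[of "\<lambda>i. snd (u i)" "(\<zeta>, \<theta>)"] tendsto_snd[of "\<lambda>i. snd (u i)" "(\<zeta>, \<theta>)"]
      by (simp_all add: l limitin_pairwise o_def x'_def \<zeta>'_def \<theta>'_def)
    have x_W2: "x' i \<in> W2 tf" "x \<in> W2 tf" for i
      using u[of i] limitin_topspace[OF lims(1)] tf0 by (simp_all add: u_eq)
    show ?thesis
    proof (cases "\<theta> \<in> S")
      case True
      \<comment> \<open>Replacing parameters outside the support by the limit keeps convergence and only increases the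
        value.\<close>
      define \<theta>'' where "\<theta>'' = (\<lambda>i. if \<theta>' i \<in> S then \<theta>' i else \<theta>)"
      have \<theta>'': "\<theta>'' i \<in> S" for i using True by (simp add: \<theta>''_def)
      have "\<theta>'' \<longlonglongrightarrow> \<theta>"
      proof (rule metric_tendsto_imp_tendsto[OF lims(3)])
        show "\<forall>\<^sub>F i in sequentially. dist (\<theta>'' i) \<theta> \<le> dist (\<theta>' i) \<theta>"
          by (simp add: \<theta>''_def)
      qed
      from ell_tendsto[OF True \<theta>'' this lims(2) x_W2 lims(1)]
      have "limsup (\<lambda>i. ell i (x' i) (\<zeta>' i) (\<theta>'' i)) = ?energy l"
        unfolding l by (intro lim_imp_Limsup) auto
      moreover have "?ell i (u i) \<le> ell i (x' i) (\<zeta>' i) (\<theta>'' i)" for i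
      proof (cases "x' i \<in> PL tf (N i) (\<tau> i) \<and> \<theta>' i \<in> S")
        case True
        then show ?thesis unfolding u_eq \<theta>''_def by (simp add: ell_PL)
      next
        case False
        then show ?thesis unfolding u_eq using ell_not_PL ell_outside by auto
      qed
      then have "limsup (\<lambda>i. ?ell i (u i)) \<le> limsup (\<lambda>i. ell i (x' i) (\<zeta>' i) (\<theta>'' i))"
        by (intro Limsup_mono always_eventually allI)
      ultimately show ?thesis by simp
    next
      case False
      have "open (- S)"
        unfolding S_def by (intro open_Compl closed_law_support)
      then have "\<forall>\<^sub>F i in sequentially. \<theta>' i \<in> - S"
        using False lims(3) by (auto dest: topological_tendstoD)
      then have "\<forall>\<^sub>F i in sequentially. ?ell i (u i) \<le> -\<infinity>"
        by eventually_elim (simp add: u_eq ell_outside)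
      from Limsup_bounded[OF this] show ?thesis
        by (rule order_trans) simp
    qed
  qed

  \<comment> \<open>Piecewise linear interpolation recovers the limit when the parameter is in the support; otherwise
    the limit value is -\<infinity> and the constant sequence will do.\<close>
  have recovery: "\<exists>u. (\<forall>i. u i \<in> topspace ?T) \<and> limitin ?T u l sequentially \<and>
      ?energy l \<le> liminf (\<lambda>i. ?ell i (u i))" if l_top: "l \<in> topspace ?T" for l
  proof -
    obtain x \<zeta> \<theta> where l: "l = (x, \<zeta>, \<theta>)" by (cases l)
    have x: "x \<in> W2 tf" using l_top tf0 by (simp add: l)
    show ?thesis
    proof (cases "\<theta> \<in> S")
      case True
      define p where "p = (\<lambda>i. pl_interpolant tf (N i) (\<tau> i) x)"
      have p: "p i \<in> PL tf (N i) (\<tau> i)" "p i \<in> W2 tf" for i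
        unfolding p_def using pl_interpolant_PL[OF tf0 partitions] PL_subset_W2[OF tf0 partitions] by auto
      have p_lim: "limitin (W2_topology tf) p x sequentially"
        unfolding p_def by (rule pl_interpolant_tendsto[OF tf0 partitions mesh' x])
      have "(\<lambda>i. ?ell i (p i, \<zeta>, \<theta>)) \<longlonglongrightarrow> ?energy l"
        unfolding ell_PL[OF p(1)] l by (intro ell_tendsto True p x p_lim tendsto_const)
      then have "liminf (\<lambda>i. ?ell i (p i, \<zeta>, \<theta>)) = ?energy l"
        by (intro lim_imp_Liminf) auto
      moreover have "limitin ?T (\<lambda>i. (p i, \<zeta>, \<theta>)) l sequentially"
        using p_lim by (simp add: l limitin_pairwise o_def)
      ultimately show ?thesis
        using p(2) tf0 by (intro exI[of _ "\<lambda>i. (p i, \<zeta>, \<theta>)"]) simp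
    next
      case False
      then have "\<pi> (x 0) \<zeta> \<theta> = 0" using support by blast
      then have "?energy l = -\<infinity>" by (simp add: l energy_log_posterior_def)
      with l_top show ?thesis
        by (intro exI[of _ "\<lambda>_. l"]) (simp add: limitin_const_iff)
    qed
  qed
  show ?thesis
    unfolding hypo_converges_def using limsup recovery by blast
qed

end
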